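(* Let $X_t=g(\varepsilon_t,\varepsilon_{t-1},\ldots)$, $t\in\mathbb Z$, be a real-valued Bernoulli shift, where $\{\varepsilon_t\}_{t\in\mathbb Z}$ is a sequence of iid random elements of a measurable space $S$ and $g:S^\infty\to\mathbb R$ is measurable. Assume that $\operatorname E X_0=0$, $\operatorname E|X_0|^4<\infty$, and $\Theta_4=\sum_{t=0}^\infty\|X_t-X_{t,\{0\}}\|_4<\infty$. Let $f(0)>0$, where $f$ is the spectral density of $\{X_t\}$, and let $m=m_n$ be a sequence of positive integers with $m\to\infty$ and $m=o(n)$ as $n\to\infty$. Suppose that $\kappa_m=(\kappa_{1,m},\ldots,\kappa_{m,m})\in\mathbb R^m\setminus\{0\}$, $m\ge1$, are such that, with $m=m_n$ and $\omega_j=2\pi j/n$, $$\frac{\|\kappa_m\|_4}{\|\kappa_m\|_2}\to0\quad\text{and}\quad\frac{\sum_{j=1}^m\kappa_{j,m}^2\sin^2(\omega_j/2)}{\|\kappa_m\|_2^2}\to0\quad\text{as }n\to\infty .$$ Let $$W_n=\frac1{\|\kappa_m\|_2^2}\sum_{j=1}^m\kappa_{j,m}I_n(\omega_j).$$ Then $$\frac{\|\kappa_m\|_2}{f(0)}\,(W_n-\operatorname E W_n)\xrightarrow{d}\mathcal N(0,1)\quad\text{as }n\to\infty .$$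
   Context: For a random variable, $\|X\|_p=(\operatorname E|X|^p)^{1/p}$; for the vector $\kappa_m$, $\|\kappa_m\|_p=(|\kappa_{1,m}|^p+\cdots+|\kappa_{m,m}|^p)^{1/p}$. Let $\{\varepsilon_t'\}_{t\in\mathbb Z}$ be an independent copy of $\{\varepsilon_t\}_{t\in\mathbb Z}$; $X_{t,\{0\}}=g(\varepsilon_t,\ldots,\varepsilon_1,\varepsilon_0',\varepsilon_{-1},\ldots)$ is obtained from $X_t$ by replacing $\varepsilon_0$ by $\varepsilon_0'$. The spectral density is $f(\omega)=\frac1{2\pi}\sum_{h=-\infty}^\infty\operatorname{Cov}(X_h,X_0)e^{-ih\omega}$ (autocovariances are absolutely summable under the assumptions). The periodogram of $X_1,\ldots,X_n$ is $I_n(\omega_j)=\bigl|\frac1{\sqrt{2\pi n}}\sum_{t=1}^nX_te^{-it\omega_j}\bigr|^2$. $\xrightarrow{d}$ denotes convergence in distribution. *)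

theory Defs
  imports "HOL-Probability.Probability" "HOL-Library.Landau_Symbols"
begin

definition rv_norm :: "'w measure \<Rightarrow> real \<Rightarrow> ('w \<Rightarrow> real) \<Rightarrow> real" where
  "rv_norm M p X = (\<integral>w. \<bar>X w\<bar> powr p \<partial>M) powr (1 / p)"

text \<open>A vector of \<open>\<real>\<^sup>m\<close> is given by the values at \<open>1, \<dots>, m\<close> of a function on \<^typ>\<open>nat\<close>.\<close>

definition vec_norm :: "real \<Rightarrow> nat \<Rightarrow> (nat \<Rightarrow> real) \<Rightarrow> real" where
  "vec_norm p m v = (\<Sum>j=1..m. \<bar>v j\<bar> powr p) powr (1 / p)"

definition iid :: "'w measure \<Rightarrow> 's measure \<Rightarrow> (int \<Rightarrow> 'w \<Rightarrow> 's) \<Rightarrow> bool" where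
  "iid M S \<epsilon> \<longleftrightarrow>
     prob_space.indep_vars M (\<lambda>_. S) \<epsilon> UNIV \<and> (\<forall>s t. distr M S (\<epsilon> s) = distr M S (\<epsilon> t))"

definition independent_copy ::
    "'w measure \<Rightarrow> 's measure \<Rightarrow> (int \<Rightarrow> 'w \<Rightarrow> 's) \<Rightarrow> (int \<Rightarrow> 'w \<Rightarrow> 's) \<Rightarrow> bool" where
  "independent_copy M S \<epsilon> \<epsilon>' \<longleftrightarrow>
     (let P = (\<Pi>\<^sub>M t\<in>UNIV. S) in
       prob_space.indep_var M P (\<lambda>w t. \<epsilon> t w) P (\<lambda>w t. \<epsilon>' t w) \<and>
       distr M P (\<lambda>w t. \<epsilon>' t w) = distr M P (\<lambda>w t. \<epsilon> t w))"

definition bernoulli_shift ::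
    "((nat \<Rightarrow> 's) \<Rightarrow> real) \<Rightarrow> (int \<Rightarrow> 'w \<Rightarrow> 's) \<Rightarrow> int \<Rightarrow> 'w \<Rightarrow> real" where
  "bernoulli_shift g \<epsilon> t w = g (\<lambda>k. \<epsilon> (t - int k) w)"

definition coupled_shift ::
    "((nat \<Rightarrow> 's) \<Rightarrow> real) \<Rightarrow> (int \<Rightarrow> 'w \<Rightarrow> 's) \<Rightarrow> (int \<Rightarrow> 'w \<Rightarrow> 's) \<Rightarrow> int \<Rightarrow> 'w \<Rightarrow> real" where
  "coupled_shift g \<epsilon> \<epsilon>' = bernoulli_shift g (\<epsilon>(0 := \<epsilon>' 0))"

definition covariance :: "'w measure \<Rightarrow> ('w \<Rightarrow> real) \<Rightarrow> ('w \<Rightarrow> real) \<Rightarrow> real" where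
  "covariance M X Y = (\<integral>w. (X w - (\<integral>u. X u \<partial>M)) * (Y w - (\<integral>u. Y u \<partial>M)) \<partial>M)"

text \<open>For a stationary process the autocovariance is even in \<open>h\<close>, so the sum is real and
  taking the real part only changes the type.\<close>

definition spectral_density :: "'w measure \<Rightarrow> (int \<Rightarrow> 'w \<Rightarrow> real) \<Rightarrow> real \<Rightarrow> real" where
  "spectral_density M X \<omega> =
     Re (1 / (2 * of_real pi) *
         (\<Sum>\<^sub>\<infinity>h\<in>UNIV. of_real (covariance M (X h) (X 0)) * exp (- (\<i> * of_int h * of_real \<omega>))))"

definition periodogram :: "(int \<Rightarrow> 'w \<Rightarrow> real) \<Rightarrow> nat \<Rightarrow> real \<Rightarrow> 'w \<Rightarrow> real" where
  "periodogram X n \<omega> w =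
     (cmod (1 / of_real (sqrt (2 * pi * real n)) *
            (\<Sum>t=1..n. of_real (X (int t) w) * exp (- (\<i> * of_nat t * of_real \<omega>)))))\<^sup>2"

definition fourier_freq :: "nat \<Rightarrow> nat \<Rightarrow> real" where
  "fourier_freq n j = 2 * pi * real j / real n"

definition weighted_periodogram ::
    "(int \<Rightarrow> 'w \<Rightarrow> real) \<Rightarrow> nat \<Rightarrow> nat \<Rightarrow> (nat \<Rightarrow> real) \<Rightarrow> 'w \<Rightarrow> real" where
  "weighted_periodogram X n m v w =
     1 / (vec_norm 2 m v)\<^sup>2 * (\<Sum>j=1..m. v j * periodogram X n (fourier_freq n j) w)"

end

(* The normalized statistic is a centred quadratic form in X_1, ..., X_n with the Toeplitz matrix
   a(s,t) = K(s-t), K(h) = (2 pi n |kappa|_2)^(-1) sum_j kappa_j cos(h omega_j). By orthogonality at the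
   Fourier frequencies a has Frobenius norm (8 pi^2)^(-1/2) and a*a has Frobenius norm of the order
   (|kappa|_4 / |kappa|_2)^2. The Efron-Stein inequality, with coordinates of the innovation sequence
   resampled one at a time, bounds the L2 norm of a centred bilinear form sum c(s,t) X_s Y_t by a
   constant times Theta(X) Theta(Y) |c|_F. Hence X may be replaced by its projection on the last l
   innovations, and a by its block averages over long blocks of times separated by gaps of length l,
   since m = o(n) makes a nearly constant on blocks. The new form sum_k B_k V_k is built from
   independent identically distributed block sums B_k, where V_k is independent of B_k, and the
   Stein-Tikhomirov method shows that its characteristic function nearly satisfies
   phi' = -2 s u phi, because sum_k V_k^2 is a quadratic form with matrix a*a, whose Frobenius norm is
   small. *)
theory Submission
  imports Defs
begin

subsection \<open>Norms of random variables\<close>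

text \<open>Stein's method needs exact independence: in Q = U_k + 2 B_k V_k the sum B_k must be
  independent of the pair (U_k, V_k). This dictates the surgery on the form. Truncation to l
  innovations makes blocks behind gaps of length l independent, deleting the diagonal blocks removes
  B_k from V_k, and averaging over pairs of blocks leaves a function of the block sums alone, so
  that only their variance matters; divided by the block length it tends to 2 pi f(0). All kernel
  errors are measured in the Frobenius norm, the only feature of a kernel that the L2 bound for
  bilinear forms sees. The limits are taken in the order n to infinity, with l and the period L = (l
  + 1)^2 of the blocks fixed, and then l to infinity. For fixed L the third-order remainders are at
  most n terms of order n^(-3/2). Constants: the kernel has squared Frobenius norm 1/(8 pi^2), so s
  = (2 pi f(0))^2 / (8 pi^2) = f(0)^2 / 2, and exp(-s u^2) belongs to the variance f(0)^2, which the
  division by f(0) turns into 1. The work is done on a product space of two-sided sequences, where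
  replacing innovations by an independent copy is a measure preserving exchange of
  coordinates.\<close>

definition Lp_fun :: "'a measure \<Rightarrow> nat \<Rightarrow> ('a \<Rightarrow> real) \<Rightarrow> bool" where
  "Lp_fun M p f \<longleftrightarrow> f \<in> borel_measurable M \<and> integrable M (\<lambda>x. \<bar>f x\<bar> ^ p)"

text \<open>Integer exponents and \<open>root\<close> suit the algebra of second, third and fourth
  powers better than the real powers of \<open>rv_norm\<close>. A non-integrable power gives the
  default value 0, so inequalities between norms need \<open>Lp_fun\<close>.\<close>

definition Lp_norm :: "'a measure \<Rightarrow> nat \<Rightarrow> ('a \<Rightarrow> real) \<Rightarrow> real" where
  "Lp_norm M p f = root p (\<integral>x. \<bar>f x\<bar> ^ p \<partial>M)"

lemma Lp_fun_measurable [measurable_dest]: "Lp_fun M p f \<Longrightarrow> f \<in> borel_measurable M"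
  by (simp add: Lp_fun_def)

lemma Lp_fun_integrable: "Lp_fun M p f \<Longrightarrow> integrable M (\<lambda>x. \<bar>f x\<bar> ^ p)"
  by (simp add: Lp_fun_def)

lemma Lp_norm_nonneg [simp]: "Lp_norm M p f \<ge> 0"
  by (simp add: Lp_norm_def real_root_ge_zero)

lemma Lp_norm_power: "p > 0 \<Longrightarrow> Lp_norm M p f ^ p = (\<integral>x. \<bar>f x\<bar> ^ p \<partial>M)"
  by (simp add: Lp_norm_def)

lemma Lp_norm_leI:
  assumes "p > 0" "(\<integral>x. \<bar>f x\<bar> ^ p \<partial>M) \<le> c ^ p" "c \<ge> 0"
  shows "Lp_norm M p f \<le> c"
  using assms by (metis Lp_norm_nonneg Lp_norm_power power_mono_iff)

lemma Lp_fun_minus: "Lp_fun M p f \<Longrightarrow> Lp_fun M p (\<lambda>x. - f x)"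
  by (simp add: Lp_fun_def)

lemma Lp_norm_minus: "Lp_norm M p (\<lambda>x. - f x) = Lp_norm M p f"
  by (simp add: Lp_norm_def)

lemma Lp_fun_cmult: "Lp_fun M p f \<Longrightarrow> Lp_fun M p (\<lambda>x. c * f x)"
  by (auto simp: Lp_fun_def abs_mult power_mult_distrib)

lemma Lp_norm_cmult: "p > 0 \<Longrightarrow> Lp_norm M p (\<lambda>x. c * f x) = \<bar>c\<bar> * Lp_norm M p f"
  by (simp add: Lp_norm_def abs_mult power_mult_distrib real_root_mult real_root_power_cancel)

lemma Lp_fun_add:
  assumes "Lp_fun M p f" "Lp_fun M p g"
  shows "Lp_fun M p (\<lambda>x. f x + g x)"
proof -
  have [measurable]: "f \<in> borel_measurable M" "g \<in> borel_measurable M"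
    using assms by (auto simp: Lp_fun_def)
  have "integrable M (\<lambda>x. 2 ^ p * (\<bar>f x\<bar> ^ p + \<bar>g x\<bar> ^ p))"
    using assms by (simp add: Lp_fun_def)
  then have "integrable M (\<lambda>x. \<bar>f x + g x\<bar> ^ p)"
  proof (rule Bochner_Integration.integrable_bound)
    show "AE x in M. norm (\<bar>f x + g x\<bar> ^ p) \<le> norm (2 ^ p * (\<bar>f x\<bar> ^ p + \<bar>g x\<bar> ^ p))"
    proof (intro AE_I2)
      fix x
      have "\<bar>f x + g x\<bar> ^ p \<le> (2 * max \<bar>f x\<bar> \<bar>g x\<bar>) ^ p"
        by (intro power_mono) auto
      also have "\<dots> \<le> 2 ^ p * (\<bar>f x\<bar> ^ p + \<bar>g x\<bar> ^ p)"
        by (auto simp: power_mult_distrib max_def)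
      finally show "norm (\<bar>f x + g x\<bar> ^ p) \<le> norm (2 ^ p * (\<bar>f x\<bar> ^ p + \<bar>g x\<bar> ^ p))"
        by simp
    qed
  qed simp
  then show ?thesis by (simp add: Lp_fun_def)
qed

lemma Lp_fun_diff: "Lp_fun M p f \<Longrightarrow> Lp_fun M p g \<Longrightarrow> Lp_fun M p (\<lambda>x. f x - g x)"
  using Lp_fun_add[of M p f "\<lambda>x. - g x"] Lp_fun_minus[of M p g] by simp

lemma Lp_fun_0: "p > 0 \<Longrightarrow> Lp_fun M p (\<lambda>x. 0)"
  by (simp add: Lp_fun_def zero_power)

lemma Lp_norm_0: "p > 0 \<Longrightarrow> Lp_norm M p (\<lambda>x. 0) = 0"
  by (simp add: Lp_norm_def zero_power)

lemma Lp_fun_sum: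
  "p > 0 \<Longrightarrow> (\<And>i. i \<in> I \<Longrightarrow> Lp_fun M p (f i)) \<Longrightarrow> Lp_fun M p (\<lambda>x. \<Sum>i\<in>I. f i x)"
  by (induction I rule: infinite_finite_induct) (auto intro: Lp_fun_add Lp_fun_0)

text \<open>Convexity of the p-th power, applied to |f|/a and |g|/b with the weights a/(a+b) and
  b/(a+b). The numbers a and b exceed the norms by e/2, so a vanishing norm needs no separate
  case.\<close>

lemma Minkowski:
  assumes "p > 0" and f: "Lp_fun M p f" and g: "Lp_fun M p g"
  shows "Lp_norm M p (\<lambda>x. f x + g x) \<le> Lp_norm M p f + Lp_norm M p g"
proof (rule field_le_epsilon)
  fix e :: real assume "e > 0"
  define a where "a = Lp_norm M p f + e / 2"
  define b where "b = Lp_norm M p g + e / 2"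
  have ab: "a > 0" "b > 0" "Lp_norm M p f \<le> a" "Lp_norm M p g \<le> b"
    using \<open>e > 0\<close> Lp_norm_nonneg[of M p f] Lp_norm_nonneg[of M p g] by (auto simp: a_def b_def intro: add_nonneg_pos)
  define u where "u = a / (a + b)"
  have u: "0 \<le> u" "u \<le> 1" "1 - u = b / (a + b)" using ab by (auto simp: u_def field_simps)
  have pw: "\<bar>f x + g x\<bar> ^ p \<le> (a + b) ^ p * (u * (\<bar>f x\<bar> ^ p / a ^ p) + (1 - u) * (\<bar>g x\<bar> ^ p / b ^ p))" for x
  proof -
    have conv: "convex_on {0::real..} (\<lambda>x. x ^ p)"
      using convex_on_subset[OF convex_power_even, of p "{0..}"] convex_power_odd[of p]
      by (cases "even p") auto
    have "((1-(1 - u)) *\<^sub>R (\<bar>f x\<bar> / a) + (1 - u) *\<^sub>R (\<bar>g x\<bar> / b)) ^ p \<le> (1-(1-u)) * (\<bar>f x\<bar> / a) ^ p + (1 - u) * (\<bar>g x\<bar> / b) ^ p"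
      using u ab by (intro convex_onD[OF conv]) auto
    moreover have "(1-(1 - u)) *\<^sub>R (\<bar>f x\<bar> / a) + (1 - u) *\<^sub>R (\<bar>g x\<bar> / b) = (\<bar>f x\<bar> + \<bar>g x\<bar>) / (a + b)"
    proof -
      have "u * (\<bar>f x\<bar> / a) = \<bar>f x\<bar> / (a + b)" "(1 - u) * (\<bar>g x\<bar> / b) = \<bar>g x\<bar> / (a + b)"
        using ab unfolding u(3) by (simp_all add: u_def)
      then show ?thesis by (simp add: add_divide_distrib)
    qed
    ultimately have "((\<bar>f x\<bar> + \<bar>g x\<bar>) / (a + b)) ^ p \<le> u * (\<bar>f x\<bar> / a) ^ p + (1 - u) * (\<bar>g x\<bar> / b) ^ p"
      by simp
    then have *: "(\<bar>f x\<bar> + \<bar>g x\<bar>) ^ p \<le> (a + b) ^ p * (u * (\<bar>f x\<bar> / a) ^ p + (1 - u) * (\<bar>g x\<bar> / b) ^ p)"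
      using ab by (simp add: power_divide field_simps)
    have "\<bar>f x + g x\<bar> ^ p \<le> (\<bar>f x\<bar> + \<bar>g x\<bar>) ^ p" by (intro power_mono) auto
    with * show ?thesis by (simp add: power_divide)
  qed
  have "(\<integral>x. \<bar>f x + g x\<bar> ^ p \<partial>M) \<le> (\<integral>x. (a + b) ^ p * (u * (\<bar>f x\<bar> ^ p / a ^ p) + (1 - u) * (\<bar>g x\<bar> ^ p / b ^ p)) \<partial>M)"
    using pw Lp_fun_integrable[OF Lp_fun_add[OF f g]] f g
    by (intro integral_mono) (auto simp: Lp_fun_def)
  also have "\<dots> = (a + b) ^ p * (u * (Lp_norm M p f ^ p / a ^ p) + (1 - u) * (Lp_norm M p g ^ p / b ^ p))"
    using f g \<open>p > 0\<close> by (simp add: Lp_norm_power Lp_fun_def)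
  also have "\<dots> \<le> (a + b) ^ p * (u * 1 + (1 - u) * 1)"
    using ab u by (intro mult_left_mono add_mono) (auto simp: divide_le_eq intro: power_mono)
  also have "\<dots> = (a + b) ^ p" by simp
  finally have "Lp_norm M p (\<lambda>x. f x + g x) \<le> a + b"
    using \<open>p > 0\<close> ab by (intro Lp_norm_leI) auto
  then show "Lp_norm M p (\<lambda>x. f x + g x) \<le> Lp_norm M p f + Lp_norm M p g + e"
    by (simp add: a_def b_def)
qed

lemma Minkowski_diff:
  assumes "p > 0" "Lp_fun M p f" "Lp_fun M p g"
  shows "Lp_norm M p (\<lambda>x. f x - g x) \<le> Lp_norm M p f + Lp_norm M p g"
  using Minkowski[OF assms(1,2) Lp_fun_minus[OF assms(3)]] by (simp add: Lp_norm_minus)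

lemma Minkowski_sum:
  assumes "p > 0" "\<And>i. i \<in> I \<Longrightarrow> Lp_fun M p (f i)"
  shows "Lp_norm M p (\<lambda>x. \<Sum>i\<in>I. f i x) \<le> (\<Sum>i\<in>I. Lp_norm M p (f i))"
  using assms(2)
proof (induction I rule: infinite_finite_induct)
  case (insert i I)
  then show ?case
    using Minkowski[OF assms(1), of M "f i" "\<lambda>x. \<Sum>i\<in>I. f i x"] Lp_fun_sum[OF assms(1), of I M f] by force
qed (auto simp: Lp_norm_0 assms)

lemma integrable_mult_of_squares:
  fixes f g :: "'a \<Rightarrow> real"
  assumes "Lp_fun M 2 f" "Lp_fun M 2 g"
  shows "integrable M (\<lambda>x. f x * g x)"
proof (rule Bochner_Integration.integrable_bound)
  show "integrable M (\<lambda>x. \<bar>f x\<bar> ^ 2 + \<bar>g x\<bar> ^ 2)" using assms by (auto simp: Lp_fun_def)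
  show "(\<lambda>x. f x * g x) \<in> borel_measurable M" using assms by (auto simp: Lp_fun_def)
  have "\<bar>f x * g x\<bar> \<le> \<bar>f x\<bar> ^ 2 + \<bar>g x\<bar> ^ 2" for x
  proof -
    have "2 * (\<bar>f x\<bar> * \<bar>g x\<bar>) \<le> \<bar>f x\<bar> ^ 2 + \<bar>g x\<bar> ^ 2"
      using sum_squares_bound[of "\<bar>f x\<bar>" "\<bar>g x\<bar>"] by (simp add: mult.assoc)
    moreover have "0 \<le> \<bar>f x\<bar> * \<bar>g x\<bar>" by simp
    ultimately have "\<bar>f x\<bar> * \<bar>g x\<bar> \<le> \<bar>f x\<bar> ^ 2 + \<bar>g x\<bar> ^ 2" by linarith
    then show ?thesis by (simp only: abs_mult)
  qed
  then show "AE x in M. norm (f x * g x) \<le> norm (\<bar>f x\<bar> ^ 2 + \<bar>g x\<bar> ^ 2)"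
    by (intro AE_I2) (simp only: real_norm_def, meson abs_ge_self order_trans)
qed

text \<open>Integrates 2xy \<le> x^2 + y^2 for the normalized functions. As in
  \<open>Minkowski\<close>, a slack d keeps the normalizing constants A and B positive.\<close>

lemma Cauchy_Schwarz_integral:
  assumes f: "Lp_fun M 2 f" and g: "Lp_fun M 2 g"
  shows "(\<integral>x. \<bar>f x * g x\<bar> \<partial>M) \<le> Lp_norm M 2 f * Lp_norm M 2 g"
proof (rule field_le_epsilon)
  fix e :: real assume "e > 0"
  define a where "a = Lp_norm M 2 f"
  define b where "b = Lp_norm M 2 g"
  have ab: "a \<ge> 0" "b \<ge> 0" by (auto simp: a_def b_def)
  \<comment> \<open>Chosen so that A B = ab + d (a + b + d) \<le> ab + d (a + b + 1) \<le> ab +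
    e.\<close>
  define d where "d = min 1 (e / (a + b + 1))"
  have d: "d > 0" "d \<le> 1" "d * (a + b + 1) \<le> e"
  proof -
    show "d > 0" "d \<le> 1" using ab \<open>e > 0\<close> by (auto simp: d_def)
    have "d * (a + b + 1) \<le> e / (a + b + 1) * (a + b + 1)"
      using ab by (intro mult_right_mono) (auto simp: d_def)
    also have "\<dots> = e" using ab by simp
    finally show "d * (a + b + 1) \<le> e" .
  qed
  define A where "A = a + d" define B where "B = b + d"
  have AB: "A > 0" "B > 0" using ab d by (auto simp: A_def B_def)
  have pw: "\<bar>f x * g x\<bar> \<le> A * B * ((\<bar>f x\<bar>^2 / A^2 + \<bar>g x\<bar>^2 / B^2) / 2)" for x
  proof -
    have "2 * (\<bar>f x\<bar> / A) * (\<bar>g x\<bar> / B) \<le> (\<bar>f x\<bar> / A)^2 + (\<bar>g x\<bar> / B)^2"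
      by (rule sum_squares_bound)
    then have "\<bar>f x\<bar> * \<bar>g x\<bar> / (A * B) \<le> (\<bar>f x\<bar>^2 / A^2 + \<bar>g x\<bar>^2 / B^2) / 2"
      by (simp only: power_divide) (simp add: field_simps)
    from mult_left_mono[OF this, of "A * B"] show ?thesis using AB by (simp add: abs_mult)
  qed
  have "(\<integral>x. \<bar>f x * g x\<bar> \<partial>M) \<le> (\<integral>x. A * B * ((\<bar>f x\<bar>^2 / A^2 + \<bar>g x\<bar>^2 / B^2) / 2) \<partial>M)"
    using integrable_mult_of_squares[OF f g] f g pw by (intro integral_mono) (auto simp: Lp_fun_def)
  also have "\<dots> = A * B * ((a^2 / A^2 + b^2 / B^2) / 2)"
    using f g Lp_norm_power[of 2 M f] Lp_norm_power[of 2 M g] by (simp add: a_def b_def Lp_fun_def)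
  also have "\<dots> \<le> A * B * ((1 + 1) / 2)"
    using AB ab d by (intro mult_left_mono divide_right_mono add_mono) (auto simp: A_def B_def divide_le_eq power_mono)
  also have "\<dots> = a * b + d * (a + b + d)" by (simp add: A_def B_def algebra_simps)
  also have "\<dots> \<le> a * b + e"
    using d ab mult_left_mono[of "a + b + d" "a + b + 1" d] by linarith
  finally show "(\<integral>x. \<bar>f x * g x\<bar> \<partial>M) \<le> Lp_norm M 2 f * Lp_norm M 2 g + e"
    by (simp add: a_def b_def)
qed

lemma Lp_fun_square: "Lp_fun M 4 f \<Longrightarrow> Lp_fun M 2 (\<lambda>x. (f x)\<^sup>2)"
  by (auto simp: Lp_fun_def simp flip: power_mult)

lemma Lp_norm_square: "Lp_norm M 2 (\<lambda>x. (f x)\<^sup>2) = (Lp_norm M 4 f)\<^sup>2"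
proof -
  have "(Lp_norm M 2 (\<lambda>x. (f x)\<^sup>2))\<^sup>2 = ((Lp_norm M 4 f)\<^sup>2)\<^sup>2"
    using Lp_norm_power[of 2 M "\<lambda>x. (f x)\<^sup>2"] Lp_norm_power[of 4 M f] by (simp flip: power_mult)
  then show ?thesis by (rule power2_eq_imp_eq) auto
qed

lemma Lp_fun_mult:
  assumes f: "Lp_fun M 4 f" and g: "Lp_fun M 4 g"
  shows "Lp_fun M 2 (\<lambda>x. f x * g x)"
  using integrable_mult_of_squares[OF Lp_fun_square[OF f] Lp_fun_square[OF g]] f g
  by (auto simp: Lp_fun_def power_mult_distrib abs_mult)

lemma Hoelder_2_4_4:
  assumes f: "Lp_fun M 4 f" and g: "Lp_fun M 4 g"
  shows "Lp_norm M 2 (\<lambda>x. f x * g x) \<le> Lp_norm M 4 f * Lp_norm M 4 g"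
proof (rule Lp_norm_leI)
  have "(\<integral>x. \<bar>f x * g x\<bar>\<^sup>2 \<partial>M) = (\<integral>x. \<bar>(f x)\<^sup>2 * (g x)\<^sup>2\<bar> \<partial>M)"
    by (simp add: abs_mult power_mult_distrib)
  also have "\<dots> \<le> (Lp_norm M 4 f)\<^sup>2 * (Lp_norm M 4 g)\<^sup>2"
    using Cauchy_Schwarz_integral[OF Lp_fun_square[OF f] Lp_fun_square[OF g]] by (simp only: Lp_norm_square)
  finally show "(\<integral>x. \<bar>f x * g x\<bar>\<^sup>2 \<partial>M) \<le> (Lp_norm M 4 f * Lp_norm M 4 g)\<^sup>2"
    by (simp add: power_mult_distrib)
qed auto

lemma abs_integral_mult_le:
  assumes f: "Lp_fun M 2 f" and g: "Lp_fun M 2 g"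
  shows "\<bar>\<integral>x. f x * g x \<partial>M\<bar> \<le> Lp_norm M 2 f * Lp_norm M 2 g"
  using Cauchy_Schwarz_integral[OF f g] integral_abs_bound[of M "\<lambda>x. f x * g x"] by linarith

lemma Lp_norm_2_square: "(Lp_norm M 2 f)\<^sup>2 = (\<integral>x. (f x)\<^sup>2 \<partial>M)"
  using Lp_norm_power[of 2 M f] by simp

lemma Lp_fun_2_iff: "Lp_fun M 2 f \<longleftrightarrow> f \<in> borel_measurable M \<and> integrable M (\<lambda>x. (f x)\<^sup>2)"
  by (simp add: Lp_fun_def)

lemma (in prob_space) Lp_fun_const: "p > 0 \<Longrightarrow> Lp_fun M p (\<lambda>x. c)"
  by (simp add: Lp_fun_def)

lemma (in prob_space) Lp_norm_const: "p > 0 \<Longrightarrow> Lp_norm M p (\<lambda>x. c) = \<bar>c\<bar>"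
  using prob_space by (simp add: Lp_norm_def real_root_power_cancel)

lemma (in prob_space) Lp_fun_mono:
  assumes "Lp_fun M q f" "p \<le> q"
  shows "Lp_fun M p f"
proof -
  have "integrable M (\<lambda>x. \<bar>f x\<bar> ^ p)"
  proof (rule Bochner_Integration.integrable_bound)
    show "integrable M (\<lambda>x. 1 + \<bar>f x\<bar> ^ q)" using assms by (auto simp: Lp_fun_def)
    have "y ^ p \<le> 1 + y ^ q" if "y \<ge> 0" for y :: real
    proof (cases "y \<le> 1")
      case True
      have "y ^ p \<le> 1" "y ^ q \<ge> 0" using True that by (auto intro: power_le_one)
      then show ?thesis by linarith
    next
      case False
      then show ?thesis using power_increasing[OF assms(2), of y] by linarith
    qed
    then have "\<bar>y\<bar> ^ p \<le> \<bar>1 + \<bar>y\<bar> ^ q\<bar>" for y :: real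
      using order_trans[OF _ abs_ge_self] by fastforce
    then show "AE x in M. norm (\<bar>f x\<bar> ^ p) \<le> norm (1 + \<bar>f x\<bar> ^ q)"
      by (simp add: power_abs)
  qed (use assms in \<open>auto simp: Lp_fun_def\<close>)
  then show ?thesis using assms by (auto simp: Lp_fun_def)
qed

lemma (in prob_space) Lp_norm_2_le_4:
  assumes "Lp_fun M 4 f"
  shows "Lp_norm M 2 f \<le> Lp_norm M 4 f"
  using Hoelder_2_4_4[OF assms, of "\<lambda>x. 1"] by (simp add: Lp_fun_const Lp_norm_const)

lemma (in prob_space) expectation_abs_le:
  assumes "Lp_fun M 2 f"
  shows "(\<integral>x. \<bar>f x\<bar> \<partial>M) \<le> Lp_norm M 2 f"
  using Cauchy_Schwarz_integral[OF assms, of "\<lambda>x. 1"] by (simp add: Lp_fun_const Lp_norm_const)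

text \<open>Cauchy-Schwarz for |f| and f^2. The remainders in Stein's method are of third order,
  whereas the process is controlled through fourth moments.\<close>

lemma (in prob_space) expectation_cube_le:
  assumes "Lp_fun M 4 f"
  shows "(\<integral>x. \<bar>f x\<bar> ^ 3 \<partial>M) \<le> Lp_norm M 4 f ^ 3"
proof -
  have f2: "Lp_fun M 2 f" using assms by (rule Lp_fun_mono) simp
  have "\<bar>f x\<bar> ^ 3 = \<bar>f x * (f x)\<^sup>2\<bar>" for x
    by (simp add: abs_mult power3_eq_cube power2_eq_square mult.assoc)
  then have "(\<integral>x. \<bar>f x\<bar> ^ 3 \<partial>M) = (\<integral>x. \<bar>f x * (f x)\<^sup>2\<bar> \<partial>M)"
    by simp
  also have "\<dots> \<le> Lp_norm M 2 f * (Lp_norm M 4 f)\<^sup>2"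
    using Cauchy_Schwarz_integral[OF f2 Lp_fun_square[OF assms]] by (simp only: Lp_norm_square)
  also have "\<dots> \<le> Lp_norm M 4 f * (Lp_norm M 4 f)\<^sup>2"
    using Lp_norm_2_le_4[OF assms] by (intro mult_right_mono) auto
  also have "\<dots> = Lp_norm M 4 f ^ 3" by (simp add: power3_eq_cube power2_eq_square mult.assoc)
  finally show ?thesis .
qed

lemma Lp_fun_distr:
  assumes "T \<in> measurable M N" "f \<in> borel_measurable N"
  shows "Lp_fun (distr M N T) p f \<longleftrightarrow> Lp_fun M p (\<lambda>x. f (T x))"
  using assms by (auto simp: Lp_fun_def integrable_distr_eq)

lemma Lp_norm_distr:
  assumes "T \<in> measurable M N" "f \<in> borel_measurable N"
  shows "Lp_norm (distr M N T) p f = Lp_norm M p (\<lambda>x. f (T x))"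
  using assms by (simp add: Lp_norm_def integral_distr)

subsection \<open>Resampling coordinates of an iid sequence\<close>

definition mix :: "int set \<Rightarrow> (int \<Rightarrow> 's) \<Rightarrow> (int \<Rightarrow> 's) \<Rightarrow> int \<Rightarrow> 's" where
  "mix A x y = (\<lambda>t. if t \<in> A then y t else x t)"

text \<open>The exchange of x_t and y_t for the t in A preserves \<open>Om2\<close>
  (\<open>distr_swap\<close>), and \<open>resample A\<close> is its first component; statements
  about resampled sequences thereby reduce to invariance.\<close>

definition swap :: "int set \<Rightarrow> (int \<Rightarrow> 's) \<times> (int \<Rightarrow> 's) \<Rightarrow> (int \<Rightarrow> 's) \<times> (int \<Rightarrow> 's)" where
  "swap A q = (mix A (fst q) (snd q), mix A (snd q) (fst q))"

abbreviation resample :: "int set \<Rightarrow> (int \<Rightarrow> 's) \<times> (int \<Rightarrow> 's) \<Rightarrow> int \<Rightarrow> 's" where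
  "resample A q \<equiv> mix A (fst q) (snd q)"

definition shift_seq :: "int \<Rightarrow> (int \<Rightarrow> 's) \<Rightarrow> int \<Rightarrow> 's" where
  "shift_seq h x = (\<lambda>t. x (t + h))"

lemma fst_swap [simp]: "fst (swap A q) = resample A q"
  by (simp add: swap_def)

lemma mix_empty [simp]: "mix {} x y = x"
  by (simp add: mix_def)

lemma mix_UNIV [simp]: "mix UNIV x y = y"
  by (simp add: mix_def)

lemma mix_apply: "mix A x y t = (if t \<in> A then y t else x t)"
  by (simp add: mix_def)

lemma snd_swap [simp]: "snd (swap A q) = mix A (snd q) (fst q)"
  by (simp add: swap_def)

text \<open>Exchanges compose by symmetric difference. Hence \<open>swap A\<close> carries the
  resampling over B to the resampling over the symmetric difference of A and B.\<close>

lemma mix_mix [simp]: "mix B (mix A x y) (mix A y x) = mix (sym_diff A B) x y"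
  by (auto simp: mix_def fun_eq_iff)

lemma mix_Compl: "mix (- A) x y = mix A y x"
  by (auto simp: mix_def fun_eq_iff)

lemma swap_empty [simp]: "swap {} q = q"
  by (simp add: swap_def)

lemma norm_abs_power_le:
  fixes a b :: real
  assumes "\<bar>a\<bar> \<le> b"
  shows "norm (\<bar>a\<bar> ^ p) \<le> b ^ p"
proof -
  have "\<bar>a\<bar> ^ p \<le> b ^ p" using assms by (rule power_mono) simp
  then show ?thesis by (subst real_norm_def, subst abs_of_nonneg) auto
qed

lemma null_sequence_bound:
  fixes f g :: "nat \<Rightarrow> real"
  assumes "\<And>n. 0 \<le> f n" "g \<longlonglongrightarrow> 0" "\<And>n. f n \<le> g n"
  shows "f \<longlonglongrightarrow> 0"
  by (rule tendsto_sandwich[OF _ _ tendsto_const assms(2)]) (auto simp: assms)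

text \<open>The canonical model: \<mu> is the law of one innovation, \<open>Om\<close> the law of
  the whole sequence, and the second factor of \<open>Om2\<close> is the independent copy that
  supplies the replacements.\<close>

locale iid_sequence =
  fixes \<mu> :: "'s measure"
  assumes prob_space_mu: "prob_space \<mu>"
begin

abbreviation Om :: "(int \<Rightarrow> 's) measure" where "Om \<equiv> PiM UNIV (\<lambda>_. \<mu>)"

abbreviation Om2 :: "((int \<Rightarrow> 's) \<times> (int \<Rightarrow> 's)) measure" where "Om2 \<equiv> Om \<Otimes>\<^sub>M Om"

sublocale mu: prob_space \<mu> by (fact prob_space_mu)

sublocale Om: prob_space Om
  by (intro prob_space_PiM prob_space_mu)

sublocale Om2: pair_prob_space Om Om ..

section \<open>Invariance of the product law under shifts and swaps\<close>

lemma component_measurable: "(\<lambda>x. x t) \<in> Om \<rightarrow>\<^sub>M \<mu>"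
  by (rule measurable_component_singleton) simp

lemma mix_measurable [measurable]: "f \<in> N \<rightarrow>\<^sub>M Om \<Longrightarrow> g \<in> N \<rightarrow>\<^sub>M Om \<Longrightarrow> (\<lambda>x. mix A (f x) (g x)) \<in> N \<rightarrow>\<^sub>M Om"
  unfolding mix_def
  by (rule measurable_abs_UNIV) (auto intro: measurable_compose[OF _ component_measurable])

lemma swap_measurable [measurable]: "swap A \<in> Om2 \<rightarrow>\<^sub>M Om2"
  unfolding swap_def by measurable

lemma shift_measurable [measurable]: "shift_seq h \<in> Om \<rightarrow>\<^sub>M Om"
  unfolding shift_seq_def by (rule measurable_abs_UNIV) (rule component_measurable)

lemma distr_reindex:
  assumes "inj \<sigma>"
  shows "distr (PiM UNIV (\<lambda>_. \<mu>)) (PiM UNIV (\<lambda>_. \<mu>)) (\<lambda>x t. x (\<sigma> t)) = PiM UNIV (\<lambda>_. \<mu>)"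
  using distr_PiM_reindex[of UNIV "\<lambda>_. \<mu>" \<sigma> UNIV] assms prob_space_mu by (simp add: restrict_def)

lemma distr_shift: "distr Om Om (shift_seq h) = Om"
  unfolding shift_seq_def by (rule distr_reindex) (simp add: inj_def)

text \<open>Realizes a pair of sequences as one product over \<open>bool \<times> int\<close>,
  because there an exchange of coordinates is a permutation of the index set. The two halves are
  independent since they use disjoint sets of independent coordinates.\<close>

lemma distr_two_copies:
  "distr (PiM (UNIV :: (bool \<times> int) set) (\<lambda>_. \<mu>)) Om2 (\<lambda>z. (\<lambda>t. z (False, t), \<lambda>t. z (True, t))) = Om2"
proof -
  let ?B = "PiM (UNIV :: (bool \<times> int) set) (\<lambda>_. \<mu>)"
  let ?K = "\<lambda>b. {b} \<times> (UNIV :: int set)"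
  interpret B: prob_space ?B by (intro prob_space_PiM prob_space_mu)
  have comp: "(\<lambda>z. z i) \<in> ?B \<rightarrow>\<^sub>M \<mu>" for i by (rule measurable_component_singleton) simp
  have id: "distr ?B ?B (\<lambda>x. x) = ?B" by (rule distr_id)
  have component_law: "distr ?B \<mu> (\<lambda>z. z i) = \<mu>" for i
    using distr_PiM_component[of UNIV "\<lambda>_. \<mu>" i] by (simp add: prob_space_mu)
  have "B.indep_vars (\<lambda>_. \<mu>) (\<lambda>i z. z i) UNIV"
    using B.indep_vars_iff_distr_eq_PiM[where I=UNIV and M'="\<lambda>_. \<mu>" and X="\<lambda>i z. z i"]
    by (simp add: comp id component_law restrict_def)
  then have "B.indep_var (PiM (?K False) (\<lambda>_. \<mu>)) (\<lambda>z. restrict (\<lambda>i. z i) (?K False))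
      (PiM (?K True) (\<lambda>_. \<mu>)) (\<lambda>z. restrict (\<lambda>i. z i) (?K True))"
    by (rule B.indep_var_restrict) auto
  moreover have "(\<lambda>z t. z (b, t)) \<in> PiM (?K b) (\<lambda>_. \<mu>) \<rightarrow>\<^sub>M Om" for b
    by (rule measurable_abs_UNIV) (rule measurable_component_singleton, simp)
  ultimately have "B.indep_var Om ((\<lambda>z t. z (False, t)) \<circ> (\<lambda>z. restrict (\<lambda>i. z i) (?K False)))
      Om ((\<lambda>z t. z (True, t)) \<circ> (\<lambda>z. restrict (\<lambda>i. z i) (?K True)))"
    by (intro B.indep_var_compose)
  then have "B.indep_var Om (\<lambda>z t. z (False, t)) Om (\<lambda>z t. z (True, t))"
    by (simp add: comp_def)
  then have "distr ?B Om (\<lambda>z t. z (False, t)) \<Otimes>\<^sub>M distr ?B Om (\<lambda>z t. z (True, t)) =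
      distr ?B Om2 (\<lambda>z. (\<lambda>t. z (False, t), \<lambda>t. z (True, t)))"
    by (simp add: B.indep_var_distribution_eq)
  then show ?thesis
    by (simp add: distr_reindex inj_def)
qed

text \<open>In the coding of \<open>distr_two_copies\<close> the exchange is the reindexing that
  flips the copy at the times in A, so \<open>distr_reindex\<close> applies.\<close>

lemma distr_swap: "distr Om2 Om2 (swap A) = Om2"
proof -
  let ?B = "PiM (UNIV :: (bool \<times> int) set) (\<lambda>_. \<mu>)"
  let ?J = "\<lambda>z. (\<lambda>t. z (False, t), \<lambda>t. z (True, t))"
  let ?\<sigma> = "\<lambda>(b, t). (if t \<in> A then \<not> b else b, t)"
  have J [measurable]: "?J \<in> ?B \<rightarrow>\<^sub>M Om2"
    by (intro measurable_Pair measurable_abs_UNIV measurable_component_singleton) auto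
  have S [measurable]: "(\<lambda>z i. z (?\<sigma> i)) \<in> ?B \<rightarrow>\<^sub>M ?B"
    by (rule measurable_abs_UNIV) (rule measurable_component_singleton, simp)
  have eq: "swap A \<circ> ?J = ?J \<circ> (\<lambda>z i. z (?\<sigma> i))"
    by (auto simp: fun_eq_iff swap_def mix_def)
  have "distr Om2 Om2 (swap A) = distr (distr ?B Om2 ?J) Om2 (swap A)"
    by (simp add: distr_two_copies)
  also have "\<dots> = distr (distr ?B ?B (\<lambda>z i. z (?\<sigma> i))) Om2 ?J"
    by (simp add: distr_distr eq)
  also have "distr ?B ?B (\<lambda>z i. z (?\<sigma> i)) = ?B"
    by (rule distr_reindex) (auto simp: inj_def split: if_splits)
  finally show ?thesis by (simp add: distr_two_copies)
qed

lemma distr_fst: "distr Om2 Om fst = Om"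
  by (rule Om.distr_pair_fst)

lemma distr_resample: "distr Om2 Om (resample A) = Om"
proof -
  have "distr Om2 Om (resample A) = distr (distr Om2 Om2 (swap A)) Om fst"
    by (subst distr_distr) (auto simp: comp_def)
  then show ?thesis by (simp add: distr_swap distr_fst)
qed

lemma integral_swap:
  fixes F :: "_ \<Rightarrow> _ :: {banach, second_countable_topology}"
  assumes [measurable]: "F \<in> borel_measurable Om2"
  shows "(\<integral>q. F (swap A q) \<partial>Om2) = (\<integral>q. F q \<partial>Om2)"
  using integral_distr[of "swap A" Om2 Om2 F] by (simp add: distr_swap)

lemma integrable_swap:
  fixes F :: "_ \<Rightarrow> _ :: {banach, second_countable_topology}"
  assumes [measurable]: "F \<in> borel_measurable Om2"
  shows "integrable Om2 (\<lambda>q. F (swap A q)) \<longleftrightarrow> integrable Om2 F"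
  using integrable_distr_eq[of "swap A" Om2 Om2 F] by (simp add: distr_swap)

lemma integral_resample:
  fixes f :: "_ \<Rightarrow> _ :: {banach, second_countable_topology}"
  assumes [measurable]: "f \<in> borel_measurable Om"
  shows "(\<integral>q. f (resample A q) \<partial>Om2) = (\<integral>x. f x \<partial>Om)"
  using integral_distr[of "resample A" Om2 Om f] by (simp add: distr_resample)

lemma integrable_resample:
  fixes f :: "_ \<Rightarrow> _ :: {banach, second_countable_topology}"
  assumes [measurable]: "f \<in> borel_measurable Om"
  shows "integrable Om2 (\<lambda>q. f (resample A q)) \<longleftrightarrow> integrable Om f"
  using integrable_distr_eq[of "resample A" Om2 Om f] by (simp add: distr_resample)

lemma integral_shift:
  fixes f :: "_ \<Rightarrow> _ :: {banach, second_countable_topology}"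
  assumes [measurable]: "f \<in> borel_measurable Om"
  shows "(\<integral>x. f (shift_seq h x) \<partial>Om) = (\<integral>x. f x \<partial>Om)"
  using integral_distr[of "shift_seq h" Om Om f] by (simp add: distr_shift)

lemma Lp_norm_swap:
  assumes "F \<in> borel_measurable Om2"
  shows "Lp_norm Om2 p (\<lambda>q. F (swap A q)) = Lp_norm Om2 p F"
  using Lp_norm_distr[of "swap A" Om2 Om2 F p] assms by (simp add: distr_swap)

lemma Lp_norm_resample:
  assumes "f \<in> borel_measurable Om"
  shows "Lp_norm Om2 p (\<lambda>q. f (resample A q)) = Lp_norm Om p f"
  using Lp_norm_distr[of "resample A" Om2 Om f p] assms by (simp add: distr_resample)

lemma Lp_fun_resample:
  assumes "Lp_fun Om p f"
  shows "Lp_fun Om2 p (\<lambda>q. f (resample A q))"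
  using Lp_fun_distr[of "resample A" Om2 Om f p] assms by (simp add: distr_resample Lp_fun_measurable)

lemma Lp_norm_fst: "f \<in> borel_measurable Om \<Longrightarrow> Lp_norm Om2 p (\<lambda>q. f (fst q)) = Lp_norm Om p f"
  using Lp_norm_resample[of f p "{}"] by simp

lemma Lp_fun_fst: "Lp_fun Om p f \<Longrightarrow> Lp_fun Om2 p (\<lambda>q. f (fst q))"
  using Lp_fun_resample[of p f "{}"] by simp

lemma Lp_norm_shift:
  assumes "f \<in> borel_measurable Om"
  shows "Lp_norm Om p (\<lambda>x. f (shift_seq h x)) = Lp_norm Om p f"
  using Lp_norm_distr[of "shift_seq h" Om Om f p] assms by (simp add: distr_shift)

lemma integral_fst_snd:
  fixes f g :: "(int \<Rightarrow> 's) \<Rightarrow> 'b :: {real_normed_field, banach, second_countable_topology}"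
  assumes f: "integrable Om f" and g: "integrable Om g"
  shows "integrable Om2 (\<lambda>q. f (fst q) * g (snd q))"
    and "(\<integral>q. f (fst q) * g (snd q) \<partial>Om2) = (\<integral>x. f x \<partial>Om) * (\<integral>x. g x \<partial>Om)"
proof -
  have [measurable]: "f \<in> borel_measurable Om" "g \<in> borel_measurable Om" using f g by auto
  show I: "integrable Om2 (\<lambda>q. f (fst q) * g (snd q))"
  proof (rule Om2.Fubini_integrable)
    have "integrable Om (\<lambda>x. norm (f x) * (\<integral>y. norm (g y) \<partial>Om))"
      using f by (intro integrable_mult_left integrable_norm) auto
    then show "integrable Om (\<lambda>x. \<integral>y. norm (f (fst (x, y)) * g (snd (x, y))) \<partial>Om)"
      by (simp add: norm_mult)
  qed (use f g in auto)
  have "(\<integral>q. f (fst q) * g (snd q) \<partial>Om2) = (\<integral>x. (\<integral>y. f x * g y \<partial>Om) \<partial>Om)"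
    using Om2.integral_fst'[OF I] by simp
  then show "(\<integral>q. f (fst q) * g (snd q) \<partial>Om2) = (\<integral>x. f x \<partial>Om) * (\<integral>x. g x \<partial>Om)"
    using f g by simp
qed

text \<open>Swapping the coordinates outside \<open>A\<close> turns one sequence into two independent ones.\<close>

lemma integral_mult_indep:
  fixes f g :: "(int \<Rightarrow> 's) \<Rightarrow> 'b :: {real_normed_field, banach, second_countable_topology}"
  assumes f: "integrable Om f" and g: "integrable Om g"
    and dep_f: "\<And>x y. f (mix (- A) x y) = f x"
    and dep_g: "\<And>x y. g (mix A x y) = g x"
  shows "integrable Om (\<lambda>x. f x * g x)"
    and "(\<integral>x. f x * g x \<partial>Om) = (\<integral>x. f x \<partial>Om) * (\<integral>x. g x \<partial>Om)"
proof -
  have [measurable]: "f \<in> borel_measurable Om" "g \<in> borel_measurable Om" using f g by auto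
  define F where "F = (\<lambda>q. f (fst q) * g (snd q))"
  have [measurable]: "F \<in> borel_measurable Om2" unfolding F_def by measurable
  have "g (mix (- A) y x) = g x" for x y
    unfolding mix_Compl by (rule dep_g)
  then have *: "F (swap (- A) q) = f (fst q) * g (fst q)" for q
    by (simp add: F_def swap_def dep_f)
  show "integrable Om (\<lambda>x. f x * g x)"
    using integrable_swap[of F "- A"] integral_fst_snd(1)[OF f g] integrable_resample[of "\<lambda>x. f x * g x" "{}"]
    by (simp only: *) (simp add: F_def)
  show "(\<integral>x. f x * g x \<partial>Om) = (\<integral>x. f x \<partial>Om) * (\<integral>x. g x \<partial>Om)"
    using integral_swap[of F "- A"] integral_fst_snd(2)[OF f g] integral_resample[of "\<lambda>x. f x * g x" "{}"]
    by (simp only: *) (simp add: F_def)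
qed

text \<open>An event that concerns one coordinate is unaffected as soon as the window contains it,
  and the property passes to complements and countable unions; hence induction over the generated
  sigma-algebra.\<close>

lemma resample_indicator_tendsto:
  assumes "B \<in> sets Om"
  shows "(\<lambda>N. \<integral>q. \<bar>indicator B (fst q) - indicator B (resample (- {- int N..int N}) q)\<bar> \<partial>Om2) \<longlonglongrightarrow> (0::real)"
proof -
  define d where "d = (\<lambda>N B. \<integral>q. \<bar>indicator B (fst q) - indicator B (resample (- {- int N..int N}) q)\<bar> \<partial>Om2 :: real)"
  let ?G = "{{f \<in> \<Pi>\<^sub>E i\<in>UNIV. space \<mu>. f i \<in> A} | i A. i \<in> (UNIV::int set) \<and> A \<in> sets \<mu>}"
  have sets_eq: "sets Om = sigma_sets (\<Pi>\<^sub>E i\<in>UNIV. space \<mu>) ?G"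
    by (rule sets_PiM_single)
  have spc: "space Om = (\<Pi>\<^sub>E i\<in>UNIV. space \<mu>)" by (simp add: space_PiM)
  have res_space: "resample A q \<in> space Om" if "q \<in> space Om2" for A q
    using that measurable_space[of "resample A" Om2 Om q] by measurable
  have integ: "integrable Om2 (\<lambda>q. \<bar>indicator B (fst q) - indicator B (resample A q)\<bar> :: real)"
    if [measurable]: "B \<in> sets Om" for A B
    by (rule Om2.P.integrable_const_bound[where B=2]) (auto simp: indicator_def)
  have "(\<lambda>N. d N B) \<longlonglongrightarrow> 0"
    using assms unfolding sets_eq
  proof (induction rule: sigma_sets.induct)
    case (Basic a)
    then obtain i A where a: "a = {f \<in> \<Pi>\<^sub>E i\<in>UNIV. space \<mu>. f i \<in> A}" by auto
    have "d N a = 0" if "N \<ge> nat \<bar>i\<bar>" for N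
    proof -
      have "i \<in> {- int N..int N}" using that by auto
      then have "\<bar>indicator a (fst q) - indicator a (resample (- {- int N..int N}) q)\<bar> = (0::real)"
        if "q \<in> space Om2" for q
        using that res_space[OF that, of "- {- int N..int N}"]
        by (auto simp: a indicator_def mix_apply spc space_pair_measure)
      then show ?thesis unfolding d_def by (intro integral_eq_zero_AE AE_I2) auto
    qed
    then show ?case
      by (intro tendsto_eventually eventually_sequentiallyI[of "nat \<bar>i\<bar>"])
  next
    case Empty
    show ?case by (simp add: d_def)
  next
    case (Compl a)
    have "d N ((\<Pi>\<^sub>E i\<in>UNIV. space \<mu>) - a) = d N a" for N
      unfolding d_def
    proof (intro Bochner_Integration.integral_cong refl)
      fix q assume q: "q \<in> space Om2"
      have "resample (- {- int N..int N}) q \<in> space Om" "fst q \<in> space Om"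
        using q res_space[OF q] by (auto simp: space_pair_measure)
      then show "\<bar>indicator ((\<Pi>\<^sub>E i\<in>UNIV. space \<mu>) - a) (fst q) - indicator ((\<Pi>\<^sub>E i\<in>UNIV. space \<mu>) - a) (resample (- {- int N..int N}) q)\<bar>
         = (\<bar>indicator a (fst q) - indicator a (resample (- {- int N..int N}) q)\<bar> :: real)"
        by (auto simp: indicator_def spc)
    qed
    then show ?case using Compl by simp
  next
    case (Union a)
    have a [measurable]: "a i \<in> sets Om" for i using Union by (simp add: sets_eq)
    define C where "C = (\<Union>i. a i)"
    define D where "D = (\<lambda>I. \<Union>i<I. a i)"
    have [measurable]: "C \<in> sets Om" "D I \<in> sets Om" for I by (auto simp: C_def D_def)
    have "(\<lambda>I. Om.prob (D I)) \<longlonglongrightarrow> Om.prob (\<Union>I. D I)"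
      by (rule Om.finite_Lim_measure_incseq) (auto simp: D_def incseq_def intro: less_le_trans)
    also have "(\<Union>I. D I) = C" unfolding C_def D_def by blast
    finally have lim: "(\<lambda>I. Om.prob (D I)) \<longlonglongrightarrow> Om.prob C" .
    \<comment> \<open>A finite subunion misses only an event of small probability. This error counts
      twice, since the original and the resampled sequence both have law \<open>Om\<close>.\<close>
    have bound: "d N C \<le> (\<Sum>i<I. d N (a i)) + 2 * (Om.prob C - Om.prob (D I))" for N I
    proof -
      let ?R = "resample (- {- int N..int N})"
      have sub: "D I \<subseteq> C" by (auto simp: C_def D_def)
      have pw: "\<bar>indicator C x - indicator C y\<bar> \<le> (\<Sum>i<I. \<bar>indicator (a i) x - indicator (a i) y\<bar>) + (indicator (C - D I) x + indicator (C - D I) y :: real)" for x y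
      proof (cases "\<exists>i<I. \<bar>indicator (a i) x - indicator (a i) y\<bar> = (1::real)")
        case True
        then obtain i where "i < I" "\<bar>indicator (a i) x - indicator (a i) y\<bar> = (1::real)" by blast
        then have "(1::real) \<le> (\<Sum>i<I. \<bar>indicator (a i) x - indicator (a i) y\<bar>)"
          using member_le_sum[of i "{..<I}" "\<lambda>i. \<bar>indicator (a i) x - indicator (a i) y\<bar> :: real"] by auto
        moreover have "\<bar>indicator C x - indicator C y\<bar> \<le> (1::real)" by (auto simp: indicator_def)
        moreover have "(0::real) \<le> indicator (C - D I) x + indicator (C - D I) y" by simp
        ultimately show ?thesis by linarith
      next
        case False
        then have "x \<in> a i \<longleftrightarrow> y \<in> a i" if "i < I" for i using that by (auto simp: indicator_def split: if_splits)
        then have "x \<in> D I \<longleftrightarrow> y \<in> D I" by (auto simp: D_def)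
        then have "\<bar>indicator C x - indicator C y\<bar> \<le> (indicator (C - D I) x + indicator (C - D I) y :: real)"
          using sub by (auto simp: indicator_def)
        moreover have "(0::real) \<le> (\<Sum>i<I. \<bar>indicator (a i) x - indicator (a i) y\<bar>)" by (intro sum_nonneg) simp
        ultimately show ?thesis by linarith
      qed
      have i1: "integrable Om2 (\<lambda>q. indicator (C - D I) (resample A q) :: real)" for A
        by (rule Om2.P.integrable_const_bound[where B=1]) (auto simp: indicator_def)
      have i2: "(\<integral>q. indicator (C - D I) (resample A q) \<partial>Om2) = Om.prob C - Om.prob (D I)" for A
        using sub by (simp add: integral_resample Om.finite_measure_Diff)
      have "d N C \<le> (\<integral>q. (\<Sum>i<I. \<bar>indicator (a i) (fst q) - indicator (a i) (?R q)\<bar>) + (indicator (C - D I) (fst q) + indicator (C - D I) (?R q)) \<partial>Om2)"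
        unfolding d_def using i1[of "{}"] i1[of "- {- int N..int N}"]
        by (intro integral_mono pw Bochner_Integration.integrable_add Bochner_Integration.integrable_sum integ) auto
      also have "\<dots> = (\<Sum>i<I. d N (a i)) + 2 * (Om.prob C - Om.prob (D I))"
        unfolding d_def using i1[of "{}"] i1[of "- {- int N..int N}"] i2[of "{}"] i2[of "- {- int N..int N}"]
        by (subst Bochner_Integration.integral_add, intro Bochner_Integration.integrable_sum integ a, simp,
            subst Bochner_Integration.integral_sum, intro integ a, simp)
      finally show ?thesis .
    qed
    have "(\<lambda>N. d N C) \<longlonglongrightarrow> 0"
    proof (rule LIMSEQ_I)
      fix e :: real assume "e > 0"
      have "\<forall>\<^sub>F I in sequentially. Om.prob C - Om.prob (D I) < e / 4"
      proof -
        have "\<forall>\<^sub>F I in sequentially. Om.prob C - e / 4 < Om.prob (D I)"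
          using order_tendstoD(1)[OF lim, of "Om.prob C - e / 4"] \<open>e > 0\<close> by simp
        then show ?thesis by (rule eventually_mono) auto
      qed
      then obtain I where I: "Om.prob C - Om.prob (D I) < e / 4" by (auto simp: eventually_sequentially)
      have "(\<lambda>N. \<Sum>i<I. d N (a i)) \<longlonglongrightarrow> (\<Sum>i<I. 0)"
        using Union by (intro tendsto_sum) auto
      then have "\<forall>\<^sub>F N in sequentially. (\<Sum>i<I. d N (a i)) < e / 2"
        using \<open>e > 0\<close> by (intro order_tendstoD(2)) auto
      then obtain N0 where N0: "(\<Sum>i<I. d N (a i)) < e / 2" if "N \<ge> N0" for N
        by (auto simp: eventually_sequentially)
      have "norm (d N C - 0) < e" if "N \<ge> N0" for N
      proof -
        have "d N C \<ge> 0" unfolding d_def by simp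
        then show ?thesis using bound[of N I] N0[OF that] I by simp
      qed
      then show "\<exists>N0. \<forall>N\<ge>N0. norm (d N C - 0) < e" by blast
    qed
    then show ?case by (simp add: C_def)
  qed
  then show ?thesis by (simp add: d_def)
qed

text \<open>Dominated convergence reduces f to simple functions, whose level sets are covered by
  \<open>resample_indicator_tendsto\<close>. Replacing f by \<open>F i\<close> costs twice their
  distance for every window, because resampling preserves the law.\<close>

lemma resample_Lp_tendsto:
  assumes p: "p > 0" and f: "Lp_fun Om p f"
  shows "(\<lambda>N. Lp_norm Om2 p (\<lambda>q. f (fst q) - f (resample (- {- int N..int N}) q))) \<longlonglongrightarrow> 0"
proof -
  let ?R = "\<lambda>N. resample (- {- int N..int N})"
  have [measurable]: "f \<in> borel_measurable Om" using f by (simp add: Lp_fun_def)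
  from borel_measurable_implies_sequence_metric[OF this, of 0] obtain F where
    F: "\<And>i. simple_function Om (F i)" and
    lim: "\<And>x. x \<in> space Om \<Longrightarrow> (\<lambda>i. F i x) \<longlonglongrightarrow> f x" and
    bound: "\<And>i x. x \<in> space Om \<Longrightarrow> norm (F i x) \<le> 2 * norm (f x)"
    by simp metis
  have [measurable]: "F i \<in> borel_measurable Om" for i
    using F by (rule borel_measurable_simple_function)
  have FL: "Lp_fun Om p (F i)" for i
  proof -
    have "integrable Om (\<lambda>x. \<bar>F i x\<bar> ^ p)"
    proof (rule Bochner_Integration.integrable_bound)
      show "integrable Om (\<lambda>x. \<bar>2 * f x\<bar> ^ p)" using Lp_fun_cmult[OF f] by (simp add: Lp_fun_def)
      show "AE x in Om. norm (\<bar>F i x\<bar> ^ p) \<le> norm (\<bar>2 * f x\<bar> ^ p)"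
      proof (intro AE_I2)
        fix x assume "x \<in> space Om"
        then have "\<bar>F i x\<bar> \<le> \<bar>2 * f x\<bar>" using bound[of x i] by (simp add: abs_mult)
        from norm_abs_power_le[OF this] show "norm (\<bar>F i x\<bar> ^ p) \<le> norm (\<bar>2 * f x\<bar> ^ p)"
          by (rule order_trans) (simp only: real_norm_def abs_ge_self)
      qed
    qed simp
    then show ?thesis by (simp add: Lp_fun_def)
  qed
  have approx: "(\<lambda>i. Lp_norm Om p (\<lambda>x. f x - F i x)) \<longlonglongrightarrow> 0"
  proof -
    have "(\<lambda>i. \<integral>x. \<bar>f x - F i x\<bar> ^ p \<partial>Om) \<longlonglongrightarrow> (\<integral>x. 0 \<partial>Om)"
    proof (rule integral_dominated_convergence)
      \<comment> \<open>|F i| is at most 2|f|, so |f - F i| is at most 3|f|.\<close>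
      show "integrable Om (\<lambda>x. \<bar>3 * f x\<bar> ^ p)" using Lp_fun_cmult[OF f] by (simp add: Lp_fun_def)
      show "AE x in Om. norm (\<bar>f x - F i x\<bar> ^ p) \<le> \<bar>3 * f x\<bar> ^ p" for i
      proof (intro AE_I2)
        fix x assume "x \<in> space Om"
        then have "\<bar>f x - F i x\<bar> \<le> \<bar>3 * f x\<bar>" using bound[of x i] by auto
        then show "norm (\<bar>f x - F i x\<bar> ^ p) \<le> \<bar>3 * f x\<bar> ^ p"
          by (rule norm_abs_power_le)
      qed
      show "AE x in Om. (\<lambda>i. \<bar>f x - F i x\<bar> ^ p) \<longlonglongrightarrow> 0"
      proof (intro AE_I2)
        fix x assume "x \<in> space Om"
        have "(\<lambda>i. \<bar>f x - F i x\<bar> ^ p) \<longlonglongrightarrow> \<bar>f x - f x\<bar> ^ p"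
          by (intro tendsto_intros lim \<open>x \<in> space Om\<close>)
        then show "(\<lambda>i. \<bar>f x - F i x\<bar> ^ p) \<longlonglongrightarrow> 0" using p by (simp add: zero_power)
      qed
    qed simp_all
    then have "(\<lambda>i. root p (\<integral>x. \<bar>f x - F i x\<bar> ^ p \<partial>Om)) \<longlonglongrightarrow> root p 0"
      by (intro tendsto_real_root) simp
    then show ?thesis using p by (simp add: Lp_norm_def)
  qed
  have simple: "(\<lambda>N. Lp_norm Om2 p (\<lambda>q. F i (fst q) - F i (?R N q))) \<longlonglongrightarrow> 0" for i
  proof -
    define V where "V = F i ` space Om"
    define B where "B v = F i -` {v} \<inter> space Om" for v
    have "finite V" using F[of i] by (simp add: V_def simple_function_def)
    have B [measurable]: "B v \<in> sets Om" for v unfolding B_def by measurable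
    define D where "D v N q = v * (indicator (B v) (fst q) - indicator (B v) (?R N q))" for v N q
    have DL: "Lp_fun Om2 p (D v N)" for v N
    proof -
      have "integrable Om2 (\<lambda>q. \<bar>D v N q\<bar> ^ p)"
      proof (rule Om2.P.integrable_const_bound[where B="(\<bar>v\<bar> * 1) ^ p"])
        show "AE q in Om2. norm (\<bar>D v N q\<bar> ^ p) \<le> (\<bar>v\<bar> * 1) ^ p"
        proof (intro AE_I2)
          fix q
          have "\<bar>D v N q\<bar> \<le> \<bar>v\<bar> * 1" unfolding D_def by (auto simp: indicator_def)
          then show "norm (\<bar>D v N q\<bar> ^ p) \<le> (\<bar>v\<bar> * 1) ^ p" by (rule norm_abs_power_le)
        qed
      qed (simp add: D_def)
      moreover have "D v N \<in> borel_measurable Om2" unfolding D_def[abs_def] by measurable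
      ultimately show ?thesis by (simp add: Lp_fun_def)
    qed
    have eq: "F i (fst q) - F i (?R N q) = (\<Sum>v\<in>V. D v N q)" if "q \<in> space Om2" for N q
    proof -
      have sp: "fst q \<in> space Om" "?R N q \<in> space Om"
        using that measurable_space[of "?R N" Om2 Om q] by (auto simp: space_pair_measure)
      have rep: "F i x = (\<Sum>v\<in>V. v * indicator (B v) x)" if "x \<in> space Om" for x
      proof -
        have "F i x = (\<Sum>v\<in>V. indicator (B v) x *\<^sub>R v)"
          unfolding V_def B_def by (rule simple_function_indicator_representation_banach[OF F[of i] that])
        also have "\<dots> = (\<Sum>v\<in>V. v * indicator (B v) x)"
          by (intro sum.cong refl) (simp only: real_scaleR_def mult.commute)
        finally show ?thesis .
      qed
      show ?thesis unfolding rep[OF sp(1)] rep[OF sp(2)] D_def by (simp add: right_diff_distrib sum_subtractf)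
    qed
    \<comment> \<open>A difference of indicators has absolute value 0 or 1, which equals its own
      p-th power; the norm is therefore a p-th root of an integral already known to tend to
      0.\<close>
    have norm_D: "Lp_norm Om2 p (D v N) = \<bar>v\<bar> * root p (\<integral>q. \<bar>indicator (B v) (fst q) - indicator (B v) (?R N q)\<bar> \<partial>Om2)" for v N
    proof -
      have "\<bar>indicator (B v) x - indicator (B v) y\<bar> ^ p = (\<bar>indicator (B v) x - indicator (B v) y\<bar> :: real)" for x y
        using p by (auto simp: indicator_def zero_power)
      then show ?thesis unfolding D_def[abs_def] Lp_norm_cmult[OF p] unfolding Lp_norm_def by presburger
    qed
    have "(\<lambda>N. \<Sum>v\<in>V. Lp_norm Om2 p (D v N)) \<longlonglongrightarrow> (\<Sum>v\<in>V. \<bar>v\<bar> * root p 0)"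
      unfolding norm_D by (intro tendsto_intros resample_indicator_tendsto B)
    then have "(\<lambda>N. \<Sum>v\<in>V. Lp_norm Om2 p (D v N)) \<longlonglongrightarrow> 0" by simp
    moreover have "Lp_norm Om2 p (\<lambda>q. F i (fst q) - F i (?R N q)) \<le> (\<Sum>v\<in>V. Lp_norm Om2 p (D v N))" for N
    proof -
      have "Lp_norm Om2 p (\<lambda>q. F i (fst q) - F i (?R N q)) = Lp_norm Om2 p (\<lambda>q. \<Sum>v\<in>V. D v N q)"
        unfolding Lp_norm_def by (intro arg_cong[where f="root p"] Bochner_Integration.integral_cong) (auto simp: eq)
      also have "\<dots> \<le> (\<Sum>v\<in>V. Lp_norm Om2 p (D v N))"
        using p DL by (rule Minkowski_sum)
      finally show ?thesis .
    qed
    ultimately show ?thesis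
      by (rule null_sequence_bound[rotated 1]) simp
  qed
  have tri: "Lp_norm Om2 p (\<lambda>q. f (fst q) - f (?R N q)) \<le> 2 * Lp_norm Om p (\<lambda>x. f x - F i x) + Lp_norm Om2 p (\<lambda>q. F i (fst q) - F i (?R N q))" for N i
  proof -
    let ?g = "\<lambda>x. f x - F i x"
    have g: "Lp_fun Om p ?g" using f FL by (rule Lp_fun_diff)
    have "Lp_norm Om2 p (\<lambda>q. f (fst q) - f (?R N q)) = Lp_norm Om2 p (\<lambda>q. (?g (fst q) - ?g (?R N q)) + (F i (fst q) - F i (?R N q)))"
      by simp
    also have "\<dots> \<le> Lp_norm Om2 p (\<lambda>q. ?g (fst q) - ?g (?R N q)) + Lp_norm Om2 p (\<lambda>q. F i (fst q) - F i (?R N q))"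
      by (intro Minkowski p Lp_fun_diff Lp_fun_fst Lp_fun_resample f FL)
    also have "Lp_norm Om2 p (\<lambda>q. ?g (fst q) - ?g (?R N q)) \<le> Lp_norm Om2 p (\<lambda>q. ?g (fst q)) + Lp_norm Om2 p (\<lambda>q. ?g (?R N q))"
      by (intro Minkowski_diff p) (rule Lp_fun_fst[OF g] Lp_fun_resample[OF g])+
    also have "\<dots> = 2 * Lp_norm Om p ?g"
      using Lp_norm_fst[of ?g p] Lp_norm_resample[of ?g p "- {- int N..int N}"] by simp
    finally show ?thesis by simp
  qed
  show ?thesis
  proof (rule LIMSEQ_I)
    fix e :: real assume "e > 0"
    obtain i where i: "Lp_norm Om p (\<lambda>x. f x - F i x) < e / 4"
      using order_tendstoD(2)[OF approx, of "e / 4"] \<open>e > 0\<close> by (auto simp: eventually_sequentially)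
    obtain N0 where N0: "Lp_norm Om2 p (\<lambda>q. F i (fst q) - F i (?R N q)) < e / 2" if "N \<ge> N0" for N
      using order_tendstoD(2)[OF simple[of i], of "e / 2"] \<open>e > 0\<close> by (auto simp: eventually_sequentially)
    have "norm (Lp_norm Om2 p (\<lambda>q. f (fst q) - f (?R N q)) - 0) < e" if "N \<ge> N0" for N
      using tri[of N i] i N0[OF that] by simp
    then show "\<exists>N0. \<forall>N\<ge>N0. norm (Lp_norm Om2 p (\<lambda>q. f (fst q) - f (?R N q)) - 0) < e" by blast
  qed
qed

section \<open>The Efron-Stein inequality\<close>

definition influence :: "nat \<Rightarrow> ((int \<Rightarrow> 's) \<Rightarrow> real) \<Rightarrow> int \<Rightarrow> real" where
  "influence p f k = Lp_norm Om2 p (\<lambda>q. f (fst q) - f (resample {k} q))"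

lemma influence_nonneg [simp]: "influence p f k \<ge> 0"
  by (simp add: influence_def)

text \<open>Exchanging \<open>x\<^sub>k\<close> and \<open>y\<^sub>k\<close> antisymmetrizes each term of the telescoping sum.\<close>

lemma Efron_Stein_finite:
  assumes f: "Lp_fun Om 2 f" and "finite A"
  shows "(\<integral>q. f (fst q) * (f (fst q) - f (resample A q)) \<partial>Om2) \<le> (\<Sum>k\<in>A. (influence 2 f k)\<^sup>2) / 2"
  using \<open>finite A\<close>
proof induction
  case (insert k A)
  have [measurable]: "f \<in> borel_measurable Om" using f by (simp add: Lp_fun_def)
  note fL = Lp_fun_fst[OF f] and fR = Lp_fun_resample[OF f]
  have sd: "A - {k} = A" using insert by auto
  let ?G = "\<lambda>q. f (fst q) * (f (resample A q) - f (resample (insert k A) q))"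
  let ?H = "\<lambda>q. (f (fst q) - f (resample {k} q)) * (f (resample A q) - f (resample (insert k A) q))"
  have iG: "integrable Om2 ?G"
    by (intro integrable_mult_of_squares Lp_fun_diff fL fR)
  have iH: "integrable Om2 ?H"
    by (intro integrable_mult_of_squares Lp_fun_diff fL fR)
  have "(\<integral>q. ?G q \<partial>Om2) = (\<integral>q. ?G (swap {k} q) \<partial>Om2)"
    by (rule integral_swap[symmetric]) simp
  also have "(\<lambda>q. ?G (swap {k} q)) = (\<lambda>q. f (resample {k} q) * (f (resample (insert k A) q) - f (resample A q)))"
    by (simp add: sd)
  finally have "2 * (\<integral>q. ?G q \<partial>Om2) = (\<integral>q. ?G q \<partial>Om2) + (\<integral>q. f (resample {k} q) * (f (resample (insert k A) q) - f (resample A q)) \<partial>Om2)"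
    by simp
  also have "\<dots> = (\<integral>q. ?G q + f (resample {k} q) * (f (resample (insert k A) q) - f (resample A q)) \<partial>Om2)"
    by (intro Bochner_Integration.integral_add[symmetric] iG integrable_mult_of_squares Lp_fun_diff fR)
  also have "(\<lambda>q. ?G q + f (resample {k} q) * (f (resample (insert k A) q) - f (resample A q))) = ?H"
    by (simp add: algebra_simps fun_eq_iff)
  also have "(\<integral>q. ?H q \<partial>Om2) \<le> influence 2 f k * Lp_norm Om2 2 (\<lambda>q. f (resample A q) - f (resample (insert k A) q))"
    unfolding influence_def
    by (rule order_trans[OF abs_ge_self abs_integral_mult_le]) (intro Lp_fun_diff fL fR)+
  \<comment> \<open>As k lies outside A, \<open>swap A\<close> turns the resampling of k into that
    of \<open>insert k A\<close>, and the original sequence into \<open>resample A\<close>.\<close>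
  also have "Lp_norm Om2 2 (\<lambda>q. f (resample A q) - f (resample (insert k A) q)) = influence 2 f k"
  proof -
    have "sym_diff A {k} = insert k A" using insert by auto
    then show ?thesis
      unfolding influence_def
      using Lp_norm_swap[of "\<lambda>q. f (fst q) - f (resample {k} q)" 2 A] by simp
  qed
  finally have G: "(\<integral>q. ?G q \<partial>Om2) \<le> (influence 2 f k)\<^sup>2 / 2" by (simp add: power2_eq_square)
  have "(\<integral>q. f (fst q) * (f (fst q) - f (resample (insert k A) q)) \<partial>Om2) =
     (\<integral>q. f (fst q) * (f (fst q) - f (resample A q)) + ?G q \<partial>Om2)"
    by (intro Bochner_Integration.integral_cong) (simp_all add: algebra_simps)
  also have "\<dots> = (\<integral>q. f (fst q) * (f (fst q) - f (resample A q)) \<partial>Om2) + (\<integral>q. ?G q \<partial>Om2)"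
    by (intro Bochner_Integration.integral_add iG integrable_mult_of_squares Lp_fun_diff fL fR)
  also have "\<dots> \<le> (\<Sum>k\<in>A. (influence 2 f k)\<^sup>2) / 2 + (influence 2 f k)\<^sup>2 / 2"
    using insert G by simp
  finally show ?case using insert by (simp add: add_divide_distrib)
qed simp

text \<open>The limit of \<open>Efron_Stein_finite\<close> along growing windows. Once every
  coordinate is resampled, the copy is independent of the original and the left side is the
  variance. The bound D for all finite sums replaces an infinite series.\<close>

lemma Efron_Stein:
  assumes f: "Lp_fun Om 2 f"
    and D: "\<And>K. finite K \<Longrightarrow> (\<Sum>k\<in>K. (influence 2 f k)\<^sup>2) \<le> D"
  shows "(\<integral>x. (f x)\<^sup>2 \<partial>Om) - (\<integral>x. f x \<partial>Om)\<^sup>2 \<le> D / 2"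
proof -
  let ?W = "\<lambda>N. {- int N..int N}"
  have [measurable]: "f \<in> borel_measurable Om" using f by (simp add: Lp_fun_def)
  note fL = Lp_fun_fst[OF f] and fR = Lp_fun_resample[OF f]
  have fi: "integrable Om f"
    by (rule Om.square_integrable_imp_integrable[OF Lp_fun_measurable[OF f]]) (use f in \<open>simp add: Lp_fun_def\<close>)
  have "(\<lambda>N. \<integral>q. f (fst q) * (f (fst q) - f (resample (?W N) q)) \<partial>Om2) \<longlonglongrightarrow>
      (\<integral>q. f (fst q) * (f (fst q) - f (resample UNIV q)) \<partial>Om2)"
  proof (rule LIM_zero_cancel, rule Lim_null_comparison)
    show "\<forall>\<^sub>F N in sequentially. norm ((\<integral>q. f (fst q) * (f (fst q) - f (resample (?W N) q)) \<partial>Om2) - (\<integral>q. f (fst q) * (f (fst q) - f (resample UNIV q)) \<partial>Om2))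
       \<le> Lp_norm Om 2 f * Lp_norm Om2 2 (\<lambda>q. f (fst q) - f (resample (- ?W N) q))"
    proof (intro always_eventually allI)
      fix N
      have "(\<integral>q. f (fst q) * (f (fst q) - f (resample (?W N) q)) \<partial>Om2) - (\<integral>q. f (fst q) * (f (fst q) - f (resample UNIV q)) \<partial>Om2)
        = (\<integral>q. f (fst q) * (f (fst q) - f (resample (?W N) q)) - f (fst q) * (f (fst q) - f (resample UNIV q)) \<partial>Om2)"
        by (intro Bochner_Integration.integral_diff[symmetric] integrable_mult_of_squares Lp_fun_diff fL fR)
      also have "\<dots> = (\<integral>q. f (fst q) * (f (resample UNIV q) - f (resample (?W N) q)) \<partial>Om2)"
        by (simp add: algebra_simps)
      also have "\<bar>\<dots>\<bar> \<le> Lp_norm Om2 2 (\<lambda>q. f (fst q)) * Lp_norm Om2 2 (\<lambda>q. f (resample UNIV q) - f (resample (?W N) q))"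
        by (intro abs_integral_mult_le Lp_fun_diff fL fR)
      also have "Lp_norm Om2 2 (\<lambda>q. f (fst q)) = Lp_norm Om 2 f" by (simp add: Lp_norm_fst)
      \<comment> \<open>Exchanging the two sequences altogether turns the window into its
        complement, the form required by \<open>resample_Lp_tendsto\<close>.\<close>
      also have "Lp_norm Om2 2 (\<lambda>q. f (resample UNIV q) - f (resample (?W N) q)) = Lp_norm Om2 2 (\<lambda>q. f (fst q) - f (resample (- ?W N) q))"
      proof -
        show ?thesis
          using Lp_norm_swap[of "\<lambda>q. f (fst q) - f (resample (- ?W N) q)" 2 UNIV]
          by (simp add: mix_Compl)
      qed
      finally show "norm ((\<integral>q. f (fst q) * (f (fst q) - f (resample (?W N) q)) \<partial>Om2) - (\<integral>q. f (fst q) * (f (fst q) - f (resample UNIV q)) \<partial>Om2))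
       \<le> Lp_norm Om 2 f * Lp_norm Om2 2 (\<lambda>q. f (fst q) - f (resample (- ?W N) q))" by simp
    qed
    show "(\<lambda>N. Lp_norm Om 2 f * Lp_norm Om2 2 (\<lambda>q. f (fst q) - f (resample (- ?W N) q))) \<longlonglongrightarrow> 0"
      using tendsto_mult_right_zero[OF resample_Lp_tendsto[OF _ f]] by simp
  qed
  then have "(\<integral>q. f (fst q) * (f (fst q) - f (resample UNIV q)) \<partial>Om2) \<le> D / 2"
  proof (rule LIMSEQ_le_const2, intro exI allI impI)
    fix N
    show "(\<integral>q. f (fst q) * (f (fst q) - f (resample (?W N) q)) \<partial>Om2) \<le> D / 2"
      using Efron_Stein_finite[OF f, of "?W N"] D[of "?W N"] by simp
  qed
  also have "(\<integral>q. f (fst q) * (f (fst q) - f (resample UNIV q)) \<partial>Om2) = (\<integral>q. (f (fst q))\<^sup>2 - f (fst q) * f (snd q) \<partial>Om2)"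
    by (simp add: algebra_simps power2_eq_square)
  also have "\<dots> = (\<integral>q. (f (fst q))\<^sup>2 \<partial>Om2) - (\<integral>q. f (fst q) * f (snd q) \<partial>Om2)"
    using fL integral_fst_snd(1)[OF fi fi] by (intro Bochner_Integration.integral_diff) (auto simp: Lp_fun_def)
  also have "\<dots> = (\<integral>x. (f x)\<^sup>2 \<partial>Om) - (\<integral>x. f x \<partial>Om)\<^sup>2"
  proof -
    have "(\<integral>q. (f (fst q))\<^sup>2 \<partial>Om2) = (\<integral>x. (f x)\<^sup>2 \<partial>Om)"
    proof -
      have "(\<lambda>x. (f x)\<^sup>2) \<in> borel_measurable Om" by measurable
      from integral_resample[OF this, of "{}"] show ?thesis by (simp only: mix_empty)
    qed
    moreover have "(\<integral>q. f (fst q) * f (snd q) \<partial>Om2) = (\<integral>x. f x \<partial>Om)\<^sup>2"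
      unfolding integral_fst_snd(2)[OF fi fi] by (rule power2_eq_square[symmetric])
    ultimately show ?thesis by (rule arg_cong2[where f="(-)"])
  qed
  finally show ?thesis .
qed

end

subsection \<open>Linear and bilinear forms of weakly dependent processes\<close>

text \<open>Young's inequality for the convolution of a summable with a square summable sequence:
  Cauchy-Schwarz with d split into two square roots, and row and column sums of d (s - k) at most
  \<Theta>.\<close>

lemma sum_convolution_square_le:
  fixes d :: "int \<Rightarrow> real" and \<alpha> :: "int \<Rightarrow> real"
  assumes d: "\<And>j. d j \<ge> 0" and \<Theta>: "\<And>K. finite K \<Longrightarrow> sum d K \<le> \<Theta>" and I: "finite I" and K: "finite K"
  shows "(\<Sum>k\<in>K. (\<Sum>s\<in>I. d (s - k) * \<alpha> s)\<^sup>2) \<le> \<Theta>\<^sup>2 * (\<Sum>s\<in>I. (\<alpha> s)\<^sup>2)"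
proof -
  have \<Theta>0: "\<Theta> \<ge> 0" using \<Theta>[of "{}"] by simp
  have 1: "(\<Sum>s\<in>I. d (s - k)) \<le> \<Theta>" for k
  proof -
    have "(\<Sum>s\<in>I. d (s - k)) = sum d ((\<lambda>s. s - k) ` I)" by (subst sum.reindex) (auto simp: inj_on_def)
    then show ?thesis using \<Theta> I by simp
  qed
  have 2: "(\<Sum>k\<in>K. d (s - k)) \<le> \<Theta>" for s
  proof -
    have "(\<Sum>k\<in>K. d (s - k)) = sum d ((\<lambda>k. s - k) ` K)" by (subst sum.reindex) (auto simp: inj_on_def)
    then show ?thesis using \<Theta> K by simp
  qed
  have "(\<Sum>s\<in>I. d (s - k) * \<alpha> s)\<^sup>2 \<le> \<Theta> * (\<Sum>s\<in>I. d (s - k) * (\<alpha> s)\<^sup>2)" for k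
  proof -
    have "(\<Sum>s\<in>I. d (s - k) * \<alpha> s)\<^sup>2 = (\<Sum>s\<in>I. sqrt (d (s - k)) * (sqrt (d (s - k)) * \<alpha> s))\<^sup>2"
      using d by (simp flip: mult.assoc)
    also have "\<dots> \<le> (\<Sum>s\<in>I. (sqrt (d (s - k)))\<^sup>2) * (\<Sum>s\<in>I. (sqrt (d (s - k)) * \<alpha> s)\<^sup>2)"
      by (rule Cauchy_Schwarz_ineq_sum)
    also have "\<dots> = (\<Sum>s\<in>I. d (s - k)) * (\<Sum>s\<in>I. d (s - k) * (\<alpha> s)\<^sup>2)"
      using d by (simp add: power_mult_distrib)
    also have "\<dots> \<le> \<Theta> * (\<Sum>s\<in>I. d (s - k) * (\<alpha> s)\<^sup>2)"
      using 1 d by (intro mult_right_mono sum_nonneg) auto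
    finally show ?thesis .
  qed
  then have "(\<Sum>k\<in>K. (\<Sum>s\<in>I. d (s - k) * \<alpha> s)\<^sup>2) \<le> (\<Sum>k\<in>K. \<Theta> * (\<Sum>s\<in>I. d (s - k) * (\<alpha> s)\<^sup>2))"
    by (rule sum_mono)
  also have "\<dots> = \<Theta> * (\<Sum>s\<in>I. (\<Sum>k\<in>K. d (s - k)) * (\<alpha> s)\<^sup>2)"
    by (simp only: sum_distrib_left[symmetric] sum_distrib_right) (subst sum.swap, rule refl)
  also have "\<dots> \<le> \<Theta> * (\<Sum>s\<in>I. \<Theta> * (\<alpha> s)\<^sup>2)"
    using 2 \<Theta>0 by (intro mult_left_mono sum_mono mult_right_mono) auto
  also have "\<dots> = \<Theta>\<^sup>2 * (\<Sum>s\<in>I. (\<alpha> s)\<^sup>2)"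
    unfolding sum_distrib_left[symmetric] by (simp add: power2_eq_square[of \<Theta>])
  finally show ?thesis .
qed

context iid_sequence
begin

text \<open>The bound d depends on the lag t - k only, so one summable sequence controls all times.
  It is a property of arbitrary families because it is applied to the process, to its truncation and
  to their difference.\<close>

definition dependence_bound :: "(int \<Rightarrow> (int \<Rightarrow> 's) \<Rightarrow> real) \<Rightarrow> (int \<Rightarrow> real) \<Rightarrow> real \<Rightarrow> bool" where
  "dependence_bound X d \<Theta> \<longleftrightarrow> (\<forall>t. Lp_fun Om 4 (X t) \<and> (\<integral>x. X t x \<partial>Om) = 0) \<and>
     (\<forall>t k. influence 4 (X t) k \<le> d (t - k)) \<and> (\<forall>j. 0 \<le> d j) \<and> (\<forall>K. finite K \<longrightarrow> sum d K \<le> \<Theta>)"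

lemma
  assumes "dependence_bound X d \<Theta>"
  shows dependence_bound_Lp: "Lp_fun Om 4 (X t)"
    and dependence_bound_mean: "(\<integral>x. X t x \<partial>Om) = 0"
    and dependence_bound_influence: "influence 4 (X t) k \<le> d (t - k)"
    and dependence_bound_pos: "0 \<le> d j"
    and dependence_bound_sum: "finite K \<Longrightarrow> sum d K \<le> \<Theta>"
  using assms unfolding dependence_bound_def by simp_all

lemma dependence_bound_nonneg: "dependence_bound X d \<Theta> \<Longrightarrow> 0 \<le> \<Theta>"
  using dependence_bound_sum[of X d \<Theta> "{}"] by simp

lemma influence_2_le_4:
  assumes "Lp_fun Om 4 f"
  shows "influence 2 f k \<le> influence 4 f k"
  unfolding influence_def
  by (intro Om2.P.Lp_norm_2_le_4 Lp_fun_diff Lp_fun_fst Lp_fun_resample assms)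

lemma integrable_Lp: "Lp_fun Om 4 f \<Longrightarrow> integrable Om f"
proof -
  assume f: "Lp_fun Om 4 f"
  then have "Lp_fun Om 2 f" by (rule Om.Lp_fun_mono) simp
  then have "integrable Om (\<lambda>x. (f x)\<^sup>2)" unfolding Lp_fun_2_iff by blast
  then show "integrable Om f"
    by (rule Om.square_integrable_imp_integrable[OF Lp_fun_measurable[OF f]])
qed

lemma influence_sum_le:
  assumes "finite I" "\<And>t. t \<in> I \<Longrightarrow> Lp_fun Om 4 (X t)"
  shows "influence 4 (\<lambda>x. \<Sum>t\<in>I. b t * X t x) k \<le> (\<Sum>t\<in>I. \<bar>b t\<bar> * influence 4 (X t) k)"
proof -
  have "influence 4 (\<lambda>x. \<Sum>t\<in>I. b t * X t x) k = Lp_norm Om2 4 (\<lambda>q. \<Sum>t\<in>I. b t * (X t (fst q) - X t (resample {k} q)))"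
    by (simp add: influence_def sum_subtractf right_diff_distrib)
  also have "\<dots> \<le> (\<Sum>t\<in>I. Lp_norm Om2 4 (\<lambda>q. b t * (X t (fst q) - X t (resample {k} q))))"
    by (intro Minkowski_sum Lp_fun_cmult Lp_fun_diff Lp_fun_fst Lp_fun_resample assms) auto
  also have "\<dots> = (\<Sum>t\<in>I. \<bar>b t\<bar> * influence 4 (X t) k)"
    by (simp add: Lp_norm_cmult influence_def)
  finally show ?thesis .
qed

text \<open>The Efron-Stein inequality for \<open>Y\<^sup>2\<close> bounds \<open>\<parallel>Y\<parallel>\<^sub>4\<^sup>4\<close> by \<open>2 D \<parallel>Y\<parallel>\<^sub>4\<^sup>2 + D\<^sup>2 / 4\<close>,
  which is a quadratic inequality for \<open>\<parallel>Y\<parallel>\<^sub>4\<^sup>2\<close>.\<close>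

lemma linear_form_L4_bound:
  assumes X: "dependence_bound X d \<Theta>" and I: "finite I"
  shows "Lp_norm Om 4 (\<lambda>x. \<Sum>t\<in>I. b t * X t x) \<le> 3 / 2 * \<Theta> * sqrt (\<Sum>t\<in>I. (b t)\<^sup>2)"
proof -
  define Y where "Y = (\<lambda>x. \<Sum>t\<in>I. b t * X t x)"
  define D where "D = \<Theta>\<^sup>2 * (\<Sum>t\<in>I. (b t)\<^sup>2)"
  define y where "y = (Lp_norm Om 4 Y)\<^sup>2"
  note \<Theta> = dependence_bound_nonneg[OF X]
  have Y: "Lp_fun Om 4 Y"
    unfolding Y_def by (intro Lp_fun_sum Lp_fun_cmult dependence_bound_Lp[OF X]) simp
  have Y2: "Lp_fun Om 2 Y" using Y by (rule Om.Lp_fun_mono) simp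
  have mean: "(\<integral>x. Y x \<partial>Om) = 0"
    unfolding Y_def
    by (simp add: Bochner_Integration.integral_sum integrable_Lp dependence_bound_Lp[OF X] dependence_bound_mean[OF X])
  have inf: "(\<Sum>k\<in>K. (influence 4 Y k)\<^sup>2) \<le> D" if K: "finite K" for K
  proof -
    have "influence 4 Y k \<le> (\<Sum>t\<in>I. d (t - k) * \<bar>b t\<bar>)" for k
    proof -
      have "influence 4 Y k \<le> (\<Sum>t\<in>I. \<bar>b t\<bar> * influence 4 (X t) k)"
        unfolding Y_def by (intro influence_sum_le I dependence_bound_Lp[OF X])
      also have "\<dots> \<le> (\<Sum>t\<in>I. d (t - k) * \<bar>b t\<bar>)"
        by (intro sum_mono) (subst mult.commute, intro mult_right_mono dependence_bound_influence[OF X], simp)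
      finally show ?thesis .
    qed
    then have "(\<Sum>k\<in>K. (influence 4 Y k)\<^sup>2) \<le> (\<Sum>k\<in>K. (\<Sum>t\<in>I. d (t - k) * \<bar>b t\<bar>)\<^sup>2)"
      by (intro sum_mono power_mono) auto
    also have "\<dots> \<le> \<Theta>\<^sup>2 * (\<Sum>t\<in>I. \<bar>b t\<bar>\<^sup>2)"
      using dependence_bound_pos[OF X] dependence_bound_sum[OF X] I K by (rule sum_convolution_square_le)
    finally show ?thesis by (simp add: D_def)
  qed
  have D0: "D \<ge> 0" using inf[of "{}"] by simp
  have second: "(\<integral>x. (Y x)\<^sup>2 \<partial>Om) \<le> D / 2"
  proof -
    have "(\<Sum>k\<in>K. (influence 2 Y k)\<^sup>2) \<le> D" if "finite K" for K
      by (rule order_trans[OF _ inf[OF that]]) (intro sum_mono power_mono influence_2_le_4 Y influence_nonneg)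
    from Efron_Stein[OF Y2 this] show ?thesis by (simp add: mean)
  qed
  have fourth: "y\<^sup>2 - (\<integral>x. (Y x)\<^sup>2 \<partial>Om)\<^sup>2 \<le> (4 * y * D) / 2"
  proof -
    have "(\<Sum>k\<in>K. (influence 2 (\<lambda>x. (Y x)\<^sup>2) k)\<^sup>2) \<le> 4 * y * D" if K: "finite K" for K
    proof -
      have "influence 2 (\<lambda>x. (Y x)\<^sup>2) k \<le> influence 4 Y k * (2 * Lp_norm Om 4 Y)" for k
      proof -
        have "influence 2 (\<lambda>x. (Y x)\<^sup>2) k = Lp_norm Om2 2 (\<lambda>q. (Y (fst q) - Y (resample {k} q)) * (Y (fst q) + Y (resample {k} q)))"
          unfolding influence_def by (simp add: power2_eq_square algebra_simps)
        also have "\<dots> \<le> Lp_norm Om2 4 (\<lambda>q. Y (fst q) - Y (resample {k} q)) * Lp_norm Om2 4 (\<lambda>q. Y (fst q) + Y (resample {k} q))"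
          by (intro Hoelder_2_4_4 Lp_fun_diff Lp_fun_add Lp_fun_fst Lp_fun_resample Y)
        also have "\<dots> \<le> influence 4 Y k * (Lp_norm Om2 4 (\<lambda>q. Y (fst q)) + Lp_norm Om2 4 (\<lambda>q. Y (resample {k} q)))"
          unfolding influence_def
          by (intro mult_left_mono Minkowski Lp_fun_fst Lp_fun_resample Y) auto
        also have "\<dots> = influence 4 Y k * (2 * Lp_norm Om 4 Y)"
          using Lp_fun_measurable[OF Y] by (simp add: Lp_norm_fst Lp_norm_resample)
        finally show ?thesis .
      qed
      then have "(\<Sum>k\<in>K. (influence 2 (\<lambda>x. (Y x)\<^sup>2) k)\<^sup>2) \<le> (\<Sum>k\<in>K. (influence 4 Y k * (2 * Lp_norm Om 4 Y))\<^sup>2)"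
        by (intro sum_mono power_mono) auto
      also have "\<dots> = 4 * y * (\<Sum>k\<in>K. (influence 4 Y k)\<^sup>2)"
        unfolding y_def sum_distrib_left by (intro sum.cong refl) (simp add: power_mult_distrib)
      also have "\<dots> \<le> 4 * y * D" using inf[OF K] by (intro mult_left_mono) (auto simp: y_def)
      finally show ?thesis .
    qed
    from Efron_Stein[OF Lp_fun_square[OF Y] this]
    have "(\<integral>x. ((Y x)\<^sup>2)\<^sup>2 \<partial>Om) - (\<integral>x. (Y x)\<^sup>2 \<partial>Om)\<^sup>2 \<le> (4 * y * D) / 2" .
    moreover have "(\<integral>x. ((Y x)\<^sup>2)\<^sup>2 \<partial>Om) = y\<^sup>2"
      using Lp_norm_2_square[of Om "\<lambda>x. (Y x)\<^sup>2"] by (simp only: Lp_norm_square y_def)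
    ultimately show ?thesis by simp
  qed
  \<comment> \<open>From y^2 \<le> 2 D y + D^2 / 4 follows y \<le> (1 + sqrt 5 / 2) D, about 2.12 D;
    9/4 is a convenient larger number, the square of 3/2.\<close>
  have "y \<le> 9 / 4 * D"
  proof (rule ccontr)
    assume "\<not> y \<le> 9 / 4 * D"
    then have *: "y > 9 / 4 * D" "y - 2 * D > 1 / 4 * D" by auto
    have "(\<integral>x. (Y x)\<^sup>2 \<partial>Om)\<^sup>2 \<le> (D / 2)\<^sup>2"
      using second by (intro power_mono) auto
    then have "y * (y - 2 * D) \<le> D\<^sup>2 / 4"
      using fourth by (simp add: power2_eq_square algebra_simps)
    moreover have "y * (y - 2 * D) > (9 / 4 * D) * (1 / 4 * D)"
      using * D0 by (intro mult_strict_mono') auto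
    moreover have "(9 / 4 * D) * (1 / 4 * D) \<ge> D\<^sup>2 / 4"
      using D0 by (simp add: power2_eq_square)
    ultimately show False by linarith
  qed
  then have "(Lp_norm Om 4 Y)\<^sup>2 \<le> (3 / 2 * \<Theta> * sqrt (\<Sum>t\<in>I. (b t)\<^sup>2))\<^sup>2"
    by (simp add: y_def D_def power_mult_distrib sum_nonneg power2_eq_square[of 3] power_divide)
  then have "Lp_norm Om 4 Y \<le> 3 / 2 * \<Theta> * sqrt (\<Sum>t\<in>I. (b t)\<^sup>2)"
    by (rule power2_le_imp_le) (use \<Theta> in \<open>auto intro!: mult_nonneg_nonneg sum_nonneg\<close>)
  then show ?thesis by (simp add: Y_def)
qed

lemma bilinear_form_Lp:
  assumes "\<And>s. s \<in> I \<Longrightarrow> Lp_fun Om 4 (X s)" "\<And>t. t \<in> I \<Longrightarrow> Lp_fun Om 4 (Y t)"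
  shows "Lp_fun Om 2 (\<lambda>x. \<Sum>s\<in>I. \<Sum>t\<in>I. c s t * (X s x * Y t x))"
  using assms by (intro Lp_fun_sum Lp_fun_cmult Lp_fun_mult) auto

text \<open>Resampling one innovation changes T by products of the change of one factor with a
  linear form in the other process. Hoelder and \<open>linear_form_L4_bound\<close> bring in the row
  norms \<alpha> and the column norms \<beta> of c, \<open>sum_convolution_square_le\<close> adds up
  over the innovations, and Efron-Stein concludes.\<close>

lemma bilinear_form_L2_bound:
  fixes c :: "int \<Rightarrow> int \<Rightarrow> real"
  assumes X: "dependence_bound X d \<Theta>" and Y: "dependence_bound Y e \<Theta>'" and I: "finite I"
  defines "T \<equiv> \<lambda>x. \<Sum>s\<in>I. \<Sum>t\<in>I. c s t * (X s x * Y t x)"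
  shows "Lp_norm Om 2 (\<lambda>x. T x - (\<integral>z. T z \<partial>Om)) \<le> 3 * \<Theta> * \<Theta>' * sqrt (\<Sum>s\<in>I. \<Sum>t\<in>I. (c s t)\<^sup>2)"
proof -
  note XL = dependence_bound_Lp[OF X] and Y_Lp = dependence_bound_Lp[OF Y]
  note \<Theta> = dependence_bound_nonneg[OF X] dependence_bound_nonneg[OF Y]
  define C where "C = (\<Sum>s\<in>I. \<Sum>t\<in>I. (c s t)\<^sup>2)"
  define \<alpha> where "\<alpha> s = sqrt (\<Sum>t\<in>I. (c s t)\<^sup>2)" for s
  define \<beta> where "\<beta> t = sqrt (\<Sum>s\<in>I. (c s t)\<^sup>2)" for t
  have \<alpha>\<beta>: "(\<Sum>s\<in>I. (\<alpha> s)\<^sup>2) = C" "(\<Sum>t\<in>I. (\<beta> t)\<^sup>2) = C"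
    unfolding \<alpha>_def \<beta>_def C_def by (simp_all add: sum_nonneg) (rule sum.swap)
  have T: "Lp_fun Om 2 T"
    unfolding T_def using XL Y_Lp by (rule bilinear_form_Lp)
  have infl: "influence 2 T k \<le> 3 / 2 * \<Theta>' * (\<Sum>s\<in>I. d (s - k) * \<alpha> s) + 3 / 2 * \<Theta> * (\<Sum>t\<in>I. e (t - k) * \<beta> t)" for k
  proof -
    \<comment> \<open>From x y - x' y' = (x - x') y + (y - y') x': the linear form in Y is taken
      before resampling, the one in X after it.\<close>
    let ?A = "\<lambda>s q. (X s (fst q) - X s (resample {k} q)) * (\<Sum>t\<in>I. c s t * Y t (fst q))"
    let ?B = "\<lambda>t q. (Y t (fst q) - Y t (resample {k} q)) * (\<Sum>s\<in>I. c s t * X s (resample {k} q))"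
    have linY: "Lp_fun Om 4 (\<lambda>x. \<Sum>t\<in>I. c s t * Y t x)" for s
      by (intro Lp_fun_sum Lp_fun_cmult Y_Lp) auto
    have linX: "Lp_fun Om 4 (\<lambda>x. \<Sum>s\<in>I. c s t * X s x)" for t
      by (intro Lp_fun_sum Lp_fun_cmult XL) auto
    have AL: "Lp_fun Om2 2 (?A s)" for s
      by (intro Lp_fun_mult Lp_fun_diff Lp_fun_fst[OF XL] Lp_fun_resample[OF XL] Lp_fun_fst[OF linY])
    have B_Lp: "Lp_fun Om2 2 (?B t)" for t
      by (intro Lp_fun_mult Lp_fun_diff Lp_fun_fst[OF Y_Lp] Lp_fun_resample[OF Y_Lp] Lp_fun_resample[OF linX])
    have eq: "T (fst q) - T (resample {k} q) = (\<Sum>s\<in>I. ?A s q) + (\<Sum>t\<in>I. ?B t q)" for q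
    proof -
      have B: "(\<Sum>t\<in>I. ?B t q) = (\<Sum>s\<in>I. \<Sum>t\<in>I. (Y t (fst q) - Y t (resample {k} q)) * (c s t * X s (resample {k} q)))"
        by (simp only: sum_distrib_left) (rule sum.swap)
      show ?thesis
        unfolding B T_def unfolding sum_distrib_left sum.distrib[symmetric] sum_subtractf[symmetric]
        by (intro sum.cong refl) (simp add: algebra_simps)
    qed
    have nA: "Lp_norm Om2 2 (?A s) \<le> d (s - k) * (3 / 2 * \<Theta>' * \<alpha> s)" for s
    proof -
      have "Lp_norm Om2 2 (?A s) \<le> influence 4 (X s) k * Lp_norm Om2 4 (\<lambda>q. \<Sum>t\<in>I. c s t * Y t (fst q))"
        unfolding influence_def
        by (intro Hoelder_2_4_4 Lp_fun_diff Lp_fun_fst[OF XL] Lp_fun_resample[OF XL] Lp_fun_fst[OF linY])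
      also have "\<dots> = influence 4 (X s) k * Lp_norm Om 4 (\<lambda>x. \<Sum>t\<in>I. c s t * Y t x)"
        using Lp_norm_fst[OF Lp_fun_measurable[OF linY], of 4] by simp
      also have "\<dots> \<le> d (s - k) * (3 / 2 * \<Theta>' * \<alpha> s)"
        unfolding \<alpha>_def
        by (intro mult_mono dependence_bound_influence[OF X] linear_form_L4_bound[OF Y I] dependence_bound_pos[OF X]) simp
      finally show ?thesis .
    qed
    have nB: "Lp_norm Om2 2 (?B t) \<le> e (t - k) * (3 / 2 * \<Theta> * \<beta> t)" for t
    proof -
      have "Lp_norm Om2 2 (?B t) \<le> influence 4 (Y t) k * Lp_norm Om2 4 (\<lambda>q. \<Sum>s\<in>I. c s t * X s (resample {k} q))"
        unfolding influence_def
        by (intro Hoelder_2_4_4 Lp_fun_diff Lp_fun_fst[OF Y_Lp] Lp_fun_resample[OF Y_Lp] Lp_fun_resample[OF linX])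
      also have "\<dots> = influence 4 (Y t) k * Lp_norm Om 4 (\<lambda>x. \<Sum>s\<in>I. c s t * X s x)"
        using Lp_norm_resample[OF Lp_fun_measurable[OF linX], of 4] by simp
      also have "\<dots> \<le> e (t - k) * (3 / 2 * \<Theta> * \<beta> t)"
        unfolding \<beta>_def
        by (intro mult_mono dependence_bound_influence[OF Y] linear_form_L4_bound[OF X I] dependence_bound_pos[OF Y]) simp
      finally show ?thesis .
    qed
    have "influence 2 T k = Lp_norm Om2 2 (\<lambda>q. (\<Sum>s\<in>I. ?A s q) + (\<Sum>t\<in>I. ?B t q))"
      unfolding influence_def eq ..
    also have "\<dots> \<le> Lp_norm Om2 2 (\<lambda>q. \<Sum>s\<in>I. ?A s q) + Lp_norm Om2 2 (\<lambda>q. \<Sum>t\<in>I. ?B t q)"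
      using AL B_Lp by (intro Minkowski Lp_fun_sum) auto
    also have "\<dots> \<le> (\<Sum>s\<in>I. Lp_norm Om2 2 (?A s)) + (\<Sum>t\<in>I. Lp_norm Om2 2 (?B t))"
      using AL B_Lp by (intro add_mono Minkowski_sum) auto
    also have "\<dots> \<le> (\<Sum>s\<in>I. d (s - k) * (3 / 2 * \<Theta>' * \<alpha> s)) + (\<Sum>t\<in>I. e (t - k) * (3 / 2 * \<Theta> * \<beta> t))"
      using nA nB by (intro add_mono sum_mono) auto
    also have "\<dots> = 3 / 2 * \<Theta>' * (\<Sum>s\<in>I. d (s - k) * \<alpha> s) + 3 / 2 * \<Theta> * (\<Sum>t\<in>I. e (t - k) * \<beta> t)"
      unfolding sum_distrib_left by (intro arg_cong2[where f="(+)"] sum.cong refl) (simp_all add: mult_ac)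
    finally show ?thesis .
  qed
  have "(\<Sum>k\<in>K. (influence 2 T k)\<^sup>2) \<le> 9 * (\<Theta> * \<Theta>')\<^sup>2 * C" if K: "finite K" for K
  proof -
    define a where "a k = (\<Sum>s\<in>I. d (s - k) * \<alpha> s)" for k
    define b where "b k = (\<Sum>t\<in>I. e (t - k) * \<beta> t)" for k
    have "(influence 2 T k)\<^sup>2 \<le> 2 * (3 / 2 * \<Theta>' * a k)\<^sup>2 + 2 * (3 / 2 * \<Theta> * b k)\<^sup>2" for k
    proof -
      have "(influence 2 T k)\<^sup>2 \<le> (3 / 2 * \<Theta>' * a k + 3 / 2 * \<Theta> * b k)\<^sup>2"
        using infl[of k] by (intro power_mono) (auto simp: a_def b_def)
      also have "\<dots> \<le> 2 * (3 / 2 * \<Theta>' * a k)\<^sup>2 + 2 * (3 / 2 * \<Theta> * b k)\<^sup>2"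
        using sum_squares_bound[of "3 / 2 * \<Theta>' * a k" "3 / 2 * \<Theta> * b k"] unfolding power2_sum by linarith
      finally show ?thesis .
    qed
    then have "(\<Sum>k\<in>K. (influence 2 T k)\<^sup>2) \<le> (\<Sum>k\<in>K. 9 / 2 * \<Theta>'\<^sup>2 * (a k)\<^sup>2 + 9 / 2 * \<Theta>\<^sup>2 * (b k)\<^sup>2)"
      by (intro sum_mono) (simp add: power_mult_distrib power2_eq_square[of 3] power_divide mult.assoc)
    also have "\<dots> = 9 / 2 * \<Theta>'\<^sup>2 * (\<Sum>k\<in>K. (a k)\<^sup>2) + 9 / 2 * \<Theta>\<^sup>2 * (\<Sum>k\<in>K. (b k)\<^sup>2)"
      by (simp add: sum.distrib sum_distrib_left)
    also have "\<dots> \<le> 9 / 2 * \<Theta>'\<^sup>2 * (\<Theta>\<^sup>2 * C) + 9 / 2 * \<Theta>\<^sup>2 * (\<Theta>'\<^sup>2 * C)"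
      unfolding a_def b_def
      using sum_convolution_square_le[OF dependence_bound_pos[OF X] dependence_bound_sum[OF X] I K, of \<alpha>]
        sum_convolution_square_le[OF dependence_bound_pos[OF Y] dependence_bound_sum[OF Y] I K, of \<beta>]
      by (intro add_mono mult_left_mono) (auto simp: \<alpha>\<beta>)
    finally show ?thesis by (simp add: power_mult_distrib mult_ac)
  qed
  from Efron_Stein[OF T this]
  have "(\<integral>x. (T x)\<^sup>2 \<partial>Om) - (\<integral>x. T x \<partial>Om)\<^sup>2 \<le> 9 * (\<Theta> * \<Theta>')\<^sup>2 * C / 2" .
  moreover have "0 \<le> 9 * (\<Theta> * \<Theta>')\<^sup>2 * C" by (auto simp: C_def intro!: mult_nonneg_nonneg sum_nonneg)
  moreover have "(Lp_norm Om 2 (\<lambda>x. T x - (\<integral>z. T z \<partial>Om)))\<^sup>2 = (\<integral>x. (T x)\<^sup>2 \<partial>Om) - (\<integral>x. T x \<partial>Om)\<^sup>2"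
  proof -
    have "integrable Om (\<lambda>x. (T x)\<^sup>2)" using T by (simp add: Lp_fun_2_iff)
    moreover have "integrable Om T"
      using T \<open>integrable Om (\<lambda>x. (T x)\<^sup>2)\<close> by (rule Om.square_integrable_imp_integrable[OF Lp_fun_measurable])
    ultimately show ?thesis unfolding Lp_norm_2_square by (rule Om.variance_eq[rotated])
  qed
  moreover have "9 * (\<Theta> * \<Theta>')\<^sup>2 * C = (3 * \<Theta> * \<Theta>' * sqrt C)\<^sup>2"
    by (simp add: power_mult_distrib C_def sum_nonneg)
  \<comment> \<open>The factor 1/2 of Efron-Stein is given up in exchange for the plain constant
    3.\<close>
  ultimately have "(Lp_norm Om 2 (\<lambda>x. T x - (\<integral>z. T z \<partial>Om)))\<^sup>2 \<le> (3 * \<Theta> * \<Theta>' * sqrt C)\<^sup>2"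
    by linarith
  then show ?thesis unfolding C_def[symmetric]
    by (rule power2_le_imp_le) (use \<Theta> in \<open>auto simp: C_def intro!: mult_nonneg_nonneg sum_nonneg\<close>)
qed

subsection \<open>Truncating the memory of a process\<close>

text \<open>A version, defined at every point, of the conditional expectation given the coordinates
  outside A. The explicit integral makes its locality (\<open>average_over_mix\<close>) a pointwise
  identity.\<close>

definition average_over :: "int set \<Rightarrow> ((int \<Rightarrow> 's) \<Rightarrow> real) \<Rightarrow> (int \<Rightarrow> 's) \<Rightarrow> real" where
  "average_over A f x = (\<integral>y. f (mix A x y) \<partial>Om)"

lemma average_over_measurable [measurable]:
  assumes [measurable]: "f \<in> borel_measurable Om"
  shows "average_over A f \<in> borel_measurable Om"
  unfolding average_over_def[abs_def] by measurable

text \<open>Jensen's inequality for the inner integral, then Fubini. An even p makes the power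
  convex on the whole line and absorbs the absolute values.\<close>

lemma Lp_norm_integral_le:
  assumes p: "p > 0" "even p" and N: "prob_space N" and F: "Lp_fun (N \<Otimes>\<^sub>M Om) p F"
  shows "Lp_fun N p (\<lambda>x. \<integral>y. F (x, y) \<partial>Om)"
    and "Lp_norm N p (\<lambda>x. \<integral>y. F (x, y) \<partial>Om) \<le> Lp_norm (N \<Otimes>\<^sub>M Om) p F"
proof -
  interpret N: prob_space N by fact
  interpret NO: pair_prob_space N Om ..
  have [measurable]: "F \<in> borel_measurable (N \<Otimes>\<^sub>M Om)" using F by (simp add: Lp_fun_def)
  have i: "integrable (N \<Otimes>\<^sub>M Om) (\<lambda>q. \<bar>F q\<bar> ^ p)" using F by (simp add: Lp_fun_def)
  have pw: "AE x in N. \<bar>\<integral>y. F (x, y) \<partial>Om\<bar> ^ p \<le> (\<integral>y. \<bar>F (x, y)\<bar> ^ p \<partial>Om)"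
    using NO.AE_integrable_fst'[OF i]
  proof eventually_elim
    case (elim x)
    show ?case
    proof (cases "integrable Om (\<lambda>y. F (x, y))")
      case False
      \<comment> \<open>The default value 0 of the inner integral makes the inequality trivial
        here.\<close>
      then have "(\<integral>y. F (x, y) \<partial>Om) = 0" by (rule not_integrable_integral_eq)
      then show ?thesis using p by (simp add: zero_power)
    next
      case True
      have "(\<integral>y. F (x, y) \<partial>Om) ^ p \<le> (\<integral>y. F (x, y) ^ p \<partial>Om)"
        using True elim p convex_power_even[OF p(2)]
        by (intro Om.jensens_inequality[where I=UNIV and q="\<lambda>x. x ^ p"]) (auto simp: power_even_abs)
      then show ?thesis using p by (simp add: power_even_abs)
    qed
  qed
  have i1: "integrable N (\<lambda>x. \<integral>y. \<bar>F (x, y)\<bar> ^ p \<partial>Om)"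
    using NO.integrable_fst'[OF i] by simp
  have i2: "integrable N (\<lambda>x. \<bar>\<integral>y. F (x, y) \<partial>Om\<bar> ^ p)"
    using i1 by (rule Bochner_Integration.integrable_bound) (use pw in auto)
  then show "Lp_fun N p (\<lambda>x. \<integral>y. F (x, y) \<partial>Om)"
    by (auto simp: Lp_fun_def)
  have "(\<integral>x. \<bar>\<integral>y. F (x, y) \<partial>Om\<bar> ^ p \<partial>N) \<le> (\<integral>x. (\<integral>y. \<bar>F (x, y)\<bar> ^ p \<partial>Om) \<partial>N)"
    by (rule integral_mono_AE[OF i2 i1 pw])
  also have "\<dots> = (\<integral>q. \<bar>F q\<bar> ^ p \<partial>(N \<Otimes>\<^sub>M Om))"
    by (rule NO.integral_fst'[OF i])
  finally show "Lp_norm N p (\<lambda>x. \<integral>y. F (x, y) \<partial>Om) \<le> Lp_norm (N \<Otimes>\<^sub>M Om) p F"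
    unfolding Lp_norm_def using p by (intro real_root_le_mono) auto
qed

lemma average_over_Lp:
  assumes p: "p > 0" "even p" and f: "Lp_fun Om p f"
  shows "Lp_fun Om p (average_over A f)"
  using Lp_norm_integral_le(1)[OF p Om.prob_space_axioms Lp_fun_resample[OF f], of A]
  by (simp add: average_over_def[abs_def])

lemma average_over_mean:
  assumes f: "integrable Om f"
  shows "(\<integral>x. average_over A f x \<partial>Om) = (\<integral>x. f x \<partial>Om)"
proof -
  have [measurable]: "f \<in> borel_measurable Om" using f by simp
  have "integrable Om2 (\<lambda>q. f (resample A q))" using f by (simp add: integrable_resample)
  from Om2.integral_fst'[OF this] show ?thesis
    by (simp add: average_over_def integral_resample)
qed

lemma Lp_norm_cong_AE:
  assumes "f \<in> borel_measurable M" "g \<in> borel_measurable M" "AE x in M. f x = g x"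
  shows "Lp_norm M p f = Lp_norm M p g"
proof -
  have "(\<integral>x. \<bar>f x\<bar> ^ p \<partial>M) = (\<integral>x. \<bar>g x\<bar> ^ p \<partial>M)"
    using assms by (intro integral_cong_AE) auto
  then show ?thesis by (simp add: Lp_norm_def)
qed

lemma AE_integrable_mix:
  fixes f :: "(int \<Rightarrow> 's) \<Rightarrow> real"
  assumes f: "integrable Om f"
  shows "AE x in Om. integrable Om (\<lambda>y. f (mix A x y))"
proof -
  have [measurable]: "f \<in> borel_measurable Om" using f by simp
  have "integrable Om2 (\<lambda>q. f (resample A q))" using f by (simp add: integrable_resample)
  from Om2.AE_integrable_fst'[OF this] show ?thesis by simp
qed

text \<open>The left side is the norm of the average over y of f(x) - f(mix A x y), so
  \<open>Lp_norm_integral_le\<close> applies. This identity holds only almost everywhere, because of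
  the x for which the inner integral does not exist.\<close>

lemma average_over_approx:
  assumes f: "Lp_fun Om 4 f"
  shows "Lp_norm Om 4 (\<lambda>x. f x - average_over A f x) \<le> Lp_norm Om2 4 (\<lambda>q. f (fst q) - f (resample A q))"
proof -
  have [measurable]: "f \<in> borel_measurable Om" using f by (simp add: Lp_fun_def)
  have "Lp_norm Om 4 (\<lambda>x. f x - average_over A f x) = Lp_norm Om 4 (\<lambda>x. \<integral>y. f x - f (mix A x y) \<partial>Om)"
  proof (rule Lp_norm_cong_AE)
    show "AE x in Om. f x - average_over A f x = (\<integral>y. f x - f (mix A x y) \<partial>Om)"
      using AE_integrable_mix[OF integrable_Lp[OF f], of A]
      by eventually_elim (simp add: average_over_def Om.prob_space)
  qed measurable
  also have "\<dots> \<le> Lp_norm Om2 4 (\<lambda>q. f (fst q) - f (resample A q))"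
    using Lp_norm_integral_le(2)[OF _ _ Om.prob_space_axioms Lp_fun_diff[OF Lp_fun_fst[OF f] Lp_fun_resample[OF f, of A]]]
    by simp
  finally show ?thesis .
qed

lemma average_over_mix:
  assumes "B \<subseteq> A"
  shows "average_over A f (mix B x z) = average_over A f x"
proof -
  have "mix A (mix B x z) y = mix A x y" for y using assms by (auto simp: mix_def fun_eq_iff)
  then show ?thesis by (simp add: average_over_def)
qed

text \<open>Needed in \<open>influence_average_over\<close>, where the averaging variable is a third
  independent sequence. On rectangles Tonelli's theorem separates the factors and reduces the claim
  to \<open>distr_resample\<close>.\<close>

lemma distr_mix_pair:
  "distr (Om2 \<Otimes>\<^sub>M Om) Om2 (\<lambda>r. (mix A (fst (fst r)) (snd r), snd (fst r))) = Om2"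
proof (rule pair_measure_eqI[symmetric])
  interpret O3: pair_prob_space Om2 Om ..
  fix B C assume [measurable]: "B \<in> sets Om" "C \<in> sets Om"
  let ?T = "\<lambda>r. (mix A (fst (fst r)) (snd r), snd (fst r))"
  have "emeasure (distr (Om2 \<Otimes>\<^sub>M Om) Om2 ?T) (B \<times> C) = (\<integral>\<^sup>+ r. indicator (B \<times> C) (?T r) \<partial>(Om2 \<Otimes>\<^sub>M Om))"
    by (subst nn_integral_indicator[symmetric], simp, subst nn_integral_distr) auto
  also have "\<dots> = (\<integral>\<^sup>+ r. indicator B (mix A (fst (fst r)) (snd r)) * indicator C (snd (fst r)) \<partial>(Om2 \<Otimes>\<^sub>M Om))"
    by (simp add: indicator_times)
  also have "\<dots> = (\<integral>\<^sup>+ q. \<integral>\<^sup>+ y. indicator B (mix A (fst q) y) * indicator C (snd q) \<partial>Om \<partial>Om2)"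
    by (subst Om.nn_integral_fst[symmetric]) auto
  also have "\<dots> = (\<integral>\<^sup>+ q. (\<integral>\<^sup>+ y. indicator B (mix A (fst q) y) \<partial>Om) * indicator C (snd q) \<partial>Om2)"
    by (intro nn_integral_cong nn_integral_multc) (auto simp: space_pair_measure)
  also have "\<dots> = (\<integral>\<^sup>+ x. \<integral>\<^sup>+ x'. (\<integral>\<^sup>+ y. indicator B (mix A x y) \<partial>Om) * indicator C x' \<partial>Om \<partial>Om)"
    by (subst Om.nn_integral_fst[symmetric]) auto
  also have "\<dots> = (\<integral>\<^sup>+ x. (\<integral>\<^sup>+ y. indicator B (mix A x y) \<partial>Om) * emeasure Om C \<partial>Om)"
    by (intro nn_integral_cong, subst nn_integral_cmult) auto
  also have "\<dots> = (\<integral>\<^sup>+ x. (\<integral>\<^sup>+ y. indicator B (mix A x y) \<partial>Om) \<partial>Om) * emeasure Om C"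
    by (rule nn_integral_multc) measurable
  also have "(\<integral>\<^sup>+ x. (\<integral>\<^sup>+ y. indicator B (mix A x y) \<partial>Om) \<partial>Om) = (\<integral>\<^sup>+ q. indicator B (resample A q) \<partial>Om2)"
    by (subst Om.nn_integral_fst[symmetric]) auto
  also have "\<dots> = emeasure (distr Om2 Om (resample A)) B"
    by (subst nn_integral_indicator[symmetric], simp, subst nn_integral_distr) auto
  finally show "emeasure Om B * emeasure Om C = emeasure (distr (Om2 \<Otimes>\<^sub>M Om) Om2 ?T) (B \<times> C)"
    by (simp add: distr_resample)
qed (auto intro: Om.sigma_finite_measure_axioms)

text \<open>For k in A the average no longer depends on coordinate k. Otherwise averaging commutes
  with resampling k, and Jensen's inequality applies to the difference under the integral.\<close>

lemma influence_average_over: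
  assumes f: "Lp_fun Om 4 f"
  shows "influence 4 (average_over A f) k \<le> influence 4 f k"
proof (cases "k \<in> A")
  case True
  then have "average_over A f (mix {k} x y) = average_over A f x" for x y
    by (intro average_over_mix) auto
  then show ?thesis by (simp add: influence_def Lp_norm_0)
next
  case False
  interpret O3: pair_prob_space Om2 Om ..
  have [measurable]: "f \<in> borel_measurable Om" using f by (simp add: Lp_fun_def)
  define G where "G = (\<lambda>q. f (fst q) - f (resample {k} q))"
  let ?T = "\<lambda>r. (mix A (fst (fst r)) (snd r), snd (fst r))"
  have T [measurable]: "?T \<in> Om2 \<Otimes>\<^sub>M Om \<rightarrow>\<^sub>M Om2" by measurable
  have [measurable]: "G \<in> borel_measurable Om2" unfolding G_def by measurable
  have GL: "Lp_fun Om2 4 G"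
    unfolding G_def by (intro Lp_fun_diff Lp_fun_fst Lp_fun_resample f)
  have FL: "Lp_fun (Om2 \<Otimes>\<^sub>M Om) 4 (\<lambda>r. G (?T r))"
    using GL Lp_fun_distr[OF T, of G 4] by (simp add: distr_mix_pair)
  have com: "mix A (mix {k} x z) y = mix {k} (mix A x y) z" for x y z
    using False by (auto simp: mix_def fun_eq_iff)
  have iB: "AE q in Om2. integrable Om (\<lambda>y. f (mix A (resample B q) y))" for B
  proof (rule AE_distrD[where f="resample B" and M'=Om and P="\<lambda>x. integrable Om (\<lambda>y. f (mix A x y))"])
    show "AE x in distr Om2 Om (resample B). integrable Om (\<lambda>y. f (mix A x y))"
      unfolding distr_resample by (rule AE_integrable_mix[OF integrable_Lp[OF f]])
  qed measurable
  have "influence 4 (average_over A f) k = Lp_norm Om2 4 (\<lambda>q. \<integral>y. G (?T (q, y)) \<partial>Om)"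
    unfolding influence_def
  proof (rule Lp_norm_cong_AE)
    show "AE q in Om2. average_over A f (fst q) - average_over A f (resample {k} q) = (\<integral>y. G (?T (q, y)) \<partial>Om)"
      using iB[of "{}"] iB[of "{k}"] by eventually_elim (simp add: average_over_def G_def com)
  qed measurable
  also have "\<dots> \<le> Lp_norm (Om2 \<Otimes>\<^sub>M Om) 4 (\<lambda>r. G (?T r))"
    using Lp_norm_integral_le(2)[OF _ _ Om2.prob_space_axioms FL] by simp
  also have "\<dots> = Lp_norm Om2 4 G"
    using Lp_norm_distr[OF T, of G 4] by (simp add: distr_mix_pair)
  finally show ?thesis by (simp add: G_def influence_def)
qed

lemma influence_diff:
  assumes f: "Lp_fun Om 4 f" and h: "Lp_fun Om 4 h"
  shows "influence 4 (\<lambda>x. f x - h x) k \<le> influence 4 f k + influence 4 h k"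
proof -
  have "influence 4 (\<lambda>x. f x - h x) k = Lp_norm Om2 4 (\<lambda>q. (f (fst q) - f (resample {k} q)) - (h (fst q) - h (resample {k} q)))"
    unfolding influence_def by (simp add: algebra_simps)
  also have "\<dots> \<le> influence 4 f k + influence 4 h k"
    unfolding influence_def
    by (rule Minkowski_diff) (intro Lp_fun_diff Lp_fun_fst Lp_fun_resample f h | simp)+
  finally show ?thesis .
qed

lemma influence_le_norm:
  assumes f: "Lp_fun Om 4 f"
  shows "influence 4 f k \<le> 2 * Lp_norm Om 4 f"
proof -
  have "influence 4 f k \<le> Lp_norm Om2 4 (\<lambda>q. f (fst q)) + Lp_norm Om2 4 (\<lambda>q. f (resample {k} q))"
    unfolding influence_def by (rule Minkowski_diff) (intro Lp_fun_fst Lp_fun_resample f | simp)+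
  then show ?thesis using Lp_fun_measurable[OF f] by (simp add: Lp_norm_fst Lp_norm_resample)
qed

lemma distr_shift_pair: "distr Om2 Om2 (\<lambda>q. (shift_seq h (fst q), shift_seq h (snd q))) = Om2"
proof -
  have "distr Om Om (shift_seq h) \<Otimes>\<^sub>M distr Om Om (shift_seq h) = distr Om2 Om2 (\<lambda>(x, y). (shift_seq h x, shift_seq h y))"
    by (rule pair_measure_distr) (auto simp: distr_shift intro: Om.sigma_finite_measure_axioms)
  then show ?thesis unfolding distr_shift case_prod_beta' by simp
qed

lemma shift_mix: "shift_seq h (mix A x y) = mix ((\<lambda>a. a - h) ` A) (shift_seq h x) (shift_seq h y)"
proof
  fix t
  have "t + h \<in> A \<longleftrightarrow> t \<in> (\<lambda>a. a - h) ` A" by (auto simp: image_iff) (metis add_diff_cancel)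
  then show "shift_seq h (mix A x y) t = mix ((\<lambda>a. a - h) ` A) (shift_seq h x) (shift_seq h y) t"
    by (simp add: shift_seq_def mix_def)
qed

lemma influence_shift:
  assumes f: "f \<in> borel_measurable Om"
  shows "influence p (\<lambda>x. f (shift_seq h x)) k = influence p f (k - h)"
proof -
  have [measurable]: "f \<in> borel_measurable Om" by fact
  let ?S = "\<lambda>q. (shift_seq h (fst q), shift_seq h (snd q))"
  have "Lp_norm (distr Om2 Om2 ?S) p (\<lambda>q. f (fst q) - f (resample {k - h} q)) =
      Lp_norm Om2 p (\<lambda>q. f (fst (?S q)) - f (resample {k - h} (?S q)))"
    by (rule Lp_norm_distr) measurable
  then show ?thesis by (simp add: influence_def distr_shift_pair shift_mix)
qed

end

lemma sum_nonneg_part_le_suminf: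
  fixes e :: "nat \<Rightarrow> real"
  assumes e: "summable e" "\<And>n. 0 \<le> e n" and K: "finite (K :: int set)"
  shows "(\<Sum>j\<in>K. if j < 0 then 0 else e (nat j)) \<le> suminf e"
proof -
  have "(\<Sum>j\<in>K. if j < 0 then 0 else e (nat j)) = (\<Sum>j\<in>K \<inter> {0..}. e (nat j))"
    using K by (intro sum.mono_neutral_cong_right) (auto simp: not_less)
  also have "\<dots> = sum e (nat ` (K \<inter> {0..}))"
    by (subst sum.reindex) (auto simp: inj_on_def)
  also have "\<dots> \<le> suminf e" using K e by (intro sum_le_suminf) auto
  finally show ?thesis .
qed

text \<open>Stationarity is required pointwise and not only in law: a Bernoulli shift is one fixed
  function of the shifted sequence. Causality is expressed as invariance of X_0 under changes at
  positive times.\<close>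

locale causal_process = iid_sequence \<mu> for \<mu> :: "'s measure" +
  fixes X :: "int \<Rightarrow> (int \<Rightarrow> 's) \<Rightarrow> real"
  assumes X0_Lp: "Lp_fun Om 4 (X 0)"
    and X0_mean: "(\<integral>x. X 0 x \<partial>Om) = 0"
    and stationary: "\<And>t x. X t x = X 0 (shift_seq t x)"
    and causal: "\<And>A x y. A \<subseteq> {0<..} \<Longrightarrow> X 0 (mix A x y) = X 0 x"
    and summable_influence: "summable (\<lambda>j. influence 4 (X 0) (- int j))"
begin

text \<open>By stationarity \<open>dep j\<close> is the norm of \<open>X\<^sub>j - X\<^sub>j\<^sub>,\<^sub>{\<^sub>0\<^sub>}\<close> of the coupled process.\<close>

definition dep :: "nat \<Rightarrow> real" where "dep j = influence 4 (X 0) (- int j)"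

definition Theta :: real where "Theta = suminf dep"

lemma dep_nonneg [simp]: "0 \<le> dep j"
  by (simp add: dep_def)

lemma summable_dep: "summable dep"
  using summable_influence by (simp add: dep_def[abs_def])

lemma X_eq: "X t = (\<lambda>x. X 0 (shift_seq t x))"
  by (rule ext) (rule stationary)

lemma X_Lp: "Lp_fun Om 4 (X t)"
proof -
  have "Lp_fun (distr Om Om (shift_seq t)) 4 (X 0)" using X0_Lp by (simp add: distr_shift)
  then show ?thesis
    unfolding X_eq[of t]
    by (subst (asm) Lp_fun_distr) (auto intro: Lp_fun_measurable[OF X0_Lp])
qed

lemma X_mean: "(\<integral>x. X t x \<partial>Om) = 0"
  unfolding stationary[of t] by (subst integral_shift) (auto simp: X0_mean intro: Lp_fun_measurable[OF X0_Lp])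

lemma X_measurable [measurable]: "X t \<in> borel_measurable Om"
  using X_Lp by (rule Lp_fun_measurable)

lemma influence_X: "influence 4 (X t) k = (if t - k < 0 then 0 else dep (nat (t - k)))"
proof -
  have "influence 4 (X t) k = influence 4 (X 0) (k - t)"
    unfolding X_eq[of t] by (rule influence_shift) (rule Lp_fun_measurable[OF X0_Lp])
  moreover have "influence 4 (X 0) (k - t) = 0" if "t - k < 0"
    using causal[of "{k - t}"] that by (simp add: influence_def Lp_norm_0)
  ultimately show ?thesis by (simp add: dep_def)
qed

lemma dependence_bound_X: "dependence_bound X (\<lambda>j. if j < 0 then 0 else dep (nat j)) Theta"
  unfolding dependence_bound_def Theta_def
  using X_Lp X_mean influence_X sum_nonneg_part_le_suminf[OF summable_dep dep_nonneg] by auto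

text \<open>The projection on the innovations at times t - l, ..., t, so that values at times more
  than l apart are independent.\<close>

definition trunc :: "nat \<Rightarrow> int \<Rightarrow> (int \<Rightarrow> 's) \<Rightarrow> real" where
  "trunc l t = average_over (- {t - int l..t}) (X t)"

lemma trunc_Lp: "Lp_fun Om 4 (trunc l t)"
  unfolding trunc_def by (intro average_over_Lp X_Lp) auto

lemma trunc_measurable [measurable]: "trunc l t \<in> borel_measurable Om"
  using trunc_Lp by (rule Lp_fun_measurable)

lemma trunc_mean: "(\<integral>x. trunc l t x \<partial>Om) = 0"
  unfolding trunc_def by (subst average_over_mean) (auto simp: X_mean intro: integrable_Lp X_Lp)

lemma trunc_local: "A \<inter> {t - int l..t} = {} \<Longrightarrow> trunc l t (mix A x y) = trunc l t x"
  unfolding trunc_def by (intro average_over_mix) auto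

lemma trunc_stationary:
  assumes x [measurable]: "x \<in> space Om"
  shows "trunc l t x = trunc l 0 (shift_seq t x)"
proof -
  have [measurable]: "shift_seq t x \<in> space Om"
    using shift_measurable x by (rule measurable_space)
  have img: "(\<lambda>a. a - t) ` (- {t - int l..t}) = - {- int l..0}"
    by (auto simp: image_iff intro!: bexI[of _ "_ + t"])
  have "trunc l t x = (\<integral>y. X 0 (mix (- {- int l..0}) (shift_seq t x) (shift_seq t y)) \<partial>Om)"
    unfolding trunc_def average_over_def stationary[of t] shift_mix img ..
  also have "\<dots> = (\<integral>y. X 0 (mix (- {- int l..0}) (shift_seq t x) y) \<partial>Om)"
    using x by (intro integral_shift) measurable
  finally show ?thesis by (simp add: trunc_def average_over_def)
qed

section \<open>Smallness of the truncation error in the dependence norm\<close>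

definition trunc_error :: "nat \<Rightarrow> real" where
  "trunc_error l = Lp_norm Om 4 (\<lambda>x. X 0 x - trunc l 0 x)"

lemma trunc_error_nonneg [simp]: "0 \<le> trunc_error l"
  by (simp add: trunc_error_def)

lemma trunc_error_tendsto: "trunc_error \<longlonglongrightarrow> 0"
proof (rule null_sequence_bound)
  show "(\<lambda>l. Lp_norm Om2 4 (\<lambda>q. X 0 (fst q) - X 0 (resample (- {- int l..int l}) q))) \<longlonglongrightarrow> 0"
    by (rule resample_Lp_tendsto[OF _ X0_Lp]) simp
  fix l :: nat
  \<comment> \<open>The projection also averages over all innovations after time 0, whereas
    \<open>resample_Lp_tendsto\<close> keeps those up to time l fixed. By causality X_0 does not
    notice the difference.\<close>
  have eq: "mix (- {- int l..0}) x y = mix {0<..int l} (mix (- {- int l..int l}) x y) y" for x y :: "int \<Rightarrow> 's"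
    by (auto simp: mix_def fun_eq_iff)
  have "X 0 (mix (- {- int l..0}) x y) = X 0 (mix (- {- int l..int l}) x y)" for x y
    unfolding eq by (rule causal) auto
  then show "trunc_error l \<le> Lp_norm Om2 4 (\<lambda>q. X 0 (fst q) - X 0 (resample (- {- int l..int l}) q))"
    using average_over_approx[OF X0_Lp, of "- {- int l..0}"] by (simp add: trunc_error_def trunc_def)
qed simp

text \<open>The first bound tends to 0 with l at every lag, the second is summable over the lags.
  The minimum inherits both properties, so its sum tends to 0 by Tannery's theorem
  (\<open>Theta_error_tendsto\<close>).\<close>

definition dep_error :: "nat \<Rightarrow> nat \<Rightarrow> real" where
  "dep_error l j = min (2 * trunc_error l) (2 * dep j)"

definition Theta_error :: "nat \<Rightarrow> real" where
  "Theta_error l = suminf (dep_error l)"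

lemma dep_error_nonneg [simp]: "0 \<le> dep_error l j"
  by (simp add: dep_error_def)

lemma summable_dep_error: "summable (dep_error l)"
  by (rule summable_comparison_test'[OF summable_mult[OF summable_dep, of 2], of 0]) (simp add: dep_error_def)

lemma Theta_error_nonneg: "0 \<le> Theta_error l"
  unfolding Theta_error_def by (intro suminf_nonneg summable_dep_error) simp

lemma Theta_error_tendsto: "Theta_error \<longlonglongrightarrow> 0"
proof -
  have "(\<lambda>l. dep_error l j) \<longlonglongrightarrow> 0" for j
  proof (rule null_sequence_bound)
    show "(\<lambda>l. 2 * trunc_error l) \<longlonglongrightarrow> 0"
      using tendsto_mult_right_zero[OF trunc_error_tendsto, of 2] .
  qed (auto simp: dep_error_def)
  moreover have "\<forall>\<^sub>F (j, l) in at_top \<times>\<^sub>F sequentially. norm (dep_error l j) \<le> 2 * dep j"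
    by (intro always_eventually) (auto simp: dep_error_def)
  ultimately have "(\<lambda>l. \<Sum>j. dep_error l j) \<longlonglongrightarrow> (\<Sum>j. 0)"
    using tannerys_theorem[of "\<lambda>j l. dep_error l j" "\<lambda>j. 0" sequentially "\<lambda>j. 2 * dep j"]
      summable_mult[OF summable_dep, of 2] by simp
  then show ?thesis by (simp add: Theta_error_def[abs_def])
qed

lemma influence_trunc: "influence 4 (trunc l t) k \<le> (if t - k < 0 then 0 else dep (nat (t - k)))"
  unfolding trunc_def using influence_average_over[OF X_Lp] influence_X by metis

lemma dependence_bound_trunc: "dependence_bound (trunc l) (\<lambda>j. if j < 0 then 0 else dep (nat j)) Theta"
  unfolding dependence_bound_def Theta_def
  using trunc_Lp trunc_mean influence_trunc sum_nonneg_part_le_suminf[OF summable_dep dep_nonneg] by auto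

lemma dependence_bound_diff_trunc:
  "dependence_bound (\<lambda>t x. X t x - trunc l t x) (\<lambda>j. if j < 0 then 0 else dep_error l (nat j)) (Theta_error l)"
  unfolding dependence_bound_def
proof (intro conjI allI impI)
  fix t k
  show L: "Lp_fun Om 4 (\<lambda>x. X t x - trunc l t x)" by (intro Lp_fun_diff X_Lp trunc_Lp)
  show "(\<integral>x. X t x - trunc l t x \<partial>Om) = 0"
    by (subst Bochner_Integration.integral_diff) (auto simp: X_mean trunc_mean intro: integrable_Lp X_Lp trunc_Lp)
  have "Lp_norm Om 4 (\<lambda>x. X t x - trunc l t x) = Lp_norm Om 4 (\<lambda>x. X 0 (shift_seq t x) - trunc l 0 (shift_seq t x))"
    unfolding Lp_norm_def
    by (intro arg_cong[where f="root 4"] Bochner_Integration.integral_cong) (simp_all add: stationary[of t] trunc_stationary[of _ l t])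
  also have "\<dots> = trunc_error l"
    unfolding trunc_error_def
    by (rule Lp_norm_shift[of "\<lambda>x. X 0 x - trunc l 0 x"]) measurable
  finally have "influence 4 (\<lambda>x. X t x - trunc l t x) k \<le> 2 * trunc_error l"
    using influence_le_norm[OF L, of k] by simp
  moreover have "influence 4 (\<lambda>x. X t x - trunc l t x) k \<le> 2 * (if t - k < 0 then 0 else dep (nat (t - k)))"
    using influence_diff[OF X_Lp trunc_Lp, of t l t k] influence_trunc[of l t k] influence_X[of t k] by linarith
  ultimately show "influence 4 (\<lambda>x. X t x - trunc l t x) k \<le> (if t - k < 0 then 0 else dep_error l (nat (t - k)))"
    by (auto simp: dep_error_def split: if_splits)
next
  fix K :: "int set" assume "finite K"
  then show "(\<Sum>j\<in>K. if j < 0 then 0 else dep_error l (nat j)) \<le> Theta_error l"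
    unfolding Theta_error_def by (intro sum_nonneg_part_le_suminf summable_dep_error) auto
qed auto

end

subsection \<open>A characteristic function estimate by Stein's method\<close>

lemma norm_iexp_minus_linear_le: "cmod (iexp x - 1 - \<i> * x) \<le> x\<^sup>2 / 2"
  using iexp_approx1[of x 1] by (simp add: numeral_2_eq_2 diff_diff_eq)

lemma norm_iexp_minus_one_le: "cmod (iexp x - 1) \<le> \<bar>x\<bar>"
  using iexp_approx1[of x 0] by simp

lemma iexp_add: "iexp (x + y) = iexp x * iexp y"
  by (simp add: distrib_left exp_add)

lemma onorm_scaleR_right_le:
  fixes z :: "'a :: real_normed_vector"
  assumes "norm z \<le> b"
  shows "onorm (\<lambda>h. h *\<^sub>R z) \<le> b"
  by (rule onorm_le) (use mult_right_mono[OF assms] in \<open>simp add: mult.commute[of "\<bar>_\<bar>"]\<close>)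

context prob_space
begin

lemma integrable_mult_iexp:
  assumes "integrable M f" "g \<in> borel_measurable M"
  shows "integrable M (\<lambda>x. complex_of_real (f x) * iexp (g x))"
proof (rule Bochner_Integration.integrable_bound[of M f])
  show "AE x in M. norm (complex_of_real (f x) * iexp (g x)) \<le> norm (f x)"
    by (simp add: norm_mult)
qed (use assms in auto)

lemma integrable_iexp: "g \<in> borel_measurable M \<Longrightarrow> integrable M (\<lambda>x. iexp (g x))"
  using integrable_mult_iexp[of "\<lambda>_. 1" g] by simp

text \<open>With a finite second moment the Taylor remainder is at most h^2 E(Q^2) / 2, which is
  o(h); the derivative is verified from its definition.\<close>

lemma char_has_vector_derivative:
  assumes Q: "Lp_fun M 2 Q"
  shows "((\<lambda>u. \<integral>x. iexp (u * Q x) \<partial>M) has_vector_derivative (\<integral>x. \<i> * (complex_of_real (Q x) * iexp (u * Q x)) \<partial>M)) (at u)"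
proof -
  let ?\<phi> = "\<lambda>u. \<integral>x. iexp (u * Q x) \<partial>M"
  let ?D = "\<integral>x. \<i> * (complex_of_real (Q x) * iexp (u * Q x)) \<partial>M"
  have Qm [measurable]: "Q \<in> borel_measurable M" using Q by (rule Lp_fun_measurable)
  have Q2: "integrable M (\<lambda>x. (Q x)\<^sup>2)" using Q by (simp add: Lp_fun_2_iff)
  have Q1: "integrable M Q" using Qm Q2 by (rule square_integrable_imp_integrable)
  have iD: "integrable M (\<lambda>x. \<i> * (complex_of_real (Q x) * iexp (u * Q x)))"
    by (intro integrable_mult_right integrable_mult_iexp Q1) measurable
  have est: "norm (?\<phi> (u + h) - ?\<phi> u - h *\<^sub>R ?D) \<le> h\<^sup>2 * ((\<integral>x. (Q x)\<^sup>2 \<partial>M) / 2)" for h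
  proof -
    have i1: "integrable M (\<lambda>x. iexp (v * Q x))" for v by (rule integrable_iexp) measurable
    define R where "R x = iexp (u * Q x) * (iexp (h * Q x) - 1 - \<i> * complex_of_real (h * Q x))" for x
    have R: "R x = iexp ((u + h) * Q x) - iexp (u * Q x) - h *\<^sub>R (\<i> * (complex_of_real (Q x) * iexp (u * Q x)))" for x
    proof -
      have "iexp ((u + h) * Q x) = iexp (u * Q x) * iexp (h * Q x)"
        unfolding distrib_right by (rule iexp_add)
      then show ?thesis unfolding R_def by (simp add: right_diff_distrib scaleR_conv_of_real mult_ac)
    qed
    have iR: "integrable M R"
      unfolding R by (intro Bochner_Integration.integrable_diff i1 integrable_scaleR_right iD)
    have "?\<phi> (u + h) - ?\<phi> u - h *\<^sub>R ?D = (\<integral>x. R x \<partial>M)"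
    proof -
      have "(\<integral>x. R x \<partial>M) = (\<integral>x. iexp ((u + h) * Q x) - iexp (u * Q x) \<partial>M) - (\<integral>x. h *\<^sub>R (\<i> * (complex_of_real (Q x) * iexp (u * Q x))) \<partial>M)"
        unfolding R
        by (rule Bochner_Integration.integral_diff[OF Bochner_Integration.integrable_diff[OF i1 i1] integrable_scaleR_right[OF iD]])
      then show ?thesis
        by (simp only: Bochner_Integration.integral_diff[OF i1 i1] integral_scaleR_right)
    qed
    then have "norm (?\<phi> (u + h) - ?\<phi> u - h *\<^sub>R ?D) \<le> (\<integral>x. norm (R x) \<partial>M)"
      using integral_norm_bound[of M R] by simp
    also have "(\<integral>x. norm (R x) \<partial>M) \<le> (\<integral>x. h\<^sup>2 * ((Q x)\<^sup>2 / 2) \<partial>M)"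
    proof (rule integral_mono)
      show "integrable M (\<lambda>x. norm (R x))" using iR by (rule integrable_norm)
      show "integrable M (\<lambda>x. h\<^sup>2 * ((Q x)\<^sup>2 / 2))" using Q2 by auto
      fix x
      have "norm (R x) = norm (iexp (h * Q x) - 1 - \<i> * complex_of_real (h * Q x))"
        unfolding R_def by (simp only: norm_mult norm_exp_i_times mult_1_left)
      also have "\<dots> \<le> (h * Q x)\<^sup>2 / 2"
        by (rule norm_iexp_minus_linear_le)
      finally show "norm (R x) \<le> h\<^sup>2 * ((Q x)\<^sup>2 / 2)"
        by (simp add: power_mult_distrib)
    qed
    also have "(\<integral>x. h\<^sup>2 * ((Q x)\<^sup>2 / 2) \<partial>M) = h\<^sup>2 * ((\<integral>x. (Q x)\<^sup>2 \<partial>M) / 2)" by simp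
    finally show ?thesis .
  qed
  show ?thesis
    unfolding has_vector_derivative_def has_derivative_at
  proof (intro conjI)
    show "bounded_linear (\<lambda>h. h *\<^sub>R ?D)" by (rule bounded_linear_scaleR_left)
    let ?c = "(\<integral>x. (Q x)\<^sup>2 \<partial>M) / 2"
    show "(\<lambda>h. norm (?\<phi> (u + h) - ?\<phi> u - h *\<^sub>R ?D) / norm h) \<midarrow>0\<rightarrow> 0"
    proof (rule Lim_null_comparison)
      show "((\<lambda>h. \<bar>h\<bar> * ?c) \<longlongrightarrow> 0) (at 0)"
        by (rule tendsto_mult_left_zero[OF tendsto_rabs_zero[OF tendsto_ident_at]])
      have "norm (norm (?\<phi> (u + h) - ?\<phi> u - h *\<^sub>R ?D) / norm h) \<le> \<bar>h\<bar> * ?c" for h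
      proof (cases "h = 0")
        case False
        have "norm (?\<phi> (u + h) - ?\<phi> u - h *\<^sub>R ?D) \<le> (\<bar>h\<bar> * ?c) * \<bar>h\<bar>"
          using est[of h] by (simp add: power2_eq_square mult_ac)
        then show ?thesis using False by (simp add: divide_le_eq)
      qed simp
      then show "\<forall>\<^sub>F h in at 0. norm (norm (?\<phi> (u + h) - ?\<phi> u - h *\<^sub>R ?D) / norm h) \<le> \<bar>h\<bar> * ?c"
        by (rule always_eventually[OF allI])
    qed
  qed
qed

text \<open>The integrating factor exp(s v^2) turns the perturbed equation into a bound for the
  derivative of exp(s v^2) \<phi>(v). For |v| \<le> |u| it is at most exp(s u^2), which cancels
  after the mean value inequality.\<close>

lemma near_gaussian_if_near_ode:
  fixes \<phi> \<phi>' :: "real \<Rightarrow> complex" and s u r :: real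
  assumes deriv: "\<And>v. (\<phi> has_vector_derivative \<phi>' v) (at v)"
    and s: "s \<ge> 0" and init: "\<phi> 0 = 1"
    and bound: "\<And>v. \<bar>v\<bar> \<le> \<bar>u\<bar> \<Longrightarrow> cmod (\<phi>' v + 2 * s * v * \<phi> v) \<le> r"
  shows "cmod (\<phi> u - exp (- (s * u\<^sup>2))) \<le> \<bar>u\<bar> * r"
proof -
  let ?\<psi> = "\<lambda>v. exp (s * v\<^sup>2) *\<^sub>R \<phi> v"
  let ?\<psi>' = "\<lambda>v. exp (s * v\<^sup>2) *\<^sub>R (\<phi>' v + 2 * s * v * \<phi> v)"
  have d: "(?\<psi> has_vector_derivative ?\<psi>' v) (at v)" for v
  proof -
    have "((\<lambda>v. exp (s * v\<^sup>2)) has_real_derivative exp (s * v\<^sup>2) * (2 * s * v)) (at v)"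
      by (auto intro!: derivative_eq_intros)
    from has_vector_derivative_scaleR[OF this deriv[of v]]
    show ?thesis by (simp add: scaleR_conv_of_real algebra_simps)
  qed
  have "norm (?\<psi> u - ?\<psi> 0) \<le> (exp (s * u\<^sup>2) * r) * norm (u - 0)"
  proof (rule differentiable_bound)
    show "convex {v. \<bar>v\<bar> \<le> \<bar>u\<bar>}"
      using convex_cball[of "0::real" "\<bar>u\<bar>"] by (simp add: cball_def dist_real_def)
    fix v assume v: "v \<in> {v. \<bar>v\<bar> \<le> \<bar>u\<bar>}"
    show "(?\<psi> has_derivative (\<lambda>h. h *\<^sub>R ?\<psi>' v)) (at v within {v. \<bar>v\<bar> \<le> \<bar>u\<bar>})"
      using d[of v] has_derivative_at_withinI unfolding has_vector_derivative_def by blast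
    have "norm (?\<psi>' v) \<le> exp (s * u\<^sup>2) * r"
    proof -
      have "v\<^sup>2 \<le> u\<^sup>2" using v by (simp add: abs_le_square_iff)
      then have "exp (s * v\<^sup>2) \<le> exp (s * u\<^sup>2)" using s by (simp add: mult_left_mono)
      then show ?thesis using bound[of v] v by (simp add: mult_mono)
    qed
    then show "onorm (\<lambda>h. h *\<^sub>R ?\<psi>' v) \<le> exp (s * u\<^sup>2) * r"
      by (rule onorm_scaleR_right_le)
  qed auto
  then have "norm (exp (s * u\<^sup>2) *\<^sub>R \<phi> u - 1) \<le> exp (s * u\<^sup>2) * (\<bar>u\<bar> * r)"
    by (simp add: init mult_ac)
  moreover have "exp (s * u\<^sup>2) *\<^sub>R \<phi> u - 1 = exp (s * u\<^sup>2) *\<^sub>R (\<phi> u - exp (- (s * u\<^sup>2)))"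
  proof -
    have "complex_of_real (exp (s * u\<^sup>2)) * complex_of_real (exp (- (s * u\<^sup>2))) = 1"
      unfolding of_real_mult[symmetric] exp_add[symmetric] by simp
    then show ?thesis by (simp add: scaleR_conv_of_real right_diff_distrib)
  qed
  ultimately have "exp (s * u\<^sup>2) * norm (\<phi> u - exp (- (s * u\<^sup>2))) \<le> exp (s * u\<^sup>2) * (\<bar>u\<bar> * r)"
    by simp
  then show ?thesis by simp
qed

text \<open>Expand the second factor of exp(i u Q) = exp(i u U) exp(2 i u B V). The constant term
  vanishes as B is centred, the linear term gives 2 i u E(B^2) E(V^2 exp(i u U)), and returning from
  U to Q costs one more expansion. Independence is assumed in the form in which it is used, as
  factorization of integrals.\<close>

lemma stein_step:
  fixes B V U Q :: "'a \<Rightarrow> real"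
  assumes B: "Lp_fun M 4 B" and V: "Lp_fun M 4 V" and U [measurable]: "U \<in> borel_measurable M"
    and mean: "expectation B = 0"
    and indep: "\<And>(f::real \<Rightarrow> complex) (h::real \<times> real \<Rightarrow> complex). f \<in> borel_measurable borel \<Longrightarrow> h \<in> borel_measurable (borel \<Otimes>\<^sub>M borel) \<Longrightarrow>
      integrable M (\<lambda>x. f (B x)) \<Longrightarrow> integrable M (\<lambda>x. h (V x, U x)) \<Longrightarrow>
      integrable M (\<lambda>x. f (B x) * h (V x, U x)) \<and>
      expectation (\<lambda>x. f (B x) * h (V x, U x)) = expectation (\<lambda>x. f (B x)) * expectation (\<lambda>x. h (V x, U x))"
    and Q: "\<And>x. Q x = U x + 2 * B x * V x"
  shows "cmod (expectation (\<lambda>x. complex_of_real (B x * V x) * iexp (u * Q x)) -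
      2 * \<i> * u * expectation (\<lambda>x. (B x)\<^sup>2) * expectation (\<lambda>x. complex_of_real ((V x)\<^sup>2) * iexp (u * Q x)))
      \<le> 6 * u\<^sup>2 * (Lp_norm M 4 B ^ 3 * Lp_norm M 4 V ^ 3)"
proof -
  have Bm [measurable]: "B \<in> borel_measurable M" and Vm [measurable]: "V \<in> borel_measurable M"
    using B V by (auto simp: Lp_fun_def)
  have Q_eq: "Q = (\<lambda>x. U x + 2 * B x * V x)" using Q by (rule ext)
  have [measurable]: "Q \<in> borel_measurable M" unfolding Q_eq by measurable
  have B2: "Lp_fun M 2 B" and V2: "Lp_fun M 2 V"
    using B V by (auto intro: Lp_fun_mono)
  have iB2: "integrable M (\<lambda>x. (B x)\<^sup>2)" and iV2: "integrable M (\<lambda>x. (V x)\<^sup>2)"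
    using B2 V2 by (auto simp: Lp_fun_2_iff)
  have iB: "integrable M B" and iV: "integrable M V"
    using square_integrable_imp_integrable[OF Bm iB2] square_integrable_imp_integrable[OF Vm iV2] by auto
  have iB3: "integrable M (\<lambda>x. \<bar>B x\<bar> ^ 3)" and iV3: "integrable M (\<lambda>x. \<bar>V x\<bar> ^ 3)"
    using Lp_fun_mono[OF B, of 3] Lp_fun_mono[OF V, of 3] by (auto simp: Lp_fun_def)
  define b where "b = Lp_norm M 4 B"
  define v where "v = Lp_norm M 4 V"
  have bv: "b \<ge> 0" "v \<ge> 0" by (auto simp: b_def v_def)
  have eB3: "expectation (\<lambda>x. \<bar>B x\<bar> ^ 3) \<le> b ^ 3" and eV3: "expectation (\<lambda>x. \<bar>V x\<bar> ^ 3) \<le> v ^ 3"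
    using expectation_cube_le[OF B] expectation_cube_le[OF V] by (auto simp: b_def v_def)
  have eB: "expectation (\<lambda>x. \<bar>B x\<bar>) \<le> b"
    using expectation_abs_le[OF B2] Lp_norm_2_le_4[OF B] by (simp add: b_def)
  have eB2: "expectation (\<lambda>x. (B x)\<^sup>2) \<le> b\<^sup>2"
    unfolding Lp_norm_2_square[symmetric] b_def using Lp_norm_2_le_4[OF B] by (intro power_mono) auto
  have eB2': "0 \<le> expectation (\<lambda>x. (B x)\<^sup>2)" by simp
  have absprod: "integrable M (\<lambda>x. \<bar>B x\<bar> ^ j * \<bar>V x\<bar> ^ 3) \<and>
      expectation (\<lambda>x. \<bar>B x\<bar> ^ j * \<bar>V x\<bar> ^ 3) = expectation (\<lambda>x. \<bar>B x\<bar> ^ j) * expectation (\<lambda>x. \<bar>V x\<bar> ^ 3)"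
    if j: "integrable M (\<lambda>x. \<bar>B x\<bar> ^ j)" for j
  proof -
    have "integrable M (\<lambda>x. complex_of_real (\<bar>B x\<bar> ^ j) * complex_of_real (\<bar>V x\<bar> ^ 3)) \<and>
      expectation (\<lambda>x. complex_of_real (\<bar>B x\<bar> ^ j) * complex_of_real (\<bar>V x\<bar> ^ 3)) =
      expectation (\<lambda>x. complex_of_real (\<bar>B x\<bar> ^ j)) * expectation (\<lambda>x. complex_of_real (\<bar>V x\<bar> ^ 3))"
      using indep[of "\<lambda>b. complex_of_real (\<bar>b\<bar> ^ j)" "\<lambda>(v, _). complex_of_real (\<bar>v\<bar> ^ 3)"] j iV3
      by (simp del: of_real_power add: case_prod_beta)
    then show ?thesis
      by (simp only: of_real_mult[symmetric] complex_of_real_integrable_eq integral_complex_of_real of_real_eq_iff)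
  qed
  let ?e = "\<lambda>x. iexp (u * U x)"
  let ?EV = "expectation (\<lambda>x. complex_of_real ((V x)\<^sup>2) * ?e x)"
  let ?EVQ = "expectation (\<lambda>x. complex_of_real ((V x)\<^sup>2) * iexp (u * Q x))"
  have split: "iexp (u * Q x) = ?e x * iexp (2 * u * B x * V x)" for x
    unfolding Q iexp_add[symmetric] by (simp add: algebra_simps)
  have first: "integrable M (\<lambda>x. complex_of_real (B x) * (complex_of_real (V x) * ?e x)) \<and>
      expectation (\<lambda>x. complex_of_real (B x) * (complex_of_real (V x) * ?e x)) = 0"
    using indep[of complex_of_real "\<lambda>(v, w). complex_of_real v * iexp (u * w)"] iB iV
      integrable_mult_iexp[OF iV, of "\<lambda>x. u * U x"] by (simp add: case_prod_beta mean)
  have second: "integrable M (\<lambda>x. complex_of_real ((B x)\<^sup>2) * (complex_of_real ((V x)\<^sup>2) * ?e x)) \<and>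
      expectation (\<lambda>x. complex_of_real ((B x)\<^sup>2) * (complex_of_real ((V x)\<^sup>2) * ?e x)) = expectation (\<lambda>x. (B x)\<^sup>2) * ?EV"
    using indep[of "\<lambda>b. complex_of_real (b\<^sup>2)" "\<lambda>(v, w). complex_of_real (v\<^sup>2) * iexp (u * w)"] iB2 iV2
      integrable_mult_iexp[OF iV2, of "\<lambda>x. u * U x"] by (simp del: of_real_power add: case_prod_beta)
  have iBV: "integrable M (\<lambda>x. complex_of_real (B x * V x) * iexp (u * Q x))"
    by (intro integrable_mult_iexp integrable_mult_of_squares B2 V2) measurable
  have iVQ: "integrable M (\<lambda>x. complex_of_real ((V x)\<^sup>2) * iexp (u * Q x))"
    and iVU: "integrable M (\<lambda>x. complex_of_real ((V x)\<^sup>2) * ?e x)"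
    by (intro integrable_mult_iexp iV2, measurable)+
  \<comment> \<open>The remainder of the linear expansion is |B V| (2 u B V)^2 / 2, that is 2 u^2 |B
    V|^3.\<close>
  have A: "cmod (expectation (\<lambda>x. complex_of_real (B x * V x) * iexp (u * Q x)) - 2 * \<i> * u * expectation (\<lambda>x. (B x)\<^sup>2) * ?EV)
      \<le> 2 * u\<^sup>2 * (b ^ 3 * v ^ 3)"
  proof -
    let ?r = "\<lambda>x. complex_of_real (B x * V x) * iexp (u * Q x) - complex_of_real (B x) * (complex_of_real (V x) * ?e x)
        - (2 * \<i> * u) * (complex_of_real ((B x)\<^sup>2) * (complex_of_real ((V x)\<^sup>2) * ?e x))"
    have ir: "integrable M ?r" using iBV first second by auto
    have "expectation ?r = expectation (\<lambda>x. complex_of_real (B x * V x) * iexp (u * Q x)) - 0 - (2 * \<i> * u) * (expectation (\<lambda>x. (B x)\<^sup>2) * ?EV)"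
      using iBV first second by (simp del: of_real_power of_real_mult)
    then have "cmod (expectation (\<lambda>x. complex_of_real (B x * V x) * iexp (u * Q x)) - 2 * \<i> * u * expectation (\<lambda>x. (B x)\<^sup>2) * ?EV) = cmod (expectation ?r)"
      by (simp add: mult.assoc)
    also have "\<dots> \<le> expectation (\<lambda>x. cmod (?r x))" by (rule integral_norm_bound)
    also have "\<dots> \<le> expectation (\<lambda>x. 2 * u\<^sup>2 * (\<bar>B x\<bar> ^ 3 * \<bar>V x\<bar> ^ 3))"
    proof (rule integral_mono)
      show "integrable M (\<lambda>x. cmod (?r x))" using ir by (rule integrable_norm)
      show "integrable M (\<lambda>x. 2 * u\<^sup>2 * (\<bar>B x\<bar> ^ 3 * \<bar>V x\<bar> ^ 3))" using absprod[OF iB3] by simp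
      fix x
      let ?y = "2 * u * B x * V x"
      have "?r x = complex_of_real (B x * V x) * ?e x * (iexp ?y - 1 - \<i> * ?y)"
        unfolding split by (simp add: algebra_simps power2_eq_square)
      then have "cmod (?r x) = \<bar>B x * V x\<bar> * cmod (iexp ?y - 1 - \<i> * ?y)"
        by (simp only: norm_mult norm_exp_i_times norm_of_real mult_1_right)
      also have "\<dots> \<le> \<bar>B x * V x\<bar> * (?y\<^sup>2 / 2)"
        using norm_iexp_minus_linear_le[of ?y] by (intro mult_left_mono) auto
      also have "\<dots> = 2 * u\<^sup>2 * (\<bar>B x\<bar> ^ 3 * \<bar>V x\<bar> ^ 3)"
        by (simp add: abs_mult power_mult_distrib power3_eq_cube power2_eq_square)
      finally show "cmod (?r x) \<le> 2 * u\<^sup>2 * (\<bar>B x\<bar> ^ 3 * \<bar>V x\<bar> ^ 3)" .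
    qed
    also have "\<dots> = 2 * u\<^sup>2 * (expectation (\<lambda>x. \<bar>B x\<bar> ^ 3) * expectation (\<lambda>x. \<bar>V x\<bar> ^ 3))"
      using absprod[OF iB3] by simp
    also have "\<dots> \<le> 2 * u\<^sup>2 * (b ^ 3 * v ^ 3)"
      using eB3 eV3 bv by (intro mult_left_mono mult_mono) auto
    finally show ?thesis .
  qed
  \<comment> \<open>The return from U to Q uses |exp(i y) - 1| \<le> |y|. Multiplied by 2 |u| E(B^2)
    it contributes 4 u^2, which with the 2 u^2 of \<open>A\<close> makes the constant 6.\<close>
  have C: "cmod (?EVQ - ?EV) \<le> 2 * \<bar>u\<bar> * (b * v ^ 3)"
  proof -
    have "?EVQ - ?EV = expectation (\<lambda>x. complex_of_real ((V x)\<^sup>2) * iexp (u * Q x) - complex_of_real ((V x)\<^sup>2) * ?e x)"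
      by (rule Bochner_Integration.integral_diff[symmetric, OF iVQ iVU])
    also have "cmod \<dots> \<le> expectation (\<lambda>x. cmod (complex_of_real ((V x)\<^sup>2) * iexp (u * Q x) - complex_of_real ((V x)\<^sup>2) * ?e x))"
      by (rule integral_norm_bound)
    also have "\<dots> \<le> expectation (\<lambda>x. 2 * \<bar>u\<bar> * (\<bar>B x\<bar> ^ 1 * \<bar>V x\<bar> ^ 3))"
    proof (rule integral_mono)
      show "integrable M (\<lambda>x. cmod (complex_of_real ((V x)\<^sup>2) * iexp (u * Q x) - complex_of_real ((V x)\<^sup>2) * ?e x))"
        by (intro integrable_norm Bochner_Integration.integrable_diff iVQ iVU)
      show "integrable M (\<lambda>x. 2 * \<bar>u\<bar> * (\<bar>B x\<bar> ^ 1 * \<bar>V x\<bar> ^ 3))" using absprod[of 1] iB by simp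
      fix x
      let ?y = "2 * u * B x * V x"
      have "complex_of_real ((V x)\<^sup>2) * iexp (u * Q x) - complex_of_real ((V x)\<^sup>2) * ?e x = complex_of_real ((V x)\<^sup>2) * ?e x * (iexp ?y - 1)"
        unfolding split by (simp add: algebra_simps)
      then have "cmod (complex_of_real ((V x)\<^sup>2) * iexp (u * Q x) - complex_of_real ((V x)\<^sup>2) * ?e x) = (V x)\<^sup>2 * cmod (iexp ?y - 1)"
        by (simp only: norm_mult norm_exp_i_times norm_of_real mult_1_right) simp
      also have "\<dots> \<le> (V x)\<^sup>2 * \<bar>?y\<bar>"
        by (intro mult_left_mono norm_iexp_minus_one_le) simp
      also have "\<dots> = 2 * \<bar>u\<bar> * (\<bar>B x\<bar> ^ 1 * \<bar>V x\<bar> ^ 3)"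
        by (simp add: abs_mult power3_eq_cube power2_eq_square)
      finally show "cmod (complex_of_real ((V x)\<^sup>2) * iexp (u * Q x) - complex_of_real ((V x)\<^sup>2) * ?e x) \<le> 2 * \<bar>u\<bar> * (\<bar>B x\<bar> ^ 1 * \<bar>V x\<bar> ^ 3)" .
    qed
    also have "\<dots> = 2 * \<bar>u\<bar> * (expectation (\<lambda>x. \<bar>B x\<bar>) * expectation (\<lambda>x. \<bar>V x\<bar> ^ 3))"
      using absprod[of 1] iB by simp
    also have "\<dots> \<le> 2 * \<bar>u\<bar> * (b * v ^ 3)"
      using eB eV3 bv by (intro mult_left_mono mult_mono) auto
    finally show ?thesis .
  qed
  let ?c = "2 * \<i> * u * expectation (\<lambda>x. (B x)\<^sup>2)"
  let ?E = "expectation (\<lambda>x. complex_of_real (B x * V x) * iexp (u * Q x))"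
  have alg: "e - c * q = (e - c * p) - c * (q - p)" for e c q p :: complex by (simp add: algebra_simps)
  have "cmod (?E - ?c * ?EVQ) \<le> cmod (?E - ?c * ?EV) + cmod (?c * (?EVQ - ?EV))"
    unfolding alg[of ?E ?c ?EVQ ?EV] by (rule norm_triangle_ineq4)
  also have "cmod (?c * (?EVQ - ?EV)) = 2 * \<bar>u\<bar> * expectation (\<lambda>x. (B x)\<^sup>2) * cmod (?EVQ - ?EV)"
    using eB2' by (simp add: norm_mult)
  also have "\<dots> \<le> 2 * \<bar>u\<bar> * b\<^sup>2 * (2 * \<bar>u\<bar> * (b * v ^ 3))"
    using C eB2 eB2' bv by (intro mult_mono mult_left_mono) auto
  also have "\<dots> = 4 * u\<^sup>2 * (b ^ 3 * v ^ 3)"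
    by (simp add: power2_eq_square power3_eq_cube)
  finally show ?thesis using A by (simp add: b_def v_def)
qed

text \<open>The Stein-Tikhomirov method: \<open>2 i u \<sigma>\<^sup>2 \<Sum>\<^sub>k E (V\<^sub>k\<^sup>2 exp (i u Q))\<close> approximates
  \<open>E (Q exp (i u Q))\<close>, so a concentrated \<open>\<Sum>\<^sub>k V\<^sub>k\<^sup>2\<close> makes the characteristic function of \<open>Q\<close>
  nearly solve the differential equation of the Gaussian one.\<close>

lemma near_gaussian_quadratic_form:
  fixes B V U :: "nat \<Rightarrow> 'a \<Rightarrow> real" and Q :: "'a \<Rightarrow> real" and \<sigma>2 s \<rho> \<tau> u :: real
  assumes B: "\<And>k. k < N \<Longrightarrow> Lp_fun M 4 (B k)" and V: "\<And>k. k < N \<Longrightarrow> Lp_fun M 4 (V k)"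
    and U: "\<And>k. k < N \<Longrightarrow> U k \<in> borel_measurable M"
    and mean: "\<And>k. k < N \<Longrightarrow> expectation (B k) = 0"
    and var: "\<And>k. k < N \<Longrightarrow> expectation (\<lambda>x. (B k x)\<^sup>2) = \<sigma>2"
    and indep: "\<And>k (f::real \<Rightarrow> complex) (h::real \<times> real \<Rightarrow> complex). k < N \<Longrightarrow> f \<in> borel_measurable borel \<Longrightarrow> h \<in> borel_measurable (borel \<Otimes>\<^sub>M borel) \<Longrightarrow>
      integrable M (\<lambda>x. f (B k x)) \<Longrightarrow> integrable M (\<lambda>x. h (V k x, U k x)) \<Longrightarrow>
      integrable M (\<lambda>x. f (B k x) * h (V k x, U k x)) \<and>
      expectation (\<lambda>x. f (B k x) * h (V k x, U k x)) = expectation (\<lambda>x. f (B k x)) * expectation (\<lambda>x. h (V k x, U k x))"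
    and Q_split: "\<And>k x. k < N \<Longrightarrow> Q x = U k x + 2 * B k x * V k x"
    and Q_sum: "\<And>x. Q x = (\<Sum>k<N. B k x * V k x)"
    and s: "s \<ge> 0"
    and \<rho>: "Lp_norm M 2 (\<lambda>x. \<sigma>2 * (\<Sum>k<N. (V k x)\<^sup>2) - s) \<le> \<rho>"
    and \<tau>: "(\<Sum>k<N. Lp_norm M 4 (B k) ^ 3 * Lp_norm M 4 (V k) ^ 3) \<le> \<tau>"
  shows "cmod (expectation (\<lambda>x. iexp (u * Q x)) - exp (- (s * u\<^sup>2))) \<le> \<bar>u\<bar> * (2 * \<bar>u\<bar> * \<rho> + 6 * u\<^sup>2 * \<tau>)"
proof (rule near_gaussian_if_near_ode)
  have Q_eq: "Q = (\<lambda>x. \<Sum>k<N. B k x * V k x)" using Q_sum by (rule ext)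
  have QL: "Lp_fun M 2 Q"
    unfolding Q_eq using B V by (intro Lp_fun_sum Lp_fun_mult) auto
  have Qm [measurable]: "Q \<in> borel_measurable M" using QL by (rule Lp_fun_measurable)
  show "((\<lambda>u. expectation (\<lambda>x. iexp (u * Q x))) has_vector_derivative (\<integral>x. \<i> * (complex_of_real (Q x) * iexp (v * Q x)) \<partial>M)) (at v)" for v
    by (rule char_has_vector_derivative[OF QL])
  show "expectation (\<lambda>x. iexp (0 * Q x)) = 1" by (simp add: prob_space)
  show "0 \<le> s" by fact
  have \<tau>0: "0 \<le> \<tau>" by (rule order_trans[OF _ \<tau>]) (intro sum_nonneg mult_nonneg_nonneg zero_le_power Lp_norm_nonneg)
  have \<rho>0: "0 \<le> \<rho>" by (rule order_trans[OF Lp_norm_nonneg \<rho>])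
  fix v :: real assume v: "\<bar>v\<bar> \<le> \<bar>u\<bar>"
  define \<phi> where "\<phi> = expectation (\<lambda>x. iexp (v * Q x))"
  define a where "a k = expectation (\<lambda>x. complex_of_real (B k x * V k x) * iexp (v * Q x))" for k
  define w where "w k = expectation (\<lambda>x. complex_of_real ((V k x)\<^sup>2) * iexp (v * Q x))" for k
  have step: "cmod (a k - 2 * \<i> * v * \<sigma>2 * w k) \<le> 6 * v\<^sup>2 * (Lp_norm M 4 (B k) ^ 3 * Lp_norm M 4 (V k) ^ 3)" if "k < N" for k
    using stein_step[OF B[OF that] V[OF that] U[OF that] mean[OF that] indep[OF that] Q_split[OF that], where u=v]
    unfolding a_def w_def var[OF that] .
  have iBV: "integrable M (\<lambda>x. complex_of_real (B k x * V k x) * iexp (v * Q x))" if "k < N" for k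
    using B[OF that] V[OF that]
    by (intro integrable_mult_iexp integrable_mult_of_squares Lp_fun_mono[of 4 _ 2]) auto
  have iV2: "integrable M (\<lambda>x. (V k x)\<^sup>2)" if "k < N" for k
    using Lp_fun_mono[OF V[OF that], of 2] by (simp add: Lp_fun_2_iff)
  have iV: "integrable M (\<lambda>x. complex_of_real ((V k x)\<^sup>2) * iexp (v * Q x))" if "k < N" for k
    using iV2[OF that] by (intro integrable_mult_iexp) auto
  have ie: "integrable M (\<lambda>x. iexp (v * Q x))" by (rule integrable_iexp) measurable
  have sum_a: "expectation (\<lambda>x. \<i> * (complex_of_real (Q x) * iexp (v * Q x))) = \<i> * (\<Sum>k<N. a k)"
  proof -
    have "complex_of_real (Q x) * iexp (v * Q x) = (\<Sum>k<N. complex_of_real (B k x * V k x) * iexp (v * Q x))" for x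
      unfolding sum_distrib_right[symmetric] of_real_sum[symmetric] Q_sum[symmetric] ..
    then have "expectation (\<lambda>x. complex_of_real (Q x) * iexp (v * Q x)) = (\<Sum>k<N. a k)"
      unfolding a_def using iBV by (simp only:) (intro Bochner_Integration.integral_sum, simp)
    then show ?thesis by (simp only: integral_mult_right_zero)
  qed
  \<comment> \<open>The exponential has modulus 1, so the first absolute moment of the deviation
    suffices, and this is at most its L2 norm.\<close>
  have w_est: "cmod (\<sigma>2 * (\<Sum>k<N. w k) - s * \<phi>) \<le> \<rho>"
  proof -
    define D where "D x = \<sigma>2 * (\<Sum>k<N. (V k x)\<^sup>2) - s" for x
    have DL: "Lp_fun M 2 D"
      unfolding D_def[abs_def] using V
      by (intro Lp_fun_diff Lp_fun_cmult Lp_fun_sum Lp_fun_square Lp_fun_const) auto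
    have iD: "integrable M D"
      unfolding D_def[abs_def] using iV2 by (intro Bochner_Integration.integrable_diff integrable_mult_right Bochner_Integration.integrable_sum) auto
    have sum_w: "expectation (\<lambda>x. \<Sum>k<N. complex_of_real ((V k x)\<^sup>2) * iexp (v * Q x)) = (\<Sum>k<N. w k)"
      unfolding w_def using iV by (intro Bochner_Integration.integral_sum) simp
    have isum: "integrable M (\<lambda>x. \<Sum>k<N. complex_of_real ((V k x)\<^sup>2) * iexp (v * Q x))"
      using iV by (intro Bochner_Integration.integrable_sum) auto
    have "complex_of_real (D x) * iexp (v * Q x) = \<sigma>2 * (\<Sum>k<N. complex_of_real ((V k x)\<^sup>2) * iexp (v * Q x)) - s * iexp (v * Q x)" for x
      unfolding D_def sum_distrib_right[symmetric] of_real_sum[symmetric] by (simp add: algebra_simps)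
    then have "expectation (\<lambda>x. complex_of_real (D x) * iexp (v * Q x)) = \<sigma>2 * (\<Sum>k<N. w k) - s * \<phi>"
      using isum ie by (simp only: Bochner_Integration.integral_diff integrable_mult_right integral_mult_right_zero sum_w \<phi>_def)
    then have "cmod (\<sigma>2 * (\<Sum>k<N. w k) - s * \<phi>) \<le> expectation (\<lambda>x. cmod (complex_of_real (D x) * iexp (v * Q x)))"
      using integral_norm_bound[of M "\<lambda>x. complex_of_real (D x) * iexp (v * Q x)"] by (simp only:)
    also have "expectation (\<lambda>x. cmod (complex_of_real (D x) * iexp (v * Q x))) = expectation (\<lambda>x. \<bar>D x\<bar>)"
      by (simp only: norm_mult norm_of_real norm_exp_i_times mult_1_right)
    also have "expectation (\<lambda>x. \<bar>D x\<bar>) \<le> \<rho>"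
      using expectation_abs_le[OF DL] \<rho> by (simp add: D_def[abs_def])
    finally show ?thesis .
  qed
  have a_est: "cmod ((\<Sum>k<N. a k) - 2 * \<i> * v * (\<sigma>2 * (\<Sum>k<N. w k))) \<le> 6 * v\<^sup>2 * \<tau>"
  proof -
    have "(\<Sum>k<N. a k) - 2 * \<i> * v * (\<sigma>2 * (\<Sum>k<N. w k)) = (\<Sum>k<N. a k - 2 * \<i> * v * \<sigma>2 * w k)"
      unfolding sum_subtractf sum_distrib_left[symmetric] by (simp only: mult.assoc)
    then have "cmod ((\<Sum>k<N. a k) - 2 * \<i> * v * (\<sigma>2 * (\<Sum>k<N. w k))) \<le> (\<Sum>k<N. 6 * v\<^sup>2 * (Lp_norm M 4 (B k) ^ 3 * Lp_norm M 4 (V k) ^ 3))"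
      using step by (simp only:) (rule sum_norm_le, simp)
    also have "\<dots> \<le> 6 * v\<^sup>2 * \<tau>"
      unfolding sum_distrib_left[symmetric] using \<tau> by (intro mult_left_mono) auto
    finally show ?thesis .
  qed
  \<comment> \<open>The derivative is i times the sum of the \<open>a k\<close>. Replacing
    \<open>a k\<close> by 2 i v \<sigma>2 \<open>w k\<close> makes it -2 v \<sigma>2 times the sum
    of the \<open>w k\<close>, which is nearly -2 s v \<phi>; the two brackets are these two
    errors.\<close>
  have alg: "\<i> * A + 2 * s' * v' * p = \<i> * (A - 2 * \<i> * v' * W) - 2 * v' * (W - s' * p)" for A W s' v' p :: complex
    by (simp add: algebra_simps)
  have "cmod (\<i> * (\<Sum>k<N. a k) + 2 * s * v * \<phi>) \<le> cmod (\<i> * ((\<Sum>k<N. a k) - 2 * \<i> * v * (\<sigma>2 * (\<Sum>k<N. w k)))) + cmod (2 * v * (\<sigma>2 * (\<Sum>k<N. w k) - s * \<phi>))"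
    unfolding of_real_mult of_real_numeral alg[of "\<Sum>k<N. a k" s v \<phi> "\<sigma>2 * (\<Sum>k<N. w k)"] by (rule norm_triangle_ineq4)
  moreover have "cmod (2 * v * (\<sigma>2 * (\<Sum>k<N. w k) - s * \<phi>)) \<le> 2 * \<bar>v\<bar> * \<rho>"
    unfolding norm_mult norm_of_real abs_mult using w_est by (intro mult_mono) auto
  moreover have "cmod (\<i> * ((\<Sum>k<N. a k) - 2 * \<i> * v * (\<sigma>2 * (\<Sum>k<N. w k)))) \<le> 6 * v\<^sup>2 * \<tau>"
    unfolding norm_mult[of \<i>] norm_ii mult_1_left by (rule a_est)
  moreover have "2 * \<bar>v\<bar> * \<rho> \<le> 2 * \<bar>u\<bar> * \<rho>" using v \<rho>0 by (intro mult_right_mono) auto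
  moreover have "6 * v\<^sup>2 * \<tau> \<le> 6 * u\<^sup>2 * \<tau>" using v \<tau>0 by (intro mult_right_mono) (auto simp: abs_le_square_iff)
  ultimately show "cmod (expectation (\<lambda>x. \<i> * (complex_of_real (Q x) * iexp (v * Q x))) + 2 * s * v * expectation (\<lambda>x. iexp (v * Q x))) \<le> 2 * \<bar>u\<bar> * \<rho> + 6 * u\<^sup>2 * \<tau>"
    unfolding sum_a \<phi>_def[symmetric] by linarith
qed

end

subsection \<open>Frobenius norms and block averages\<close>

definition frobenius :: "'i set \<Rightarrow> ('i \<Rightarrow> 'i \<Rightarrow> real) \<Rightarrow> real" where
  "frobenius I a = sqrt (\<Sum>s\<in>I. \<Sum>t\<in>I. (a s t)\<^sup>2)"

definition mat_prod :: "'i set \<Rightarrow> ('i \<Rightarrow> 'i \<Rightarrow> real) \<Rightarrow> ('i \<Rightarrow> 'i \<Rightarrow> real) \<Rightarrow> 'i \<Rightarrow> 'i \<Rightarrow> real" where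
  "mat_prod I a b s t = (\<Sum>r\<in>I. a s r * b r t)"

lemma frobenius_eq_L2_set: "frobenius I a = L2_set (\<lambda>(s, t). a s t) (I \<times> I)"
  by (simp add: frobenius_def L2_set_def sum.cartesian_product case_prod_beta)

lemma frobenius_nonneg [simp]: "0 \<le> frobenius I a"
  by (simp add: frobenius_def sum_nonneg)

lemma frobenius_square: "(frobenius I a)\<^sup>2 = (\<Sum>s\<in>I. \<Sum>t\<in>I. (a s t)\<^sup>2)"
  by (simp add: frobenius_def sum_nonneg)

lemma frobenius_triangle: "frobenius I (\<lambda>s t. a s t + b s t) \<le> frobenius I a + frobenius I b"
  using L2_set_triangle_ineq[of "\<lambda>(s, t). a s t" "\<lambda>(s, t). b s t" "I \<times> I"]
  by (simp add: frobenius_eq_L2_set case_prod_unfold)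

lemma frobenius_minus_commute: "frobenius I (\<lambda>s t. a s t - b s t) = frobenius I (\<lambda>s t. b s t - a s t)"
  by (simp add: frobenius_def power2_commute)

lemma frobenius_diff_bound: "\<bar>frobenius I a - frobenius I b\<bar> \<le> frobenius I (\<lambda>s t. a s t - b s t)"
  using frobenius_triangle[of I "\<lambda>s t. a s t - b s t" b] frobenius_triangle[of I "\<lambda>s t. b s t - a s t" a]
    frobenius_minus_commute[of I a b] by simp

lemma frobenius_mat_prod_le: "frobenius I (mat_prod I a b) \<le> frobenius I a * frobenius I b"
proof -
  have "(\<Sum>s\<in>I. \<Sum>t\<in>I. (mat_prod I a b s t)\<^sup>2) \<le> (\<Sum>s\<in>I. \<Sum>t\<in>I. (\<Sum>r\<in>I. (a s r)\<^sup>2) * (\<Sum>r\<in>I. (b r t)\<^sup>2))"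
    unfolding mat_prod_def by (intro sum_mono Cauchy_Schwarz_ineq_sum)
  also have "\<dots> = (\<Sum>s\<in>I. \<Sum>r\<in>I. (a s r)\<^sup>2) * (\<Sum>t\<in>I. \<Sum>r\<in>I. (b r t)\<^sup>2)"
    by (simp only: sum_distrib_left[symmetric] sum_distrib_right[symmetric])
  also have "(\<Sum>t\<in>I. \<Sum>r\<in>I. (b r t)\<^sup>2) = (\<Sum>r\<in>I. \<Sum>t\<in>I. (b r t)\<^sup>2)" by (rule sum.swap)
  finally show ?thesis unfolding frobenius_def real_sqrt_mult[symmetric] by (rule real_sqrt_le_mono)
qed

text \<open>From c c = a a + (c - a) a + c (c - a) and submultiplicativity of the Frobenius
  norm.\<close>

lemma frobenius_square_perturb:
  "frobenius I (mat_prod I c c) \<le> frobenius I (mat_prod I a a) + frobenius I (\<lambda>s t. a s t - c s t) * (frobenius I a + frobenius I c)"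
proof -
  let ?d = "\<lambda>s t. c s t - a s t"
  have eq: "mat_prod I c c s t = mat_prod I a a s t + (mat_prod I ?d a s t + mat_prod I c ?d s t)" for s t
    unfolding mat_prod_def sum.distrib[symmetric] by (intro sum.cong refl) (simp add: algebra_simps)
  have "frobenius I (mat_prod I c c) = frobenius I (\<lambda>s t. mat_prod I a a s t + (mat_prod I ?d a s t + mat_prod I c ?d s t))"
    by (rule arg_cong[where f="frobenius I"]) (intro ext eq)
  also have "\<dots> \<le> frobenius I (mat_prod I a a) + frobenius I (\<lambda>s t. mat_prod I ?d a s t + mat_prod I c ?d s t)"
    by (rule frobenius_triangle)
  also have "frobenius I (\<lambda>s t. mat_prod I ?d a s t + mat_prod I c ?d s t) \<le> frobenius I (mat_prod I ?d a) + frobenius I (mat_prod I c ?d)"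
    by (rule frobenius_triangle)
  also have "frobenius I (mat_prod I ?d a) \<le> frobenius I ?d * frobenius I a" by (rule frobenius_mat_prod_le)
  also have "frobenius I (mat_prod I c ?d) \<le> frobenius I c * frobenius I ?d" by (rule frobenius_mat_prod_le)
  finally show ?thesis
    by (simp add: frobenius_minus_commute[of I c a] algebra_simps)
qed

text \<open>J collects the times that lie in blocks, \<open>blk\<close> numbers the blocks and q is
  their common length. In the application I - J consists of the gaps and of an incomplete period at
  the end.\<close>

locale block_partition =
  fixes I J :: "int set" and blk :: "int \<Rightarrow> nat" and N q :: nat and a :: "int \<Rightarrow> int \<Rightarrow> real"
  assumes finI: "finite I" and JI: "J \<subseteq> I" and blk: "\<And>s. s \<in> J \<Longrightarrow> blk s < N" and q: "q > 0"
    and card_block: "\<And>k. k < N \<Longrightarrow> card {s \<in> J. blk s = k} = q"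
    and sym: "\<And>s t. a s t = a t s"
begin

definition block :: "nat \<Rightarrow> int set" where "block k = {s \<in> J. blk s = k}"

definition block_avg :: "nat \<Rightarrow> nat \<Rightarrow> real" where
  "block_avg k l = (\<Sum>s\<in>block k. \<Sum>t\<in>block l. a s t) / (real q)\<^sup>2"

text \<open>Zero within a block, so that the cofactor of a block sum contains no time of the same
  block; constant on pairs of blocks, so that the form depends on the block sums only.\<close>

definition blocked :: "int \<Rightarrow> int \<Rightarrow> real" where
  "blocked s t = (if s \<in> J \<and> t \<in> J \<and> blk s \<noteq> blk t then block_avg (blk s) (blk t) else 0)"

lemma finJ: "finite J" using finI JI by (rule finite_subset[rotated])

lemma finite_block [simp]: "finite (block k)" using finJ by (simp add: block_def)

lemma card_block': "k < N \<Longrightarrow> card (block k) = q" using card_block by (simp add: block_def)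

lemma block_sub: "block k \<subseteq> J" by (auto simp: block_def)

lemma card_J: "card J = N * q"
proof -
  have "J = (\<Union>k<N. block k)" using blk by (auto simp: block_def)
  then have "card J = card (\<Union>k\<in>{..<N}. block k)" by simp
  also have "\<dots> = (\<Sum>k<N. card (block k))" by (rule card_UN_disjoint) (auto simp: block_def finJ)
  finally show ?thesis by (simp add: card_block')
qed

lemma sum_J_blocks: "(\<Sum>s\<in>J. F s) = (\<Sum>k<N. \<Sum>s\<in>block k. F s)"
proof -
  have "J = (\<Union>k<N. block k)" using blk by (auto simp: block_def)
  then have "(\<Sum>s\<in>J. F s) = (\<Sum>s\<in>(\<Union>k\<in>{..<N}. block k). F s)" by simp
  also have "\<dots> = (\<Sum>k<N. \<Sum>s\<in>block k. F s)" by (rule sum.UNION_disjoint) (auto simp: block_def finJ)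
  finally show ?thesis .
qed

text \<open>Each s' is counted once for every one of the q members of its block.\<close>

lemma sum_over_block: "(\<Sum>s\<in>J. \<Sum>s'\<in>block (blk s). F s') = real q * (\<Sum>s'\<in>J. F s' :: real)"
proof -
  have "(\<Sum>s\<in>J. \<Sum>s'\<in>block (blk s). F s') = (\<Sum>k<N. \<Sum>s\<in>block k. \<Sum>s'\<in>block (blk s). F s')"
    by (rule sum_J_blocks)
  also have "\<dots> = (\<Sum>k<N. \<Sum>s\<in>block k. \<Sum>s'\<in>block k. F s')"
    by (intro sum.cong refl) (simp add: block_def)
  also have "\<dots> = (\<Sum>k<N. real q * (\<Sum>s'\<in>block k. F s'))"
    by (intro sum.cong refl) (simp add: card_block')
  also have "\<dots> = real q * (\<Sum>s'\<in>J. F s')"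
    unfolding sum_J_blocks sum_distrib_left ..
  finally show ?thesis .
qed

lemma blocked_sym: "blocked s t = blocked t s"
proof -
  have "block_avg k l = block_avg l k" for k l
    unfolding block_avg_def by (subst sum.swap) (simp add: sym[of _ _])
  then show ?thesis by (auto simp: blocked_def)
qed

lemma avg_square_le:
  fixes F :: "int \<Rightarrow> int \<Rightarrow> real"
  assumes "k < N" "l < N"
  shows "((\<Sum>s\<in>block k. \<Sum>t\<in>block l. F s t) / (real q)\<^sup>2)\<^sup>2 \<le> (\<Sum>s\<in>block k. \<Sum>t\<in>block l. (F s t)\<^sup>2) / (real q)\<^sup>2"
proof -
  let ?P = "block k \<times> block l"
  have "(\<Sum>p\<in>?P. 1 * F (fst p) (snd p))\<^sup>2 \<le> (\<Sum>p\<in>?P. 1\<^sup>2) * (\<Sum>p\<in>?P. (F (fst p) (snd p))\<^sup>2)"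
    by (rule Cauchy_Schwarz_ineq_sum)
  then have "(\<Sum>s\<in>block k. \<Sum>t\<in>block l. F s t)\<^sup>2 \<le> (real q)\<^sup>2 * (\<Sum>s\<in>block k. \<Sum>t\<in>block l. (F s t)\<^sup>2)"
    using assms by (simp add: sum.cartesian_product case_prod_beta card_cartesian_product card_block' power2_eq_square)
  then have "(\<Sum>s\<in>block k. \<Sum>t\<in>block l. F s t)\<^sup>2 / ((real q)\<^sup>2)\<^sup>2 \<le> (real q)\<^sup>2 * (\<Sum>s\<in>block k. \<Sum>t\<in>block l. (F s t)\<^sup>2) / ((real q)\<^sup>2)\<^sup>2"
    by (rule divide_right_mono) simp
  then show ?thesis using q by (simp add: power_divide power2_eq_square)
qed

text \<open>The square of an average is at most the average of the squares, so averaging preserves a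
  common bound for the rows. The bound controls the norms of the cofactors V_k.\<close>

lemma blocked_row_bound:
  assumes row: "\<And>s. s \<in> I \<Longrightarrow> (\<Sum>t\<in>I. (a s t)\<^sup>2) \<le> \<alpha>" and s: "s \<in> J"
  shows "(\<Sum>t\<in>J. (blocked s t)\<^sup>2) \<le> \<alpha>"
proof -
  have "(\<Sum>t\<in>J. (blocked s t)\<^sup>2) \<le> (\<Sum>t\<in>J. (block_avg (blk s) (blk t))\<^sup>2)"
    by (intro sum_mono) (auto simp: blocked_def)
  also have "\<dots> \<le> (\<Sum>t\<in>J. (\<Sum>s'\<in>block (blk s). \<Sum>t'\<in>block (blk t). (a s' t')\<^sup>2) / (real q)\<^sup>2)"
    unfolding block_avg_def using blk s by (intro sum_mono avg_square_le) auto
  also have "\<dots> = (\<Sum>t\<in>J. \<Sum>t'\<in>block (blk t). \<Sum>s'\<in>block (blk s). (a s' t')\<^sup>2) / (real q)\<^sup>2"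
    unfolding sum_divide_distrib[symmetric] by (intro arg_cong2[where f="(/)"] sum.cong refl sum.swap)
  also have "\<dots> = (\<Sum>t'\<in>J. \<Sum>s'\<in>block (blk s). (a s' t')\<^sup>2) / real q"
    unfolding sum_over_block using q by (simp add: power2_eq_square)
  also have "\<dots> = (\<Sum>s'\<in>block (blk s). \<Sum>t'\<in>J. (a s' t')\<^sup>2) / real q"
    by (subst sum.swap) (rule refl)
  also have "\<dots> \<le> (\<Sum>s'\<in>block (blk s). \<alpha>) / real q"
  proof (intro divide_right_mono sum_mono)
    fix s' assume "s' \<in> block (blk s)"
    then have "s' \<in> I" using block_sub JI by blast
    have "(\<Sum>t'\<in>J. (a s' t')\<^sup>2) \<le> (\<Sum>t'\<in>I. (a s' t')\<^sup>2)" using finI JI by (intro sum_mono2) auto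
    then show "(\<Sum>t'\<in>J. (a s' t')\<^sup>2) \<le> \<alpha>" using row[OF \<open>s' \<in> I\<close>] by linarith
  qed simp
  also have "\<dots> = \<alpha>" using q card_block'[OF blk[OF s]] by simp
  finally show ?thesis .
qed

text \<open>An entry is compared with the average by moving first the row index and then the column
  index inside a block; symmetry of a lets \<eta> control both moves. The inequality (x + y)^2 \<le>
  2 x^2 + 2 y^2 for the two moves yields the factor 4.\<close>

lemma block_avg_close:
  assumes smooth: "\<And>s s'. s \<in> J \<Longrightarrow> s' \<in> J \<Longrightarrow> blk s = blk s' \<Longrightarrow> (\<Sum>t\<in>I. (a s t - a s' t)\<^sup>2) \<le> \<eta>"
  shows "(\<Sum>s\<in>J. \<Sum>t\<in>J. (a s t - block_avg (blk s) (blk t))\<^sup>2) \<le> 4 * real (N * q) * \<eta>"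
proof -
  have smooth': "(\<Sum>t\<in>J. (a s t - a s' t)\<^sup>2) \<le> \<eta>" if "s \<in> J" "s' \<in> block (blk s)" for s s'
  proof -
    have "(\<Sum>t\<in>J. (a s t - a s' t)\<^sup>2) \<le> (\<Sum>t\<in>I. (a s t - a s' t)\<^sup>2)" using finI JI by (intro sum_mono2) auto
    then show ?thesis using smooth[of s s'] that by (auto simp: block_def)
  qed
  have pw: "(a s t - block_avg (blk s) (blk t))\<^sup>2 \<le>
      2 / real q * (\<Sum>s'\<in>block (blk s). (a s t - a s' t)\<^sup>2) + 2 / (real q)\<^sup>2 * (\<Sum>t'\<in>block (blk t). \<Sum>s'\<in>block (blk s). (a s' t - a s' t')\<^sup>2)"
    if "s \<in> J" "t \<in> J" for s t
  proof -
    note cb = card_block'[OF blk[OF that(1)]] card_block'[OF blk[OF that(2)]]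
    have "a s t = (\<Sum>s'\<in>block (blk s). \<Sum>t'\<in>block (blk t). a s t) / (real q)\<^sup>2"
      using q cb by (simp add: power2_eq_square)
    then have "a s t - block_avg (blk s) (blk t) = (\<Sum>s'\<in>block (blk s). \<Sum>t'\<in>block (blk t). a s t - a s' t') / (real q)\<^sup>2"
      unfolding block_avg_def by (simp add: sum_subtractf diff_divide_distrib)
    then have "(a s t - block_avg (blk s) (blk t))\<^sup>2 \<le> (\<Sum>s'\<in>block (blk s). \<Sum>t'\<in>block (blk t). (a s t - a s' t')\<^sup>2) / (real q)\<^sup>2"
      using avg_square_le[OF blk[OF that(1)] blk[OF that(2)], of "\<lambda>s' t'. a s t - a s' t'"] by simp
    also have "\<dots> \<le> (\<Sum>s'\<in>block (blk s). \<Sum>t'\<in>block (blk t). 2 * (a s t - a s' t)\<^sup>2 + 2 * (a s' t - a s' t')\<^sup>2) / (real q)\<^sup>2"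
    proof (intro divide_right_mono sum_mono)
      fix s' t'
      have "(x + y)\<^sup>2 \<le> 2 * x\<^sup>2 + 2 * y\<^sup>2" for x y :: real
        using sum_squares_bound[of x y] by (simp add: power2_sum)
      from this[of "a s t - a s' t" "a s' t - a s' t'"]
      show "(a s t - a s' t')\<^sup>2 \<le> 2 * (a s t - a s' t)\<^sup>2 + 2 * (a s' t - a s' t')\<^sup>2" by simp
    qed simp
    also have "\<dots> = 2 / real q * (\<Sum>s'\<in>block (blk s). (a s t - a s' t)\<^sup>2) + 2 / (real q)\<^sup>2 * (\<Sum>s'\<in>block (blk s). \<Sum>t'\<in>block (blk t). (a s' t - a s' t')\<^sup>2)"
      using q cb by (simp add: sum.distrib sum_distrib_left[symmetric] add_divide_distrib power2_eq_square)
    also have "(\<Sum>s'\<in>block (blk s). \<Sum>t'\<in>block (blk t). (a s' t - a s' t')\<^sup>2) = (\<Sum>t'\<in>block (blk t). \<Sum>s'\<in>block (blk s). (a s' t - a s' t')\<^sup>2)"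
      by (rule sum.swap)
    finally show ?thesis .
  qed
  have "(\<Sum>s\<in>J. \<Sum>t\<in>J. (a s t - block_avg (blk s) (blk t))\<^sup>2) \<le>
    (\<Sum>s\<in>J. \<Sum>t\<in>J. 2 / real q * (\<Sum>s'\<in>block (blk s). (a s t - a s' t)\<^sup>2) + 2 / (real q)\<^sup>2 * (\<Sum>t'\<in>block (blk t). \<Sum>s'\<in>block (blk s). (a s' t - a s' t')\<^sup>2))"
    by (intro sum_mono pw)
  also have "\<dots> = 2 / real q * (\<Sum>s\<in>J. \<Sum>t\<in>J. \<Sum>s'\<in>block (blk s). (a s t - a s' t)\<^sup>2) + 2 / (real q)\<^sup>2 * (\<Sum>s\<in>J. \<Sum>t\<in>J. \<Sum>t'\<in>block (blk t). \<Sum>s'\<in>block (blk s). (a s' t - a s' t')\<^sup>2)"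
    by (simp only: sum.distrib sum_distrib_left[symmetric])
  also have "(\<Sum>s\<in>J. \<Sum>t\<in>J. \<Sum>s'\<in>block (blk s). (a s t - a s' t)\<^sup>2) = (\<Sum>s\<in>J. \<Sum>s'\<in>block (blk s). \<Sum>t\<in>J. (a s t - a s' t)\<^sup>2)"
    by (intro sum.cong refl sum.swap)
  also have "(\<Sum>s\<in>J. \<Sum>t\<in>J. \<Sum>t'\<in>block (blk t). \<Sum>s'\<in>block (blk s). (a s' t - a s' t')\<^sup>2) = real q * (\<Sum>t\<in>J. \<Sum>t'\<in>block (blk t). \<Sum>s'\<in>J. (a s' t - a s' t')\<^sup>2)"
  proof -
    have "(\<Sum>s\<in>J. \<Sum>t\<in>J. \<Sum>t'\<in>block (blk t). \<Sum>s'\<in>block (blk s). (a s' t - a s' t')\<^sup>2)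
      = (\<Sum>t\<in>J. \<Sum>t'\<in>block (blk t). \<Sum>s\<in>J. \<Sum>s'\<in>block (blk s). (a s' t - a s' t')\<^sup>2)"
      by (subst sum.swap) (intro sum.cong refl sum.swap)
    then show ?thesis unfolding sum_over_block sum_distrib_left .
  qed
  also have "(\<Sum>t\<in>J. \<Sum>t'\<in>block (blk t). \<Sum>s'\<in>J. (a s' t - a s' t')\<^sup>2) = (\<Sum>t\<in>J. \<Sum>t'\<in>block (blk t). \<Sum>s'\<in>J. (a t s' - a t' s')\<^sup>2)"
    by (intro sum.cong refl) (metis sym)
  also have "2 / real q * (\<Sum>s\<in>J. \<Sum>s'\<in>block (blk s). \<Sum>t\<in>J. (a s t - a s' t)\<^sup>2) + 2 / (real q)\<^sup>2 * (real q * (\<Sum>t\<in>J. \<Sum>t'\<in>block (blk t). \<Sum>s'\<in>J. (a t s' - a t' s')\<^sup>2))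
     = 4 / real q * (\<Sum>s\<in>J. \<Sum>s'\<in>block (blk s). \<Sum>t\<in>J. (a s t - a s' t)\<^sup>2)"
    using q by (simp add: power2_eq_square)
  also have "\<dots> \<le> 4 / real q * (\<Sum>s\<in>J. \<Sum>s'\<in>block (blk s). \<eta>)"
    by (intro mult_left_mono sum_mono smooth') auto
  also have "(\<Sum>s\<in>J. \<Sum>s'\<in>block (blk s). \<eta>) = real q * (real (N * q) * \<eta>)"
    unfolding sum_over_block by (simp add: card_J)
  finally show ?thesis using q by simp
qed

text \<open>Three sources of error: rows and columns outside J (hence the factor 2), the deleted
  diagonal blocks with N q^2 entries, and the averaging.\<close>

lemma frobenius_blocked_close:
  assumes row: "\<And>s. s \<in> I \<Longrightarrow> (\<Sum>t\<in>I. (a s t)\<^sup>2) \<le> \<alpha>"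
    and smooth: "\<And>s s'. s \<in> J \<Longrightarrow> s' \<in> J \<Longrightarrow> blk s = blk s' \<Longrightarrow> (\<Sum>t\<in>I. (a s t - a s' t)\<^sup>2) \<le> \<eta>"
    and diag: "\<And>s t. s \<in> J \<Longrightarrow> t \<in> J \<Longrightarrow> blk s = blk t \<Longrightarrow> (a s t)\<^sup>2 \<le> \<zeta>"
  shows "(frobenius I (\<lambda>s t. a s t - blocked s t))\<^sup>2 \<le> 2 * real (card (I - J)) * \<alpha> + real (N * q\<^sup>2) * \<zeta> + 4 * real (N * q) * \<eta>"
proof -
  let ?i = "\<lambda>P. if P then 1 else 0 :: real"
  have pw: "(a s t - blocked s t)\<^sup>2 \<le> ?i (s \<notin> J) * (a s t)\<^sup>2 + ?i (t \<notin> J) * (a s t)\<^sup>2 +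
      ?i (s \<in> J \<and> t \<in> J \<and> blk s = blk t) * (a s t)\<^sup>2 + ?i (s \<in> J \<and> t \<in> J) * (a s t - block_avg (blk s) (blk t))\<^sup>2" for s t
    by (auto simp: blocked_def)
  have restrict: "(\<Sum>s\<in>I. \<Sum>t\<in>I. ?i (s \<in> J \<and> t \<in> J) * F s t) = (\<Sum>s\<in>J. \<Sum>t\<in>J. F s t)" for F :: "int \<Rightarrow> int \<Rightarrow> real"
  proof -
    have "(\<Sum>s\<in>I. \<Sum>t\<in>I. ?i (s \<in> J \<and> t \<in> J) * F s t) = (\<Sum>s\<in>J. \<Sum>t\<in>I. ?i (s \<in> J \<and> t \<in> J) * F s t)"
      using finI JI by (intro sum.mono_neutral_right) auto
    also have "\<dots> = (\<Sum>s\<in>J. \<Sum>t\<in>J. ?i (s \<in> J \<and> t \<in> J) * F s t)"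
      using finI JI by (intro sum.cong refl sum.mono_neutral_right) auto
    finally show ?thesis by simp
  qed
  have r1: "(\<Sum>s\<in>I. \<Sum>t\<in>I. ?i (s \<notin> J) * (a s t)\<^sup>2) \<le> real (card (I - J)) * \<alpha>"
  proof -
    have "(\<Sum>s\<in>I. \<Sum>t\<in>I. ?i (s \<notin> J) * (a s t)\<^sup>2) = (\<Sum>s\<in>I - J. \<Sum>t\<in>I. ?i (s \<notin> J) * (a s t)\<^sup>2)"
      using finI by (intro sum.mono_neutral_right) auto
    also have "\<dots> \<le> (\<Sum>s\<in>I - J. \<alpha>)" by (intro sum_mono) (use row in auto)
    finally show ?thesis by simp
  qed
  have r2: "(\<Sum>s\<in>I. \<Sum>t\<in>I. ?i (t \<notin> J) * (a s t)\<^sup>2) \<le> real (card (I - J)) * \<alpha>"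
  proof -
    have "(\<Sum>s\<in>I. \<Sum>t\<in>I. ?i (t \<notin> J) * (a s t)\<^sup>2) = (\<Sum>t\<in>I. \<Sum>s\<in>I. ?i (t \<notin> J) * (a t s)\<^sup>2)"
      by (subst sum.swap) (intro sum.cong refl, metis sym)
    then show ?thesis using r1 by simp
  qed
  have r3: "(\<Sum>s\<in>I. \<Sum>t\<in>I. ?i (s \<in> J \<and> t \<in> J \<and> blk s = blk t) * (a s t)\<^sup>2) \<le> real (N * q\<^sup>2) * \<zeta>"
  proof -
    have "(\<Sum>s\<in>I. \<Sum>t\<in>I. ?i (s \<in> J \<and> t \<in> J \<and> blk s = blk t) * (a s t)\<^sup>2) = (\<Sum>s\<in>I. \<Sum>t\<in>I. ?i (s \<in> J \<and> t \<in> J) * (?i (blk t = blk s) * (a s t)\<^sup>2))"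
      by (intro sum.cong refl) auto
    also have "\<dots> = (\<Sum>s\<in>J. \<Sum>t\<in>J. ?i (blk t = blk s) * (a s t)\<^sup>2)" by (rule restrict)
    also have "\<dots> = (\<Sum>s\<in>J. \<Sum>t\<in>block (blk s). (a s t)\<^sup>2)"
    proof (rule sum.cong[OF refl])
      fix s
      have "(\<Sum>t\<in>J. ?i (blk t = blk s) * (a s t)\<^sup>2) = (\<Sum>t\<in>block (blk s). ?i (blk t = blk s) * (a s t)\<^sup>2)"
        using finJ by (intro sum.mono_neutral_right) (auto simp: block_def)
      also have "\<dots> = (\<Sum>t\<in>block (blk s). (a s t)\<^sup>2)" by (intro sum.cong refl) (simp add: block_def)
      finally show "(\<Sum>t\<in>J. ?i (blk t = blk s) * (a s t)\<^sup>2) = (\<Sum>t\<in>block (blk s). (a s t)\<^sup>2)" .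
    qed
    also have "\<dots> \<le> (\<Sum>s\<in>J. \<Sum>t\<in>block (blk s). \<zeta>)"
      by (intro sum_mono diag) (auto simp: block_def)
    also have "\<dots> = real (N * q\<^sup>2) * \<zeta>"
      unfolding sum_over_block by (simp add: card_J power2_eq_square)
    finally show ?thesis .
  qed
  have r4: "(\<Sum>s\<in>I. \<Sum>t\<in>I. ?i (s \<in> J \<and> t \<in> J) * (a s t - block_avg (blk s) (blk t))\<^sup>2) \<le> 4 * real (N * q) * \<eta>"
    unfolding restrict by (rule block_avg_close[OF smooth])
  have "(frobenius I (\<lambda>s t. a s t - blocked s t))\<^sup>2 \<le> (\<Sum>s\<in>I. \<Sum>t\<in>I. ?i (s \<notin> J) * (a s t)\<^sup>2 + ?i (t \<notin> J) * (a s t)\<^sup>2 +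
      ?i (s \<in> J \<and> t \<in> J \<and> blk s = blk t) * (a s t)\<^sup>2 + ?i (s \<in> J \<and> t \<in> J) * (a s t - block_avg (blk s) (blk t))\<^sup>2)"
    unfolding frobenius_square by (intro sum_mono pw)
  then show ?thesis using r1 r2 r3 r4 unfolding sum.distrib by linarith
qed

end

subsection \<open>Orthogonality of trigonometric kernels at Fourier frequencies\<close>

text \<open>The terms are real parts of a multiple of the powers of an n-th root of unity z, and z
  differs from 1 because n does not divide i; so the geometric sum vanishes. The phase c is kept for
  use in product formulas.\<close>

lemma sum_cos_fourier:
  fixes i :: int and n :: nat
  assumes "n > 0" "\<not> int n dvd i"
  shows "(\<Sum>t\<in>{1..int n}. cos (c + 2 * pi * of_int i * of_int t / real n)) = 0"
proof -
  define z where "z = cis (2 * pi * of_int i / real n)"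
  have zn: "z ^ n = 1"
  proof -
    have "z ^ n = cis (real n * (2 * pi * of_int i / real n))" unfolding z_def by (rule Complex.DeMoivre)
    also have "real n * (2 * pi * of_int i / real n) = 2 * pi * of_int i" using assms by simp
    finally show ?thesis using cis_multiple_2pi[of "of_int i"] by simp
  qed
  have z1: "z \<noteq> 1"
  proof
    assume "z = 1"
    then have "cos (2 * pi * of_int i / real n) = 1" by (simp add: z_def complex_eq_iff)
    then obtain k where "2 * pi * of_int i / real n = of_int k * 2 * pi"
      by (auto simp: cos_one_2pi_int)
    then have "real_of_int i = of_int k * real n" using assms by (simp add: field_simps)
    then have "i = k * int n" by (metis of_int_eq_iff of_int_mult of_int_of_nat_eq)
    then show False using assms by simp
  qed
  have term_eq: "cos (c + 2 * pi * of_int i * of_int (int (Suc t)) / real n) = Re (cis c * z * z ^ t)" for t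
  proof -
    have "cis c * z * z ^ t = cis (c + 2 * pi * of_int i * of_int (int (Suc t)) / real n)"
      unfolding z_def Complex.DeMoivre cis_mult by (simp add: add_divide_distrib algebra_simps)
    then show ?thesis by simp
  qed
  have "(\<Sum>t\<in>{1..int n}. cos (c + 2 * pi * of_int i * of_int t / real n)) = (\<Sum>t<n. cos (c + 2 * pi * of_int i * of_int (int (Suc t)) / real n))"
    by (rule sum.reindex_bij_witness[of _ "\<lambda>t. int (Suc t)" "\<lambda>t. nat (t - 1)"]) auto
  also have "\<dots> = Re (\<Sum>t<n. cis c * z * z ^ t)" unfolding term_eq by simp
  also have "(\<Sum>t<n. cis c * z * z ^ t) = cis c * z * (\<Sum>t<n. z ^ t)" by (simp add: sum_distrib_left)
  also have "(\<Sum>t<n. z ^ t) = 0" using z1 zn by (simp add: geometric_sum)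
  finally show ?thesis by simp
qed

text \<open>As a Toeplitz kernel in s - t this is the matrix of the normalized statistic when p j is
  \<kappa>_j divided by 2 pi n times the norm of \<kappa>.\<close>

definition trig_kernel :: "nat \<Rightarrow> nat \<Rightarrow> (nat \<Rightarrow> real) \<Rightarrow> int \<Rightarrow> real" where
  "trig_kernel n m p h = (\<Sum>j=1..m. p j * cos (of_int h * fourier_freq n j))"

lemma trig_kernel_minus: "trig_kernel n m p (- h) = trig_kernel n m p h"
  by (simp add: trig_kernel_def)

text \<open>The product formula leaves cosines with frequency indices j - k and j + k, whose sums
  over n times vanish unless n divides the index. By 2m < n this happens only for the difference
  with j = k. Matrix products thus act on coefficients, which makes row norms, the Frobenius norm
  and the matrix square explicit.\<close>

lemma trig_kernel_conv:
  assumes n: "2 * m < n"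
  shows "(\<Sum>t\<in>{1..int n}. trig_kernel n m p (s - t) * trig_kernel n m p' (r - t)) =
    trig_kernel n m (\<lambda>j. real n / 2 * (p j * p' j)) (s - r)"
proof -
  have orth: "(\<Sum>t\<in>{1..int n}. cos (of_int (s - t) * fourier_freq n j) * cos (of_int (r - t) * fourier_freq n k)) =
      (if j = k then real n / 2 * cos (of_int (s - r) * fourier_freq n j) else 0)"
    if j: "j \<in> {1..m}" and k: "k \<in> {1..m}" for j k
  proof -
    let ?c = "of_int s * fourier_freq n j - of_int r * fourier_freq n k"
    let ?d = "of_int s * fourier_freq n j + of_int r * fourier_freq n k"
    have "cos (of_int (s - t) * fourier_freq n j) * cos (of_int (r - t) * fourier_freq n k) =
       cos (?c + 2 * pi * of_int (int k - int j) * of_int t / real n) / 2 + cos (?d + 2 * pi * of_int (- int k - int j) * of_int t / real n) / 2" for t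
    proof -
      have e1: "of_int (s - t) * fourier_freq n j - of_int (r - t) * fourier_freq n k = ?c + 2 * pi * of_int (int k - int j) * of_int t / real n"
        by (simp add: fourier_freq_def algebra_simps add_divide_distrib diff_divide_distrib)
      have e2: "of_int (s - t) * fourier_freq n j + of_int (r - t) * fourier_freq n k = ?d + 2 * pi * of_int (- int k - int j) * of_int t / real n"
        by (simp add: fourier_freq_def algebra_simps add_divide_distrib diff_divide_distrib)
      show ?thesis unfolding cos_times_cos e1 e2 by (rule add_divide_distrib)
    qed
    then have "(\<Sum>t\<in>{1..int n}. cos (of_int (s - t) * fourier_freq n j) * cos (of_int (r - t) * fourier_freq n k)) =
      (\<Sum>t\<in>{1..int n}. cos (?c + 2 * pi * of_int (int k - int j) * of_int t / real n)) / 2 +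
      (\<Sum>t\<in>{1..int n}. cos (?d + 2 * pi * of_int (- int k - int j) * of_int t / real n)) / 2"
      by (simp only: sum.distrib sum_divide_distrib)
    moreover have "(\<Sum>t\<in>{1..int n}. cos (?d + 2 * pi * of_int (- int k - int j) * of_int t / real n)) = 0"
    proof (rule sum_cos_fourier)
      show "\<not> int n dvd - int k - int j"
      proof
        assume "int n dvd - int k - int j"
        moreover have eq: "int k + int j = - (- int k - int j)" by simp
        ultimately have "int n dvd int (k + j)" by (simp only: of_nat_add eq dvd_minus_iff)
        then have "n \<le> k + j" using j by (simp only: int_dvd_int_iff) (rule dvd_imp_le, auto)
        then show False using j k n by simp
      qed
    qed (use n in simp)
    moreover have "(\<Sum>t\<in>{1..int n}. cos (?c + 2 * pi * of_int (int k - int j) * of_int t / real n)) = 0" if "j \<noteq> k"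
    proof (rule sum_cos_fourier)
      show "\<not> int n dvd int k - int j"
      proof
        assume "int n dvd int k - int j"
        then have "\<bar>int n\<bar> \<le> \<bar>int k - int j\<bar>" using that by (intro dvd_imp_le_int) auto
        then show False using j k n by auto
      qed
    qed (use n in simp)
    moreover have "(\<Sum>t\<in>{1..int n}. cos (?c + 2 * pi * of_int (int k - int j) * of_int t / real n)) = real n * cos (of_int (s - r) * fourier_freq n j)" if "j = k"
      using that by (simp add: left_diff_distrib)
    ultimately show ?thesis by auto
  qed
  have "(\<Sum>t\<in>{1..int n}. trig_kernel n m p (s - t) * trig_kernel n m p' (r - t)) =
    (\<Sum>t\<in>{1..int n}. \<Sum>j=1..m. \<Sum>k=1..m. (p j * p' k) * (cos (of_int (s - t) * fourier_freq n j) * cos (of_int (r - t) * fourier_freq n k)))"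
    unfolding trig_kernel_def sum_product by (intro sum.cong refl) (simp add: mult_ac)
  also have "\<dots> = (\<Sum>j=1..m. \<Sum>k=1..m. (p j * p' k) * (\<Sum>t\<in>{1..int n}. cos (of_int (s - t) * fourier_freq n j) * cos (of_int (r - t) * fourier_freq n k)))"
    unfolding sum_distrib_left by (subst sum.swap) (intro sum.cong refl sum.swap)
  also have "\<dots> = (\<Sum>j=1..m. \<Sum>k=1..m. if j = k then (p j * p' k) * (real n / 2 * cos (of_int (s - r) * fourier_freq n j)) else 0)"
    by (intro sum.cong refl) (subst orth, auto)
  also have "\<dots> = trig_kernel n m (\<lambda>j. real n / 2 * (p j * p' j)) (s - r)"
    unfolding trig_kernel_def by (intro sum.cong refl) (simp add: mult_ac)
  finally show ?thesis .
qed

lemma trig_kernel_row: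
  assumes "2 * m < n"
  shows "(\<Sum>t\<in>{1..int n}. (trig_kernel n m p (s - t))\<^sup>2) = real n / 2 * (\<Sum>j=1..m. (p j)\<^sup>2)"
  using trig_kernel_conv[OF assms, of p s p s]
  by (simp add: power2_eq_square trig_kernel_def sum_distrib_left)

lemma trig_kernel_frobenius:
  assumes "2 * m < n"
  shows "(frobenius {1..int n} (\<lambda>s t. trig_kernel n m p (s - t)))\<^sup>2 = (real n)\<^sup>2 / 2 * (\<Sum>j=1..m. (p j)\<^sup>2)"
  unfolding frobenius_square trig_kernel_row[OF assms] by (simp add: power2_eq_square)

lemma trig_kernel_mat_prod:
  assumes "2 * m < n"
  shows "mat_prod {1..int n} (\<lambda>s t. trig_kernel n m p (s - t)) (\<lambda>s t. trig_kernel n m p (s - t)) =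
    (\<lambda>s t. trig_kernel n m (\<lambda>j. real n / 2 * (p j)\<^sup>2) (s - t))"
proof (intro ext)
  fix s t
  have "trig_kernel n m p (r - t) = trig_kernel n m p (t - r)" for r
    using trig_kernel_minus[of n m p "r - t"] by simp
  then show "mat_prod {1..int n} (\<lambda>s t. trig_kernel n m p (s - t)) (\<lambda>s t. trig_kernel n m p (s - t)) s t = trig_kernel n m (\<lambda>j. real n / 2 * (p j)\<^sup>2) (s - t)"
    unfolding mat_prod_def using trig_kernel_conv[OF assms, of p s p t] by (simp add: power2_eq_square)
qed

lemma one_minus_cos_le: "2 - 2 * cos x \<le> x\<^sup>2" for x :: real
proof -
  have "2 - 2 * cos x = 4 * (sin (x / 2))\<^sup>2" using cos_double_sin[of "x / 2"] by simp
  also have "\<dots> \<le> 4 * (x / 2)\<^sup>2"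
    using abs_sin_x_le_abs_x[of "x / 2"] by (intro mult_left_mono) (auto simp: abs_le_square_iff[symmetric])
  finally show ?thesis by (simp add: power_divide)
qed

text \<open>Expanding the square with \<open>trig_kernel_conv\<close> leaves 2 - 2 cos((s - s')
  \<omega>_j), which is at most (2 pi m L / n)^2. Through this ratio m = o(n) makes the kernel
  nearly constant on blocks of fixed length.\<close>

lemma trig_kernel_smooth:
  assumes mn: "2 * m < n" and L: "\<bar>s - s'\<bar> \<le> int L"
  shows "(\<Sum>t\<in>{1..int n}. (trig_kernel n m p (s - t) - trig_kernel n m p (s' - t))\<^sup>2) \<le> real n / 2 * (\<Sum>j=1..m. (p j)\<^sup>2) * (2 * pi * real m * real L / real n)\<^sup>2"
proof -
  let ?K = "trig_kernel n m p"
  have "(?K (s - t) - ?K (s' - t))\<^sup>2 = (?K (s - t))\<^sup>2 + (?K (s' - t))\<^sup>2 - 2 * (?K (s - t) * ?K (s' - t))" for t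
    by (simp add: power2_diff)
  then have "(\<Sum>t\<in>{1..int n}. (?K (s - t) - ?K (s' - t))\<^sup>2) = real n / 2 * (\<Sum>j=1..m. (p j)\<^sup>2) + real n / 2 * (\<Sum>j=1..m. (p j)\<^sup>2)
     - 2 * trig_kernel n m (\<lambda>j. real n / 2 * (p j * p j)) (s - s')"
    by (simp only: sum.distrib sum_subtractf sum_distrib_left[symmetric] trig_kernel_row[OF mn] trig_kernel_conv[OF mn])
  also have "\<dots> = real n / 2 * (\<Sum>j=1..m. (p j)\<^sup>2 * (2 - 2 * cos (of_int (s - s') * fourier_freq n j)))"
  proof -
    have k: "trig_kernel n m (\<lambda>j. real n / 2 * (p j * p j)) h = real n / 2 * (\<Sum>j=1..m. (p j)\<^sup>2 * cos (of_int h * fourier_freq n j))" for h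
      unfolding trig_kernel_def sum_distrib_left by (intro sum.cong refl) (simp add: power2_eq_square)
    have "(\<Sum>j=1..m. (p j)\<^sup>2 * (2 - 2 * cos (of_int (s - s') * fourier_freq n j))) = 2 * (\<Sum>j=1..m. (p j)\<^sup>2) - 2 * (\<Sum>j=1..m. (p j)\<^sup>2 * cos (of_int (s - s') * fourier_freq n j))"
      unfolding sum_distrib_left sum_subtractf[symmetric] by (intro sum.cong refl) (simp add: algebra_simps)
    then show ?thesis unfolding k by (simp only:) (simp add: algebra_simps)
  qed
  also have "\<dots> \<le> real n / 2 * (\<Sum>j=1..m. (p j)\<^sup>2 * (2 * pi * real m * real L / real n)\<^sup>2)"
  proof (intro mult_left_mono sum_mono)
    fix j assume j: "j \<in> {1..m}"
    have "\<bar>of_int (s - s') * fourier_freq n j\<bar> \<le> real L * (2 * pi * real m / real n)"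
      unfolding abs_mult
    proof (rule mult_mono)
      show "\<bar>real_of_int (s - s')\<bar> \<le> real L" using L by linarith
      show "\<bar>fourier_freq n j\<bar> \<le> 2 * pi * real m / real n"
        using j by (auto simp: fourier_freq_def abs_mult intro!: divide_right_mono)
    qed auto
    then have "(of_int (s - s') * fourier_freq n j)\<^sup>2 \<le> (real L * (2 * pi * real m / real n))\<^sup>2"
      using power_mono[of "\<bar>of_int (s - s') * fourier_freq n j\<bar>" _ 2] by simp
    then show "2 - 2 * cos (of_int (s - s') * fourier_freq n j) \<le> (2 * pi * real m * real L / real n)\<^sup>2"
      using one_minus_cos_le[of "of_int (s - s') * fourier_freq n j"] by (simp add: mult_ac)
  qed auto
  finally show ?thesis by (simp add: sum_distrib_right mult.assoc)
qed

lemma trig_kernel_square_le: "(trig_kernel n m p h)\<^sup>2 \<le> real m * (\<Sum>j=1..m. (p j)\<^sup>2)"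
proof -
  have "(trig_kernel n m p h)\<^sup>2 \<le> (\<Sum>j=1..m. (cos (of_int h * fourier_freq n j))\<^sup>2) * (\<Sum>j=1..m. (p j)\<^sup>2)"
    unfolding trig_kernel_def using Cauchy_Schwarz_ineq_sum[of p "\<lambda>j. cos (of_int h * fourier_freq n j)" "{1..m}"] by (simp add: mult.commute)
  also have "\<dots> \<le> (\<Sum>j=1..m. 1) * (\<Sum>j=1..m. (p j)\<^sup>2)"
    by (intro mult_right_mono sum_mono sum_nonneg) (auto simp: abs_square_le_1)
  finally show ?thesis by simp
qed

subsection \<open>Blocked quadratic forms\<close>

context block_partition
begin

text \<open>Any member of a block can stand for it in the kernel, since \<open>blocked\<close> is
  constant on blocks (\<open>blocked_cong\<close>).\<close>

definition rep :: "nat \<Rightarrow> int" where "rep k = (SOME s. s \<in> block k)"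

lemma rep_block: "k < N \<Longrightarrow> rep k \<in> block k"
proof -
  assume "k < N"
  then have "block k \<noteq> {}" using card_block' q by force
  then show "rep k \<in> block k" unfolding rep_def by (rule some_in_eq[THEN iffD2])
qed

lemma rep_J: "k < N \<Longrightarrow> rep k \<in> J" and blk_rep: "k < N \<Longrightarrow> blk (rep k) = k"
  using rep_block[of k] by (auto simp: block_def)

lemma blocked_cong: "s \<in> block k \<Longrightarrow> s' \<in> block k \<Longrightarrow> blocked s t = blocked s' t"
  by (simp add: blocked_def block_def)

lemma blocked_same: "s \<in> block k \<Longrightarrow> t \<in> block k \<Longrightarrow> blocked s t = 0"
  by (simp add: blocked_def block_def)

lemma blocked_outside: "s \<notin> J \<or> t \<notin> J \<Longrightarrow> blocked s t = 0"
  by (auto simp: blocked_def)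

lemma sum_blocked: "(\<Sum>s\<in>I. \<Sum>t\<in>I. blocked s t * F s t) = (\<Sum>s\<in>J. \<Sum>t\<in>J. blocked s t * F s t)"
proof -
  have "(\<Sum>s\<in>I. \<Sum>t\<in>I. blocked s t * F s t) = (\<Sum>s\<in>J. \<Sum>t\<in>I. blocked s t * F s t)"
    using finI JI by (intro sum.mono_neutral_right) (auto simp: blocked_outside)
  also have "\<dots> = (\<Sum>s\<in>J. \<Sum>t\<in>J. blocked s t * F s t)"
    using finI JI by (intro sum.cong refl sum.mono_neutral_right) (auto simp: blocked_outside)
  finally show ?thesis .
qed

lemma frobenius_blocked: "(frobenius I blocked)\<^sup>2 = (\<Sum>s\<in>J. \<Sum>t\<in>J. (blocked s t)\<^sup>2)"
  using sum_blocked[of blocked] unfolding frobenius_square by (simp only: power2_eq_square)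

lemma mat_prod_blocked: "mat_prod I blocked blocked s t = (\<Sum>r\<in>J. blocked r s * blocked r t)"
proof -
  have "mat_prod I blocked blocked s t = (\<Sum>r\<in>J. blocked s r * blocked r t)"
    unfolding mat_prod_def using finI JI by (intro sum.mono_neutral_right) (auto simp: blocked_outside)
  then show ?thesis by (simp only: blocked_sym[of s])
qed

lemma sum_block_const:
  assumes "\<And>s k. s \<in> block k \<Longrightarrow> k < N \<Longrightarrow> G s = G (rep k)"
  shows "(\<Sum>s\<in>J. G s) = real q * (\<Sum>k<N. G (rep k) :: real)"
proof -
  have "(\<Sum>s\<in>J. G s) = (\<Sum>k<N. \<Sum>s\<in>block k. G (rep k))"
    unfolding sum_J_blocks using assms by (intro sum.cong refl) auto
  then show ?thesis by (simp add: card_block' sum_distrib_left)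
qed

text \<open>The two strips in which one index runs through block k are equal by symmetry, whence the
  factor 2; the square in which both do vanishes because \<open>blocked\<close> is zero
  there.\<close>

lemma blocked_form_split:
  fixes y :: "int \<Rightarrow> real"
  assumes k: "k < N"
  shows "(\<Sum>s\<in>J. \<Sum>t\<in>J. blocked s t * (y s * y t)) =
    (\<Sum>s\<in>J - block k. \<Sum>t\<in>J - block k. blocked s t * (y s * y t)) + 2 * (\<Sum>s\<in>block k. y s) * (\<Sum>t\<in>J. blocked (rep k) t * y t)"
proof -
  let ?F = "\<lambda>s t. blocked s t * (y s * y t)"
  let ?R = "J - block k"
  have split: "(\<Sum>s\<in>J. G s) = (\<Sum>s\<in>?R. G s) + (\<Sum>s\<in>block k. G s)" for G :: "int \<Rightarrow> real"
    using sum.subset_diff[OF block_sub finJ] by simp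
  have F_sym: "?F s t = ?F t s" for s t by (simp add: blocked_sym[of s t] mult.commute)
  have BV: "(\<Sum>s\<in>block k. \<Sum>t\<in>J. ?F s t) = (\<Sum>s\<in>block k. y s) * (\<Sum>t\<in>J. blocked (rep k) t * y t)"
    unfolding sum_product
    by (intro sum.cong refl) (subst blocked_cong[OF _ rep_block[OF k]], assumption, simp)
  have "(\<Sum>s\<in>?R. \<Sum>t\<in>block k. ?F s t) = (\<Sum>t\<in>block k. \<Sum>s\<in>?R. ?F t s)"
    by (subst sum.swap) (intro sum.cong refl F_sym)
  also have "\<dots> = (\<Sum>t\<in>block k. \<Sum>s\<in>J. ?F t s)"
    unfolding split by (simp add: blocked_same)
  finally have "(\<Sum>s\<in>?R. \<Sum>t\<in>block k. ?F s t) = (\<Sum>s\<in>block k. y s) * (\<Sum>t\<in>J. blocked (rep k) t * y t)"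
    using BV by simp
  then have "(\<Sum>s\<in>?R. \<Sum>t\<in>J. ?F s t) = (\<Sum>s\<in>?R. \<Sum>t\<in>?R. ?F s t) + (\<Sum>s\<in>block k. y s) * (\<Sum>t\<in>J. blocked (rep k) t * y t)"
    unfolding split sum.distrib by simp
  then show ?thesis unfolding split[of "\<lambda>s. \<Sum>t\<in>J. ?F s t"] BV by simp
qed

lemma blocked_form_sum:
  fixes y :: "int \<Rightarrow> real"
  shows "(\<Sum>s\<in>J. \<Sum>t\<in>J. blocked s t * (y s * y t)) = (\<Sum>k<N. (\<Sum>s\<in>block k. y s) * (\<Sum>t\<in>J. blocked (rep k) t * y t))"
  unfolding sum_J_blocks[of "\<lambda>s. \<Sum>t\<in>J. blocked s t * (y s * y t)"]
proof (rule sum.cong[OF refl])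
  fix k assume "k \<in> {..<N}"
  then have k: "k < N" by simp
  show "(\<Sum>s\<in>block k. \<Sum>t\<in>J. blocked s t * (y s * y t)) = (\<Sum>s\<in>block k. y s) * (\<Sum>t\<in>J. blocked (rep k) t * y t)"
    unfolding sum_product
    by (intro sum.cong refl) (subst blocked_cong[OF _ rep_block[OF k]], assumption, simp)
qed

end

text \<open>\<open>Z k\<close> contains the innovations on which the values in block k depend; the
  independence of blocks is derived from the disjointness of these sets.\<close>

locale blocked_process = iid_sequence \<mu> + block_partition I J blk N q a
  for \<mu> :: "'s measure" and I J blk N q a +
  fixes Y :: "int \<Rightarrow> (int \<Rightarrow> 's) \<Rightarrow> real" and d \<Theta> \<sigma>2 and Z :: "nat \<Rightarrow> int set"
  assumes Y: "dependence_bound Y d \<Theta>"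
    and local: "\<And>s A x y. s \<in> J \<Longrightarrow> A \<inter> Z (blk s) = {} \<Longrightarrow> Y s (mix A x y) = Y s x"
    and disjoint: "\<And>k l. k \<noteq> l \<Longrightarrow> Z k \<inter> Z l = {}"
    and var: "\<And>k. k < N \<Longrightarrow> (\<integral>x. (\<Sum>s\<in>block k. Y s x)\<^sup>2 \<partial>Om) = \<sigma>2"
begin

definition B :: "nat \<Rightarrow> (int \<Rightarrow> 's) \<Rightarrow> real" where "B k x = (\<Sum>s\<in>block k. Y s x)"

text \<open>Half the derivative of Q with respect to the block sum \<open>B k\<close>, which enters
  through rows and through columns.\<close>

definition V :: "nat \<Rightarrow> (int \<Rightarrow> 's) \<Rightarrow> real" where "V k x = (\<Sum>t\<in>J. blocked (rep k) t * Y t x)"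

definition U :: "nat \<Rightarrow> (int \<Rightarrow> 's) \<Rightarrow> real" where
  "U k x = (\<Sum>s\<in>J - block k. \<Sum>t\<in>J - block k. blocked s t * (Y s x * Y t x))"

definition Q :: "(int \<Rightarrow> 's) \<Rightarrow> real" where
  "Q x = (\<Sum>s\<in>I. \<Sum>t\<in>I. blocked s t * (Y s x * Y t x))"

lemma Q_J: "Q x = (\<Sum>s\<in>J. \<Sum>t\<in>J. blocked s t * (Y s x * Y t x))"
  unfolding Q_def by (rule sum_blocked)

lemma Q_split: "k < N \<Longrightarrow> Q x = U k x + 2 * B k x * V k x"
  unfolding Q_J U_def B_def V_def by (rule blocked_form_split)

lemma Q_sum: "Q x = (\<Sum>k<N. B k x * V k x)"
  unfolding Q_J B_def V_def by (rule blocked_form_sum)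

lemma Y_Lp: "Lp_fun Om 4 (Y t)" using Y by (rule dependence_bound_Lp)

lemma B_Lp: "Lp_fun Om 4 (B k)" unfolding B_def[abs_def] by (intro Lp_fun_sum Y_Lp) simp

lemma V_Lp: "Lp_fun Om 4 (V k)" unfolding V_def[abs_def] by (intro Lp_fun_sum Lp_fun_cmult Y_Lp) simp

lemma U_measurable: "U k \<in> borel_measurable Om"
proof -
  have [measurable]: "Y t \<in> borel_measurable Om" for t using Y_Lp by (rule Lp_fun_measurable)
  show ?thesis unfolding U_def[abs_def] by measurable
qed

lemma B_mean: "(\<integral>x. B k x \<partial>Om) = 0"
  unfolding B_def using integrable_Lp[OF Y_Lp] dependence_bound_mean[OF Y]
  by (subst Bochner_Integration.integral_sum) auto

lemma B_local: "k < N \<Longrightarrow> A \<inter> Z k = {} \<Longrightarrow> B k (mix A x y) = B k x"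
  unfolding B_def by (intro sum.cong refl local) (auto simp: block_def)

lemma V_local:
  assumes "k < N" shows "V k (mix (Z k) x y) = V k x"
  unfolding V_def
proof (rule sum.cong[OF refl])
  fix t assume t: "t \<in> J"
  show "blocked (rep k) t * Y t (mix (Z k) x y) = blocked (rep k) t * Y t x"
  proof (cases "blk t = k")
    case True
    then show ?thesis using t assms by (simp add: blocked_def blk_rep)
  next
    case False
    then show ?thesis using local[OF t, of "Z k"] disjoint[of k "blk t"] by simp
  qed
qed

lemma U_local: "U k (mix (Z k) x y) = U k x"
proof -
  have "Y t (mix (Z k) x y) = Y t x" if "t \<in> J - block k" for t
    using that disjoint[of k "blk t"] by (intro local) (auto simp: block_def)
  then show ?thesis unfolding U_def by (intro sum.cong refl) simp
qed

text \<open>\<open>B k\<close> is a function of the innovations in \<open>Z k\<close>, while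
  \<open>V k\<close> and \<open>U k\<close> ignore exactly these.\<close>

lemma indep_block:
  fixes f :: "real \<Rightarrow> complex" and h :: "real \<times> real \<Rightarrow> complex"
  assumes k: "k < N"
    and "integrable Om (\<lambda>x. f (B k x))" "integrable Om (\<lambda>x. h (V k x, U k x))"
  shows "integrable Om (\<lambda>x. f (B k x) * h (V k x, U k x)) \<and>
      (\<integral>x. f (B k x) * h (V k x, U k x) \<partial>Om) = (\<integral>x. f (B k x) \<partial>Om) * (\<integral>x. h (V k x, U k x) \<partial>Om)"
  by (intro conjI integral_mult_indep[where A="Z k"] assms)
    (simp_all add: B_local[OF k] V_local[OF k] U_local)

lemma B_indep:
  assumes "k < N" "l < N" "k \<noteq> l"
  shows "(\<integral>x. B k x * B l x \<partial>Om) = 0"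
proof -
  have "(\<integral>x. B k x * B l x \<partial>Om) = (\<integral>x. B k x \<partial>Om) * (\<integral>x. B l x \<partial>Om)"
    by (intro integral_mult_indep(2)[where A="Z k"] integrable_Lp B_Lp)
      (use assms disjoint in \<open>auto intro!: B_local\<close>)
  then show ?thesis by (simp add: B_mean)
qed

lemma BV_mean:
  assumes k: "k < N"
  shows "(\<integral>x. B k x * V k x \<partial>Om) = 0"
proof -
  have "(\<integral>x. B k x * V k x \<partial>Om) = (\<integral>x. B k x \<partial>Om) * (\<integral>x. V k x \<partial>Om)"
    by (intro integral_mult_indep(2)[where A="Z k"] integrable_Lp B_Lp V_Lp)
      (simp_all add: B_local[OF k] V_local[OF k])
  then show ?thesis by (simp add: B_mean)
qed

lemma integrable_mult_L4: "Lp_fun Om 4 f \<Longrightarrow> Lp_fun Om 4 g \<Longrightarrow> integrable Om (\<lambda>x. f x * g x)"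
  by (intro integrable_mult_of_squares Om.Lp_fun_mono[of 4 _ 2]) auto

lemma Q_mean: "(\<integral>x. Q x \<partial>Om) = 0"
  unfolding Q_sum using BV_mean
  by (subst Bochner_Integration.integral_sum) (auto intro: integrable_mult_L4 B_Lp V_Lp)

lemma V_blocks: "V k x = (\<Sum>l<N. blocked (rep k) (rep l) * B l x)"
  unfolding V_def sum_J_blocks B_def sum_distrib_left
proof (intro sum.cong refl)
  fix l t assume "l \<in> {..<N}" "t \<in> block l"
  then have "blocked (rep k) t = blocked (rep k) (rep l)"
    using blocked_cong[of t l "rep l" "rep k"] rep_block[of l] by (simp add: blocked_sym[of "rep k"])
  then show "blocked (rep k) t * Y t x = blocked (rep k) (rep l) * Y t x" by simp
qed

text \<open>Block sums are uncorrelated with common second moment \<sigma>2, so only the diagonal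
  terms survive; the sum over J counts each block q times, whence the division by q.\<close>

lemma V_square_mean:
  assumes "k < N"
  shows "(\<integral>x. (V k x)\<^sup>2 \<partial>Om) = \<sigma>2 / real q * (\<Sum>t\<in>J. (blocked (rep k) t)\<^sup>2)"
proof -
  let ?A = "\<lambda>l. blocked (rep k) (rep l)"
  have "(\<integral>x. (V k x)\<^sup>2 \<partial>Om) = (\<integral>x. (\<Sum>l<N. \<Sum>l'<N. (?A l * ?A l') * (B l x * B l' x)) \<partial>Om)"
    unfolding V_blocks power2_eq_square sum_product by (simp only: mult_ac)
  also have "\<dots> = (\<Sum>l<N. \<Sum>l'<N. (?A l * ?A l') * (\<integral>x. B l x * B l' x \<partial>Om))"
    by (subst Bochner_Integration.integral_sum, intro Bochner_Integration.integrable_sum integrable_mult_right integrable_mult_L4 B_Lp,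
        subst Bochner_Integration.integral_sum, intro integrable_mult_right integrable_mult_L4 B_Lp, simp)
  also have "\<dots> = (\<Sum>l<N. \<Sum>l'<N. if l' = l then (?A l)\<^sup>2 * \<sigma>2 else 0)"
    using var by (intro sum.cong refl) (auto simp: B_indep B_def[symmetric] power2_eq_square)
  also have "\<dots> = \<sigma>2 * (\<Sum>l<N. (?A l)\<^sup>2)"
    by (simp add: sum_distrib_left mult.commute)
  also have "(\<Sum>l<N. (?A l)\<^sup>2) = (\<Sum>t\<in>J. (blocked (rep k) t)\<^sup>2) / real q"
  proof -
    have "(\<Sum>t\<in>J. (blocked (rep k) t)\<^sup>2) = real q * (\<Sum>l<N. (?A l)\<^sup>2)"
    proof (rule sum_block_const)
      fix t l assume "t \<in> block l" "l < N"
      then have "blocked (rep k) t = ?A l"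
        using blocked_cong[of t l "rep l" "rep k"] rep_block[of l] by (simp add: blocked_sym[of "rep k"])
      then show "(blocked (rep k) t)\<^sup>2 = (?A l)\<^sup>2" by simp
    qed
    then show ?thesis using q by simp
  qed
  finally show ?thesis by simp
qed

text \<open>The mean of \<sigma>2 times the sum of the squares of the V_k, and half the variance of
  Q: a Gaussian characteristic function exp(-s u^2) has variance 2 s.\<close>

definition limit_var :: real where "limit_var = (\<sigma>2 / real q)\<^sup>2 * (frobenius I blocked)\<^sup>2"

lemma sum_rep_blocked:
  assumes "\<And>s s'. blocked s = blocked s' \<Longrightarrow> G s = G s'"
  shows "(\<Sum>k<N. G (rep k)) = (\<Sum>s\<in>J. G s :: real) / real q"
proof -
  have "(\<Sum>s\<in>J. G s) = real q * (\<Sum>k<N. G (rep k))"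
    by (rule sum_block_const) (auto intro!: assms ext blocked_cong rep_block)
  then show ?thesis using q by simp
qed

text \<open>\<open>bilinear_form_L2_bound\<close> for the square of the blocked matrix times
  \<sigma>2 / q, where 1 / q comes from passing from one representative per block to all of J. The
  mean in the centring is evaluated by \<open>V_square_mean\<close>.\<close>

lemma V_squares_deviation:
  "Lp_norm Om 2 (\<lambda>x. \<sigma>2 * (\<Sum>k<N. (V k x)\<^sup>2) - limit_var) \<le> 3 * \<Theta>\<^sup>2 * (\<bar>\<sigma>2\<bar> / real q) * frobenius I (mat_prod I blocked blocked)"
proof -
  let ?T = "\<lambda>x. \<Sum>s\<in>J. \<Sum>t\<in>J. (\<sigma>2 / real q * mat_prod I blocked blocked s t) * (Y s x * Y t x)"
  have eq: "\<sigma>2 * (\<Sum>k<N. (V k x)\<^sup>2) = ?T x" for x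
  proof -
    have "(\<Sum>k<N. (V k x)\<^sup>2) = (\<Sum>r\<in>J. (\<Sum>t\<in>J. blocked r t * Y t x)\<^sup>2) / real q"
      unfolding V_def by (rule sum_rep_blocked) simp
    also have "(\<Sum>r\<in>J. (\<Sum>t\<in>J. blocked r t * Y t x)\<^sup>2) = (\<Sum>r\<in>J. \<Sum>s\<in>J. \<Sum>t\<in>J. (blocked r s * blocked r t) * (Y s x * Y t x))"
      unfolding power2_eq_square sum_product by (simp only: mult_ac)
    also have "\<dots> = (\<Sum>s\<in>J. \<Sum>t\<in>J. (\<Sum>r\<in>J. blocked r s * blocked r t) * (Y s x * Y t x))"
      unfolding sum_distrib_right by (subst sum.swap) (intro sum.cong refl sum.swap)
    finally have "\<sigma>2 * (\<Sum>k<N. (V k x)\<^sup>2) = \<sigma>2 / real q * (\<Sum>s\<in>J. \<Sum>t\<in>J. mat_prod I blocked blocked s t * (Y s x * Y t x))"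
      unfolding mat_prod_blocked by simp
    then show ?thesis by (simp only: sum_distrib_left mult.assoc)
  qed
  have mean: "(\<integral>x. ?T x \<partial>Om) = limit_var"
  proof -
    have "(\<integral>x. ?T x \<partial>Om) = (\<integral>x. \<sigma>2 * (\<Sum>k<N. (V k x)\<^sup>2) \<partial>Om)" by (simp only: eq)
    also have "\<dots> = \<sigma>2 * (\<Sum>k<N. \<integral>x. (V k x)\<^sup>2 \<partial>Om)"
      using integrable_mult_L4[OF V_Lp V_Lp] by (simp add: Bochner_Integration.integral_sum power2_eq_square)
    also have "(\<Sum>k<N. \<integral>x. (V k x)\<^sup>2 \<partial>Om) = (\<Sum>k<N. \<sigma>2 / real q * (\<Sum>t\<in>J. (blocked (rep k) t)\<^sup>2))"
      by (intro sum.cong refl V_square_mean) simp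
    also have "\<dots> = (\<Sum>s\<in>J. \<sigma>2 / real q * (\<Sum>t\<in>J. (blocked s t)\<^sup>2)) / real q"
      by (rule sum_rep_blocked) simp
    also have "\<dots> = \<sigma>2 / real q * (frobenius I blocked)\<^sup>2 / real q"
      unfolding frobenius_blocked sum_distrib_left ..
    finally show ?thesis by (simp add: limit_var_def power2_eq_square)
  qed
  have T: "Lp_norm Om 2 (\<lambda>x. ?T x - (\<integral>z. ?T z \<partial>Om)) \<le> 3 * \<Theta> * \<Theta> * sqrt (\<Sum>s\<in>J. \<Sum>t\<in>J. (\<sigma>2 / real q * mat_prod I blocked blocked s t)\<^sup>2)"
    by (rule bilinear_form_L2_bound[OF Y Y finJ])
  have F: "sqrt (\<Sum>s\<in>J. \<Sum>t\<in>J. (\<sigma>2 / real q * mat_prod I blocked blocked s t)\<^sup>2) \<le> \<bar>\<sigma>2\<bar> / real q * frobenius I (mat_prod I blocked blocked)"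
  proof -
    have "(\<Sum>s\<in>J. \<Sum>t\<in>J. (\<sigma>2 / real q * mat_prod I blocked blocked s t)\<^sup>2) = (\<sigma>2 / real q)\<^sup>2 * (\<Sum>s\<in>J. \<Sum>t\<in>J. (mat_prod I blocked blocked s t)\<^sup>2)"
      by (simp only: power_mult_distrib sum_distrib_left)
    also have "\<dots> \<le> (\<sigma>2 / real q)\<^sup>2 * (\<Sum>s\<in>I. \<Sum>t\<in>I. (mat_prod I blocked blocked s t)\<^sup>2)"
    proof (rule mult_left_mono)
      have "(\<Sum>s\<in>J. \<Sum>t\<in>J. (mat_prod I blocked blocked s t)\<^sup>2) \<le> (\<Sum>s\<in>J. \<Sum>t\<in>I. (mat_prod I blocked blocked s t)\<^sup>2)"
        using finI JI by (intro sum_mono sum_mono2) auto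
      also have "\<dots> \<le> (\<Sum>s\<in>I. \<Sum>t\<in>I. (mat_prod I blocked blocked s t)\<^sup>2)"
        using finI JI by (intro sum_mono2) (auto intro: sum_nonneg)
      finally show "(\<Sum>s\<in>J. \<Sum>t\<in>J. (mat_prod I blocked blocked s t)\<^sup>2) \<le> (\<Sum>s\<in>I. \<Sum>t\<in>I. (mat_prod I blocked blocked s t)\<^sup>2)" .
    qed simp
    finally have "sqrt (\<Sum>s\<in>J. \<Sum>t\<in>J. (\<sigma>2 / real q * mat_prod I blocked blocked s t)\<^sup>2) \<le> sqrt ((\<sigma>2 / real q)\<^sup>2 * (\<Sum>s\<in>I. \<Sum>t\<in>I. (mat_prod I blocked blocked s t)\<^sup>2))"
      by (rule real_sqrt_le_mono)
    then show ?thesis unfolding frobenius_def real_sqrt_mult real_sqrt_abs by simp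
  qed
  have "Lp_norm Om 2 (\<lambda>x. \<sigma>2 * (\<Sum>k<N. (V k x)\<^sup>2) - limit_var) \<le> 3 * \<Theta> * \<Theta> * sqrt (\<Sum>s\<in>J. \<Sum>t\<in>J. (\<sigma>2 / real q * mat_prod I blocked blocked s t)\<^sup>2)"
    using T unfolding mean unfolding eq .
  also have "\<dots> \<le> 3 * \<Theta> * \<Theta> * (\<bar>\<sigma>2\<bar> / real q * frobenius I (mat_prod I blocked blocked))"
    using F dependence_bound_nonneg[OF Y] by (intro mult_left_mono) auto
  finally show ?thesis by (simp add: power2_eq_square mult.assoc)
qed

lemma B_norm: "k < N \<Longrightarrow> Lp_norm Om 4 (B k) \<le> 3 / 2 * \<Theta> * sqrt (real q)"
  using linear_form_L4_bound[OF Y finite_block[of k], of "\<lambda>_. 1"] by (simp add: B_def[abs_def] card_block')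

lemma V_norm:
  assumes row: "\<And>s. s \<in> I \<Longrightarrow> (\<Sum>t\<in>I. (a s t)\<^sup>2) \<le> \<alpha>" and k: "k < N"
  shows "Lp_norm Om 4 (V k) \<le> 3 / 2 * \<Theta> * sqrt \<alpha>"
proof -
  have "Lp_norm Om 4 (V k) \<le> 3 / 2 * \<Theta> * sqrt (\<Sum>t\<in>J. (blocked (rep k) t)\<^sup>2)"
    unfolding V_def[abs_def] by (rule linear_form_L4_bound[OF Y finJ])
  also have "\<dots> \<le> 3 / 2 * \<Theta> * sqrt \<alpha>"
    using blocked_row_bound[OF row rep_J[OF k]] dependence_bound_nonneg[OF Y]
    by (intro mult_left_mono real_sqrt_le_mono) auto
  finally show ?thesis .
qed

lemma near_gaussian_blocked:
  assumes row: "\<And>s. s \<in> I \<Longrightarrow> (\<Sum>t\<in>I. (a s t)\<^sup>2) \<le> \<alpha>"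
  shows "cmod ((\<integral>x. iexp (u * Q x) \<partial>Om) - exp (- (limit_var * u\<^sup>2))) \<le>
     \<bar>u\<bar> * (2 * \<bar>u\<bar> * (3 * \<Theta>\<^sup>2 * (\<bar>\<sigma>2\<bar> / real q) * frobenius I (mat_prod I blocked blocked)) +
       6 * u\<^sup>2 * (real N * ((3 / 2 * \<Theta> * sqrt (real q)) ^ 3 * (3 / 2 * \<Theta> * sqrt \<alpha>) ^ 3)))"
proof (rule Om.near_gaussian_quadratic_form[OF B_Lp V_Lp U_measurable B_mean _ _ Q_split Q_sum])
  show "(\<integral>x. (B k x)\<^sup>2 \<partial>Om) = \<sigma>2" if "k < N" for k using var[OF that] by (simp add: B_def)
  show "0 \<le> limit_var" by (simp add: limit_var_def)
  show "Lp_norm Om 2 (\<lambda>x. \<sigma>2 * (\<Sum>k<N. (V k x)\<^sup>2) - limit_var) \<le> 3 * \<Theta>\<^sup>2 * (\<bar>\<sigma>2\<bar> / real q) * frobenius I (mat_prod I blocked blocked)"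
    by (rule V_squares_deviation)
  have "(\<Sum>k<N. Lp_norm Om 4 (B k) ^ 3 * Lp_norm Om 4 (V k) ^ 3) \<le> (\<Sum>k<N. (3 / 2 * \<Theta> * sqrt (real q)) ^ 3 * (3 / 2 * \<Theta> * sqrt \<alpha>) ^ 3)"
    using B_norm V_norm[OF row] dependence_bound_nonneg[OF Y]
    by (intro sum_mono mult_mono power_mono) auto
  then show "(\<Sum>k<N. Lp_norm Om 4 (B k) ^ 3 * Lp_norm Om 4 (V k) ^ 3) \<le> real N * ((3 / 2 * \<Theta> * sqrt (real q)) ^ 3 * (3 / 2 * \<Theta> * sqrt \<alpha>) ^ 3)"
    by simp
qed (rule indep_block)

end

subsection \<open>Blocks of consecutive times separated by gaps\<close>

text \<open>Periods of length L that begin at time 1, hence s - 1. The first l times of a period are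
  its gap, so a value in the block that remembers l past innovations uses innovations of its own
  period only. The incomplete last period is left out.\<close>

definition big_blocks :: "nat \<Rightarrow> nat \<Rightarrow> nat \<Rightarrow> int set" where
  "big_blocks n L l = {s \<in> {1..int n}. (s - 1) div int L < int (n div L) \<and> int l \<le> (s - 1) mod int L}"

definition block_index :: "nat \<Rightarrow> int \<Rightarrow> nat" where
  "block_index L s = nat ((s - 1) div int L)"

lemma big_block_eq:
  assumes "l < L" "k < n div L"
  shows "{s \<in> big_blocks n L l. block_index L s = k} = {int (k * L) + int l + 1..int (k * L) + int L}"
proof (intro set_eqI iffI)
  fix s assume "s \<in> {s \<in> big_blocks n L l. block_index L s = k}"
  then have s: "1 \<le> s" "int l \<le> (s - 1) mod int L" "nat ((s - 1) div int L) = k"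
    by (auto simp: big_blocks_def block_index_def)
  have "0 \<le> (s - 1) div int L" using s(1) assms by (intro pos_imp_zdiv_nonneg_iff[THEN iffD2]) auto
  then have "(s - 1) div int L = int k" using s(3) by simp
  moreover have "s - 1 = int L * ((s - 1) div int L) + (s - 1) mod int L" by simp
  moreover have "(s - 1) mod int L < int L" using assms by simp
  ultimately show "s \<in> {int (k * L) + int l + 1..int (k * L) + int L}"
    using s(2) by (simp add: mult.commute)
next
  fix s assume s: "s \<in> {int (k * L) + int l + 1..int (k * L) + int L}"
  define r where "r = s - 1 - int (k * L)"
  have r: "int l \<le> r" "r < int L" "s - 1 = int L * int k + r" using s by (auto simp: r_def)
  have d: "(s - 1) div int L = int k" and m: "(s - 1) mod int L = r"
    using r by (auto simp: div_pos_geq intro!: int_div_pos_eq int_mod_pos_eq)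
  have "0 \<le> int (k * L)" by simp
  then have s1: "1 \<le> s" using s unfolding atLeastAtMost_iff by linarith
  have "(k + 1) * L \<le> n div L * L" using assms(2) by (intro mult_right_mono) auto
  also have "\<dots> \<le> n" by simp
  finally have "int (k * L) + int L \<le> int n" by (simp add: algebra_simps flip: of_nat_add of_nat_mult)
  then show "s \<in> {s \<in> big_blocks n L l. block_index L s = k}"
    using s r d m assms s1 by (auto simp: big_blocks_def block_index_def)
qed

lemma block_partition_big_blocks:
  assumes "l < L" "\<And>s t. a s t = a t s"
  shows "block_partition {1..int n} (big_blocks n L l) (block_index L) (n div L) (L - l) a"
proof
  show "block_index L s < n div L" if "s \<in> big_blocks n L l" for s
    using that assms(1) by (auto simp: big_blocks_def block_index_def nat_less_iff pos_imp_zdiv_nonneg_iff)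
  show "card {s \<in> big_blocks n L l. block_index L s = k} = L - l" if "k < n div L" for k
    unfolding big_block_eq[OF assms(1) that] using assms(1) by simp
qed (use assms in \<open>auto simp: big_blocks_def\<close>)

text \<open>There are more than n / L - 1 full periods; each of them loses l times, and the
  incomplete one has fewer than L.\<close>

lemma card_gaps:
  assumes "l < L" "n > 0"
  shows "real (card ({1..int n} - big_blocks n L l)) \<le> real n * real l / real L + real L"
proof -
  interpret block_partition "{1..int n}" "big_blocks n L l" "block_index L" "n div L" "L - l" "\<lambda>_ _. 0"
    using assms(1) by (rule block_partition_big_blocks) simp
  have "card ({1..int n} - big_blocks n L l) = n - n div L * (L - l)"
    using card_Diff_subset[OF finJ JI] card_J by simp
  moreover have "n div L * (L - l) \<le> n"
    using card_mono[OF finI JI] card_J by simp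
  ultimately have c: "real (card ({1..int n} - big_blocks n L l)) = real n - real (n div L) * (real L - real l)"
    using assms(1) by (simp add: of_nat_diff)
  have "n < (n div L + 1) * L"
    using assms dividend_less_div_times[of L n] by (simp add: algebra_simps)
  then have "real n < (real (n div L) + 1) * real L"
    by (metis of_nat_less_iff of_nat_mult of_nat_add of_nat_1)
  then have "real n / real L - 1 \<le> real (n div L)" using assms by (simp add: field_simps)
  then have "(real n / real L - 1) * (real L - real l) \<le> real (n div L) * (real L - real l)"
    using assms by (intro mult_right_mono) auto
  moreover have "(real n / real L - 1) * (real L - real l) = real n - real n * real l / real L - real L + real l"
    using assms by (simp add: field_simps)
  ultimately show ?thesis using c of_nat_0_le_iff[of l, where 'a=real] by linarith
qed

context causal_process
begin

section \<open>Variance of the block sums\<close>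

lemma shift_seq_shift_seq: "shift_seq t (shift_seq h x) = shift_seq (t + h) x"
  by (simp add: shift_seq_def fun_eq_iff add.assoc)

lemma trunc_shift: "x \<in> space Om \<Longrightarrow> trunc l (t + h) x = trunc l t (shift_seq h x)"
  using trunc_stationary[of x l "t + h"] trunc_stationary[of "shift_seq h x" l t] measurable_space[OF shift_measurable, of x h]
  by (simp add: shift_seq_shift_seq)

definition partial_sum_var :: "nat \<Rightarrow> nat \<Rightarrow> real" where
  "partial_sum_var l q = (\<integral>x. (\<Sum>s\<in>{1..int q}. trunc l s x)\<^sup>2 \<partial>Om)"

lemma block_sum_var: "(\<integral>x. (\<Sum>s\<in>{h + 1..h + int q}. trunc l s x)\<^sup>2 \<partial>Om) = partial_sum_var l q"
proof -
  have "(\<Sum>s\<in>{h + 1..h + int q}. trunc l s x) = (\<Sum>s\<in>{1..int q}. trunc l s (shift_seq h x))" if "x \<in> space Om" for x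
  proof -
    have "(\<Sum>s\<in>{h + 1..h + int q}. trunc l s x) = (\<Sum>s\<in>{1..int q}. trunc l (s + h) x)"
      by (rule sum.reindex_bij_witness[of _ "\<lambda>s. s + h" "\<lambda>s. s - h"]) auto
    then show ?thesis using trunc_shift[OF that] by simp
  qed
  then have "(\<integral>x. (\<Sum>s\<in>{h + 1..h + int q}. trunc l s x)\<^sup>2 \<partial>Om) = (\<integral>x. (\<Sum>s\<in>{1..int q}. trunc l s (shift_seq h x))\<^sup>2 \<partial>Om)"
    by (intro Bochner_Integration.integral_cong) auto
  also have "\<dots> = partial_sum_var l q"
    unfolding partial_sum_var_def by (rule integral_shift[of "\<lambda>x. (\<Sum>s\<in>{1..int q}. trunc l s x)\<^sup>2"]) measurable
  finally show ?thesis .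
qed

lemma partial_sum_var_bounds: "0 \<le> partial_sum_var l q" "partial_sum_var l q \<le> 9 / 4 * Theta\<^sup>2 * real q"
proof -
  let ?S = "\<lambda>x. \<Sum>s\<in>{1..int q}. trunc l s x"
  have L: "Lp_fun Om 4 ?S" by (intro Lp_fun_sum trunc_Lp) simp
  show "0 \<le> partial_sum_var l q" by (simp add: partial_sum_var_def)
  have "partial_sum_var l q = (Lp_norm Om 2 ?S)\<^sup>2" by (simp add: partial_sum_var_def Lp_norm_2_square)
  also have "\<dots> \<le> (Lp_norm Om 4 ?S)\<^sup>2" by (intro power_mono Om.Lp_norm_2_le_4 L) simp
  also have "\<dots> \<le> (3 / 2 * Theta * sqrt (real q))\<^sup>2"
    using linear_form_L4_bound[OF dependence_bound_trunc, of "{1..int q}" "\<lambda>_. 1" l] by (intro power_mono) auto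
  also have "\<dots> = 9 / 4 * Theta\<^sup>2 * real q" by (simp add: power_mult_distrib power_divide power2_eq_square[of 3])
  finally show "partial_sum_var l q \<le> 9 / 4 * Theta\<^sup>2 * real q" .
qed

section \<open>Approximation of the quadratic form by a blocked one\<close>

definition quad_form :: "nat \<Rightarrow> (int \<Rightarrow> int \<Rightarrow> real) \<Rightarrow> (int \<Rightarrow> 's) \<Rightarrow> real" where
  "quad_form n a x = (\<Sum>s\<in>{1..int n}. \<Sum>t\<in>{1..int n}. a s t * (X s x * X t x))"

lemma quad_form_Lp: "Lp_fun Om 2 (quad_form n a)"
  unfolding quad_form_def[abs_def] by (intro bilinear_form_Lp X_Lp)

lemma Theta_nonneg: "0 \<le> Theta"
  using dependence_bound_nonneg[OF dependence_bound_X] .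

text \<open>With Y for the truncation, a X X - c Y Y = a (X - Y) X + a Y (X - Y) + (a - c) Y Y, and
  \<open>bilinear_form_L2_bound\<close> treats the three parts; the first two together give the
  factor 6.\<close>

lemma quad_form_approx:
  fixes a c :: "int \<Rightarrow> int \<Rightarrow> real" and n l :: nat
  defines "I \<equiv> {1..int n}"
  defines "T' \<equiv> \<lambda>x. \<Sum>s\<in>I. \<Sum>t\<in>I. c s t * (trunc l s x * trunc l t x)"
  assumes mean: "(\<integral>x. T' x \<partial>Om) = 0"
  shows "Lp_norm Om 2 (\<lambda>x. (quad_form n a x - (\<integral>z. quad_form n a z \<partial>Om)) - T' x) \<le>
    6 * Theta * Theta_error l * frobenius I a + 3 * Theta\<^sup>2 * frobenius I (\<lambda>s t. a s t - c s t)"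
proof -
  let ?D = "\<lambda>t x. X t x - trunc l t x"
  define T1 where "T1 = (\<lambda>x. \<Sum>s\<in>I. \<Sum>t\<in>I. a s t * (?D s x * X t x))"
  define T2 where "T2 = (\<lambda>x. \<Sum>s\<in>I. \<Sum>t\<in>I. a s t * (trunc l s x * ?D t x))"
  define T3 where "T3 = (\<lambda>x. \<Sum>s\<in>I. \<Sum>t\<in>I. (a s t - c s t) * (trunc l s x * trunc l t x))"
  have DL: "Lp_fun Om 4 (?D t)" for t by (intro Lp_fun_diff X_Lp trunc_Lp)
  have L1: "Lp_fun Om 2 T1" and L2: "Lp_fun Om 2 T2" and L3: "Lp_fun Om 2 T3"
    unfolding T1_def T2_def T3_def by (intro bilinear_form_Lp X_Lp trunc_Lp DL)+
  have L': "Lp_fun Om 2 T'" unfolding T'_def by (intro bilinear_form_Lp trunc_Lp)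
  have int: "integrable Om f" if "Lp_fun Om 2 f" for f
    using that by (intro Om.square_integrable_imp_integrable[of f, OF Lp_fun_measurable[OF that]]) (simp add: Lp_fun_2_iff)
  have sum: "quad_form n a x = T1 x + T2 x + T3 x + T' x" for x
    unfolding quad_form_def T1_def T2_def T3_def T'_def I_def sum.distrib[symmetric]
    by (intro sum.cong refl) (simp add: algebra_simps)
  let ?c = "\<lambda>f x. f x - (\<integral>z. f z \<partial>Om)"
  have "(\<integral>z. quad_form n a z \<partial>Om) = (\<integral>z. T1 z \<partial>Om) + (\<integral>z. T2 z \<partial>Om) + (\<integral>z. T3 z \<partial>Om)"
    unfolding sum using int[OF L1] int[OF L2] int[OF L3] int[OF L'] mean by simp
  then have eq: "(\<lambda>x. (quad_form n a x - (\<integral>z. quad_form n a z \<partial>Om)) - T' x) = (\<lambda>x. (?c T1 x + ?c T2 x) + ?c T3 x)"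
    by (intro ext) (simp add: sum)
  have C1: "Lp_fun Om 2 (?c T1)" and C2: "Lp_fun Om 2 (?c T2)" and C3: "Lp_fun Om 2 (?c T3)"
    by (intro Lp_fun_diff L1 L2 L3 Om.Lp_fun_const, simp)+
  have "Lp_norm Om 2 (\<lambda>x. (?c T1 x + ?c T2 x) + ?c T3 x) \<le> Lp_norm Om 2 (\<lambda>x. ?c T1 x + ?c T2 x) + Lp_norm Om 2 (?c T3)"
    by (rule Minkowski[OF _ Lp_fun_add[OF C1 C2] C3]) simp
  moreover have "Lp_norm Om 2 (\<lambda>x. ?c T1 x + ?c T2 x) \<le> Lp_norm Om 2 (?c T1) + Lp_norm Om 2 (?c T2)"
    by (rule Minkowski[OF _ C1 C2]) simp
  moreover have "Lp_norm Om 2 (?c T1) \<le> 3 * Theta_error l * Theta * frobenius I a"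
    unfolding T1_def frobenius_def
    by (rule bilinear_form_L2_bound[OF dependence_bound_diff_trunc dependence_bound_X]) (simp add: I_def)
  moreover have "Lp_norm Om 2 (?c T2) \<le> 3 * Theta * Theta_error l * frobenius I a"
    unfolding T2_def frobenius_def
    by (rule bilinear_form_L2_bound[OF dependence_bound_trunc dependence_bound_diff_trunc]) (simp add: I_def)
  moreover have "Lp_norm Om 2 (?c T3) \<le> 3 * Theta * Theta * frobenius I (\<lambda>s t. a s t - c s t)"
    unfolding T3_def frobenius_def
    by (rule bilinear_form_L2_bound[OF dependence_bound_trunc dependence_bound_trunc]) (simp add: I_def)
  ultimately show ?thesis unfolding eq by (simp add: power2_eq_square algebra_simps)
qed

lemma char_diff_le:
  assumes f: "Lp_fun Om 2 f" and g: "Lp_fun Om 2 g"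
  shows "cmod ((\<integral>x. iexp (v * f x) \<partial>Om) - (\<integral>x. iexp (v * g x) \<partial>Om)) \<le> \<bar>v\<bar> * Lp_norm Om 2 (\<lambda>x. f x - g x)"
proof -
  have [measurable]: "f \<in> borel_measurable Om" "g \<in> borel_measurable Om" using f g by (auto simp: Lp_fun_def)
  have i: "integrable Om (\<lambda>x. iexp (v * f x))" "integrable Om (\<lambda>x. iexp (v * g x))"
    by (intro Om.integrable_iexp, measurable)+
  have fg: "Lp_fun Om 2 (\<lambda>x. f x - g x)" using f g by (rule Lp_fun_diff)
  have ifg: "integrable Om (\<lambda>x. f x - g x)"
    by (rule Om.square_integrable_imp_integrable[OF Lp_fun_measurable[OF fg]]) (use fg in \<open>simp add: Lp_fun_2_iff\<close>)
  have "(\<integral>x. iexp (v * f x) \<partial>Om) - (\<integral>x. iexp (v * g x) \<partial>Om) = (\<integral>x. iexp (v * f x) - iexp (v * g x) \<partial>Om)"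
    using Bochner_Integration.integral_diff[OF i] by simp
  then have "cmod ((\<integral>x. iexp (v * f x) \<partial>Om) - (\<integral>x. iexp (v * g x) \<partial>Om)) \<le> (\<integral>x. cmod (iexp (v * f x) - iexp (v * g x)) \<partial>Om)"
    using integral_norm_bound[of Om "\<lambda>x. iexp (v * f x) - iexp (v * g x)"] by (simp only:)
  also have "\<dots> \<le> (\<integral>x. \<bar>v\<bar> * \<bar>f x - g x\<bar> \<partial>Om)"
  proof (rule integral_mono)
    show "integrable Om (\<lambda>x. cmod (iexp (v * f x) - iexp (v * g x)))"
      using i by (intro integrable_norm Bochner_Integration.integrable_diff)
    show "integrable Om (\<lambda>x. \<bar>v\<bar> * \<bar>f x - g x\<bar>)" using ifg by simp
    fix x
    have "iexp (v * f x) = iexp (v * g x) * iexp (v * (f x - g x))"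
      unfolding iexp_add[symmetric] by (simp add: algebra_simps)
    then have "iexp (v * f x) - iexp (v * g x) = iexp (v * g x) * (iexp (v * (f x - g x)) - 1)"
      by (simp add: right_diff_distrib)
    then have "cmod (iexp (v * f x) - iexp (v * g x)) = cmod (iexp (v * (f x - g x)) - 1)"
      by (simp only: norm_mult norm_exp_i_times mult_1_left)
    also have "\<dots> \<le> \<bar>v * (f x - g x)\<bar>" by (rule norm_iexp_minus_one_le)
    finally show "cmod (iexp (v * f x) - iexp (v * g x)) \<le> \<bar>v\<bar> * \<bar>f x - g x\<bar>" by (simp add: abs_mult)
  qed
  also have "\<dots> \<le> \<bar>v\<bar> * Lp_norm Om 2 (\<lambda>x. f x - g x)"
    using Om.expectation_abs_le[OF fg] by (simp add: mult_left_mono)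
  finally show ?thesis .
qed

lemma exp_minus_diff_le: "\<bar>exp (- x) - exp (- y)\<bar> \<le> \<bar>x - y\<bar>" if "0 \<le> x" "0 \<le> y" for x y :: real
proof -
  have "exp (- x) - exp (- y) \<le> y - x" if "0 \<le> x" "x \<le> y" for x y :: real
  proof -
    have "exp (- x) - exp (- y) = exp (- x) * (1 - exp (- (y - x)))"
      by (simp add: right_diff_distrib flip: exp_add)
    also have "\<dots> \<le> 1 * (y - x)"
    proof (rule mult_mono)
      show "1 - exp (- (y - x)) \<le> y - x" using exp_ge_add_one_self[of "- (y - x)"] by linarith
    qed (use that in auto)
    finally show ?thesis by simp
  qed
  from this[of x y] this[of y x] show ?thesis using that by (cases "x \<le> y") auto
qed

text \<open>The three summands come from truncation and block averaging, from Stein's method, and from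
  the difference of the limiting variances.\<close>

lemma quad_form_char_bound:
  fixes a :: "int \<Rightarrow> int \<Rightarrow> real" and n l L :: nat
  defines "I \<equiv> {1..int n}"
  defines "T \<equiv> \<lambda>x. quad_form n a x - (\<integral>z. quad_form n a z \<partial>Om)"
  assumes l: "l < L" and sym: "\<And>s t. a s t = a t s"
    and row: "\<And>s. s \<in> I \<Longrightarrow> (\<Sum>t\<in>I. (a s t)\<^sup>2) \<le> \<alpha>"
    and smooth: "\<And>s s'. s \<in> I \<Longrightarrow> \<bar>s - s'\<bar> \<le> int L \<Longrightarrow> (\<Sum>t\<in>I. (a s t - a s' t)\<^sup>2) \<le> \<eta>"
    and diag: "\<And>s t. (a s t)\<^sup>2 \<le> \<zeta>"
    and n: "n > 0" and nonneg: "0 \<le> \<alpha>" "0 \<le> \<zeta>" "0 \<le> \<eta>" and s: "0 \<le> s"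
    and e: "2 * (real n * real l / real L + real L) * \<alpha> + real n * real L * \<zeta> + 4 * real n * \<eta> \<le> e\<^sup>2" "0 \<le> e"
    and w: "frobenius I a \<le> w"
  defines "lrv \<equiv> partial_sum_var l (L - l) / real (L - l)"
  shows "cmod ((\<integral>x. iexp (v * T x) \<partial>Om) - exp (- (s * v\<^sup>2))) \<le>
     \<bar>v\<bar> * (6 * Theta * Theta_error l * w + 3 * Theta\<^sup>2 * e) +
     \<bar>v\<bar> * (2 * \<bar>v\<bar> * (3 * Theta\<^sup>2 * (9 / 4 * Theta\<^sup>2) * (frobenius I (mat_prod I a a) + e * (2 * w + e))) +
       6 * v\<^sup>2 * (real n * ((3 / 2 * Theta * sqrt (real L)) ^ 3 * (3 / 2 * Theta * sqrt \<alpha>) ^ 3))) +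
     v\<^sup>2 * ((9 / 4 * Theta\<^sup>2)\<^sup>2 * (e * (2 * w + e)) + \<bar>lrv\<^sup>2 * (frobenius I a)\<^sup>2 - s\<bar>)"
proof -
  let ?J = "big_blocks n L l" and ?N = "n div L" and ?q = "L - l"
  \<comment> \<open>The whole period k, gap included: it contains the l innovations that precede
    each time of the block.\<close>
  let ?Z = "\<lambda>k. {int (k * L) + 1..int (k * L) + int L}"
  interpret bp: block_partition I ?J "block_index L" ?N ?q a
    unfolding I_def using l sym by (rule block_partition_big_blocks)
  have block: "bp.block k = {int (k * L) + int l + 1..int (k * L) + int L}" if "k < ?N" for k
    using big_block_eq[OF l that] by (simp add: bp.block_def)
  interpret Y: blocked_process \<mu> I ?J "block_index L" ?N ?q a "trunc l" "\<lambda>j. if j < 0 then 0 else dep (nat j)" Theta "partial_sum_var l ?q" ?Z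
  proof
    show "dependence_bound (trunc l) (\<lambda>j. if j < 0 then 0 else dep (nat j)) Theta" by (rule dependence_bound_trunc)
    show "trunc l s (mix A x y) = trunc l s x" if "s \<in> ?J" "A \<inter> ?Z (block_index L s) = {}" for s A x y
    proof (rule trunc_local)
      have "s \<in> bp.block (block_index L s)" using that by (simp add: bp.block_def)
      then have "{s - int l..s} \<subseteq> ?Z (block_index L s)" using block[OF bp.blk[OF that(1)]] by auto
      then show "A \<inter> {s - int l..s} = {}" using that by blast
    qed
    show "?Z k \<inter> ?Z k' = {}" if "k \<noteq> k'" for k k'
    proof -
      have "(k + 1) * L \<le> k' * L \<or> (k' + 1) * L \<le> k * L"
        using that by (metis Suc_eq_plus1 Suc_leI mult_le_mono1 nat_neq_iff)
      then have "int (k * L) + int L \<le> int (k' * L) \<or> int (k' * L) + int L \<le> int (k * L)"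
        unfolding of_nat_add[symmetric] of_nat_le_iff by (simp add: add.commute)
      then show ?thesis by auto
    qed
    show "(\<integral>x. (\<Sum>s\<in>bp.block k. trunc l s x)\<^sup>2 \<partial>Om) = partial_sum_var l ?q" if "k < ?N" for k
      using block_sum_var[where h="int (k * L) + int l" and q="?q" and l=l] l by (simp add: block[OF that] of_nat_diff)
  qed
  let ?c = "bp.blocked" and ?d = "frobenius I (\<lambda>s t. a s t - bp.blocked s t)"
  have q: "real ?q > 0" using l by simp
  have Nq: "real (?N * ?q) \<le> real n"
  proof -
    have "?N * ?q \<le> n" using card_mono[OF bp.finI bp.JI] bp.card_J by (simp add: I_def)
    then show ?thesis by (simp only: of_nat_le_iff)
  qed
  have lrv: "0 \<le> lrv" "lrv \<le> 9 / 4 * Theta\<^sup>2"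
    using partial_sum_var_bounds[of l ?q] q unfolding lrv_def by (auto simp: divide_le_eq)
  have w0: "0 \<le> w" using w frobenius_nonneg order_trans by blast
  have de: "?d \<le> e"
  proof -
    have "?d\<^sup>2 \<le> 2 * real (card (I - ?J)) * \<alpha> + real (?N * ?q\<^sup>2) * \<zeta> + 4 * real (?N * ?q) * \<eta>"
    proof (rule bp.frobenius_blocked_close[OF row _ diag])
      fix s s' assume s: "s \<in> ?J" "s' \<in> ?J" "block_index L s = block_index L s'"
      then have "s \<in> bp.block (block_index L s)" "s' \<in> bp.block (block_index L s)" by (auto simp: bp.block_def)
      then have "\<bar>s - s'\<bar> \<le> int L" using block[OF bp.blk[OF s(1)]] by auto
      then show "(\<Sum>t\<in>I. (a s t - a s' t)\<^sup>2) \<le> \<eta>" using s bp.JI by (intro smooth) auto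
    qed
    also have "\<dots> \<le> 2 * (real n * real l / real L + real L) * \<alpha> + real n * real L * \<zeta> + 4 * real n * \<eta>"
    proof (intro add_mono mult_right_mono mult_left_mono)
      show "real (card (I - ?J)) \<le> real n * real l / real L + real L" unfolding I_def by (rule card_gaps[OF l n])
      have "real (?N * ?q\<^sup>2) = real (?N * ?q) * real ?q" by (simp add: power2_eq_square)
      also have "\<dots> \<le> real n * real L" using Nq by (intro mult_mono) auto
      finally show "real (?N * ?q\<^sup>2) \<le> real n * real L" .
    qed (use Nq nonneg in auto)
    also have "\<dots> \<le> e\<^sup>2" by (rule e)
    finally show ?thesis using e(2) by (rule power2_le_imp_le)
  qed
  have ca: "\<bar>frobenius I a - frobenius I ?c\<bar> \<le> e"
    using frobenius_diff_bound[of I a ?c] de by linarith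
  have cw: "frobenius I a + frobenius I ?c \<le> 2 * w + e" using ca w by linarith
  have cc: "frobenius I (mat_prod I ?c ?c) \<le> frobenius I (mat_prod I a a) + e * (2 * w + e)"
  proof -
    have "frobenius I (mat_prod I ?c ?c) \<le> frobenius I (mat_prod I a a) + ?d * (frobenius I a + frobenius I ?c)"
      by (rule frobenius_square_perturb)
    also have "?d * (frobenius I a + frobenius I ?c) \<le> e * (2 * w + e)"
      using de cw e(2) by (intro mult_mono) (auto intro: add_nonneg_nonneg)
    finally show ?thesis by simp
  qed
  have QL: "Lp_fun Om 2 Y.Q" unfolding Y.Q_def[abs_def] by (intro bilinear_form_Lp trunc_Lp)
  have TL: "Lp_fun Om 2 T" unfolding T_def by (intro Lp_fun_diff quad_form_Lp Om.Lp_fun_const) simp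
  have step1: "cmod ((\<integral>x. iexp (v * T x) \<partial>Om) - (\<integral>x. iexp (v * Y.Q x) \<partial>Om)) \<le> \<bar>v\<bar> * (6 * Theta * Theta_error l * w + 3 * Theta\<^sup>2 * e)"
  proof -
    have "Lp_norm Om 2 (\<lambda>x. T x - Y.Q x) \<le> 6 * Theta * Theta_error l * frobenius I a + 3 * Theta\<^sup>2 * ?d"
      unfolding T_def Y.Q_def unfolding I_def
      by (rule quad_form_approx) (use Y.Q_mean in \<open>unfold Y.Q_def, unfold I_def\<close>)
    also have "\<dots> \<le> 6 * Theta * Theta_error l * w + 3 * Theta\<^sup>2 * e"
      using w de Theta_nonneg Theta_error_nonneg[of l] by (intro add_mono mult_left_mono) auto
    finally have "Lp_norm Om 2 (\<lambda>x. T x - Y.Q x) \<le> 6 * Theta * Theta_error l * w + 3 * Theta\<^sup>2 * e" .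
    then show ?thesis
      using char_diff_le[OF TL QL, of v] mult_left_mono[of "Lp_norm Om 2 (\<lambda>x. T x - Y.Q x)" _ "\<bar>v\<bar>"] by fastforce
  qed
  have step2: "cmod ((\<integral>x. iexp (v * Y.Q x) \<partial>Om) - exp (- (Y.limit_var * v\<^sup>2))) \<le>
     \<bar>v\<bar> * (2 * \<bar>v\<bar> * (3 * Theta\<^sup>2 * (9 / 4 * Theta\<^sup>2) * (frobenius I (mat_prod I a a) + e * (2 * w + e))) +
       6 * v\<^sup>2 * (real n * ((3 / 2 * Theta * sqrt (real L)) ^ 3 * (3 / 2 * Theta * sqrt \<alpha>) ^ 3)))"
  proof -
    have 1: "3 * Theta\<^sup>2 * (\<bar>partial_sum_var l ?q\<bar> / real ?q) * frobenius I (mat_prod I ?c ?c) \<le>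
        3 * Theta\<^sup>2 * (9 / 4 * Theta\<^sup>2) * (frobenius I (mat_prod I a a) + e * (2 * w + e))"
      using lrv partial_sum_var_bounds(1)[of l ?q] cc by (intro mult_mono) (auto simp: lrv_def)
    have 2: "real ?N * ((3 / 2 * Theta * sqrt (real ?q)) ^ 3 * (3 / 2 * Theta * sqrt \<alpha>) ^ 3) \<le>
        real n * ((3 / 2 * Theta * sqrt (real L)) ^ 3 * (3 / 2 * Theta * sqrt \<alpha>) ^ 3)"
      using Theta_nonneg nonneg by (intro mult_mono power_mono mult_left_mono real_sqrt_le_mono) auto
    show ?thesis
      by (rule order_trans[OF Y.near_gaussian_blocked[OF row, of v]], assumption)
        (intro mult_left_mono add_mono 1 2, auto)
  qed
  \<comment> \<open>Both exponents are multiples of squared Frobenius norms, and the norms of a and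
    of its blocked version differ by at most e.\<close>
  have step3: "cmod (complex_of_real (exp (- (Y.limit_var * v\<^sup>2))) - complex_of_real (exp (- (s * v\<^sup>2)))) \<le>
     v\<^sup>2 * ((9 / 4 * Theta\<^sup>2)\<^sup>2 * (e * (2 * w + e)) + \<bar>lrv\<^sup>2 * (frobenius I a)\<^sup>2 - s\<bar>)"
  proof -
    have "cmod (complex_of_real (exp (- (Y.limit_var * v\<^sup>2))) - complex_of_real (exp (- (s * v\<^sup>2)))) = \<bar>exp (- (Y.limit_var * v\<^sup>2)) - exp (- (s * v\<^sup>2))\<bar>"
      unfolding of_real_diff[symmetric] norm_of_real ..
    also have "\<dots> \<le> \<bar>Y.limit_var * v\<^sup>2 - s * v\<^sup>2\<bar>"
      using s by (intro exp_minus_diff_le) (auto simp: Y.limit_var_def)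
    also have "\<dots> = v\<^sup>2 * \<bar>lrv\<^sup>2 * (frobenius I ?c)\<^sup>2 - s\<bar>"
      by (simp add: Y.limit_var_def lrv_def abs_mult flip: left_diff_distrib)
    also have "\<dots> \<le> v\<^sup>2 * ((9 / 4 * Theta\<^sup>2)\<^sup>2 * (e * (2 * w + e)) + \<bar>lrv\<^sup>2 * (frobenius I a)\<^sup>2 - s\<bar>)"
    proof (rule mult_left_mono)
      have "\<bar>(frobenius I ?c)\<^sup>2 - (frobenius I a)\<^sup>2\<bar> = \<bar>frobenius I a - frobenius I ?c\<bar> * (frobenius I a + frobenius I ?c)"
        by (simp add: power2_eq_square square_diff_square_factored abs_mult abs_minus_commute add.commute mult.commute)
      also have "\<dots> \<le> e * (2 * w + e)" using ca cw e(2) by (intro mult_mono) auto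
      finally have "lrv\<^sup>2 * \<bar>(frobenius I ?c)\<^sup>2 - (frobenius I a)\<^sup>2\<bar> \<le> (9 / 4 * Theta\<^sup>2)\<^sup>2 * (e * (2 * w + e))"
        using lrv by (intro mult_mono power_mono) auto
      moreover have "lrv\<^sup>2 * (frobenius I ?c)\<^sup>2 - s = lrv\<^sup>2 * ((frobenius I ?c)\<^sup>2 - (frobenius I a)\<^sup>2) + (lrv\<^sup>2 * (frobenius I a)\<^sup>2 - s)"
        by (simp add: algebra_simps)
      moreover have "\<bar>lrv\<^sup>2 * ((frobenius I ?c)\<^sup>2 - (frobenius I a)\<^sup>2)\<bar> = lrv\<^sup>2 * \<bar>(frobenius I ?c)\<^sup>2 - (frobenius I a)\<^sup>2\<bar>"
        by (simp add: abs_mult)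
      ultimately show "\<bar>lrv\<^sup>2 * (frobenius I ?c)\<^sup>2 - s\<bar> \<le> (9 / 4 * Theta\<^sup>2)\<^sup>2 * (e * (2 * w + e)) + \<bar>lrv\<^sup>2 * (frobenius I a)\<^sup>2 - s\<bar>"
        using abs_triangle_ineq[of "lrv\<^sup>2 * ((frobenius I ?c)\<^sup>2 - (frobenius I a)\<^sup>2)" "lrv\<^sup>2 * (frobenius I a)\<^sup>2 - s"] by linarith
    qed simp
    finally show ?thesis .
  qed
  have tri: "cmod (x - z) \<le> cmod (x - y) + cmod (y - y') + cmod (y' - z)" for x y y' z :: complex
    using norm_triangle_ineq[of "x - y" "y - y'"] norm_triangle_ineq[of "x - y'" "y' - z"] by simp
  show ?thesis
    by (rule order_trans[OF tri[of _ _ "\<integral>x. iexp (v * Y.Q x) \<partial>Om" "complex_of_real (exp (- (Y.limit_var * v\<^sup>2)))"]])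
      (intro add_mono step1 step2 step3)
qed

end

subsection \<open>The long-run variance\<close>

lemma cesaro_mean_tendsto:
  fixes A :: "nat \<Rightarrow> real"
  assumes "A \<longlonglongrightarrow> c"
  shows "(\<lambda>n. (\<Sum>k<n. A k) / real n) \<longlonglongrightarrow> c"
proof (rule LIMSEQ_I)
  fix r :: real assume r: "r > 0"
  obtain N where N: "\<bar>A k - c\<bar> < r / 2" if "k \<ge> N" for k
    using LIMSEQ_D[OF assms, of "r / 2"] r by auto
  define C where "C = (\<Sum>k<N. \<bar>A k - c\<bar>)"
  have C: "C \<ge> 0" by (simp add: C_def sum_nonneg)
  have "norm ((\<Sum>k<n. A k) / real n - c) < r" if n: "n \<ge> max (Suc N) (nat \<lceil>2 * C / r\<rceil> + 1)" for n
  proof -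
    have n0: "n > 0" "n \<ge> N" using n by auto
    have "2 * C / r < real n" using n by linarith
    then have Cn: "C < r / 2 * real n" using r by (simp add: field_simps)
    have "(\<Sum>k<n. A k) / real n - c = (\<Sum>k<n. A k - c) / real n"
      using n0 by (simp add: sum_subtractf diff_divide_distrib)
    then have "norm ((\<Sum>k<n. A k) / real n - c) \<le> (\<Sum>k<n. \<bar>A k - c\<bar>) / real n"
      by (simp add: divide_right_mono)
    also have "(\<Sum>k<n. \<bar>A k - c\<bar>) = C + (\<Sum>k=N..<n. \<bar>A k - c\<bar>)"
      unfolding C_def using sum.atLeastLessThan_concat[of 0 N n "\<lambda>k. \<bar>A k - c\<bar>"] n0 by (simp add: atLeast0LessThan)
    also have "(\<Sum>k=N..<n. \<bar>A k - c\<bar>) \<le> (\<Sum>k=N..<n. r / 2)"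
      using N by (intro sum_mono less_imp_le) auto
    also have "(\<Sum>k=N..<n. r / 2) \<le> r / 2 * real n" using r n0 by simp
    also have "(C + r / 2 * real n) / real n < r" using Cn n0 by (simp add: field_simps)
    finally show ?thesis using n0 by (simp add: divide_right_mono)
  qed
  then show "\<exists>no. \<forall>n\<ge>no. norm ((\<Sum>k<n. A k) / real n - c) < r" by blast
qed

lemma sum_symmetric_interval_tendsto:
  fixes g :: "int \<Rightarrow> real"
  assumes "(g has_sum c) UNIV"
  shows "(\<lambda>n. \<Sum>h\<in>{- int n..int n}. g h) \<longlonglongrightarrow> c"
proof -
  have "filterlim (\<lambda>n. {- int n..int n}) (finite_subsets_at_top UNIV) sequentially"
    unfolding filterlim_finite_subsets_at_top
  proof (intro allI impI)
    fix X :: "int set" assume "finite X \<and> X \<subseteq> UNIV"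
    then have b: "\<bar>x\<bar> \<le> (\<Sum>x\<in>X. \<bar>x\<bar>)" if "x \<in> X" for x
      using that by (intro member_le_sum) auto
    show "\<forall>\<^sub>F n in sequentially. finite {- int n..int n} \<and> X \<subseteq> {- int n..int n} \<and> {- int n..int n} \<subseteq> UNIV"
      using b by (intro eventually_sequentiallyI[of "nat (\<Sum>x\<in>X. \<bar>x\<bar>)"]) force
  qed
  then show ?thesis using assms unfolding has_sum_def by (rule filterlim_compose[rotated])
qed

text \<open>Passing from q to q + 1 adds a row and a column, which together contain each lag from -q
  to q once. Divided by q, the double sum is therefore a Cesaro mean of symmetric partial
  sums.\<close>

lemma sum_toeplitz:
  fixes g :: "int \<Rightarrow> real"
  assumes even: "\<And>h. g (- h) = g h"
  shows "(\<Sum>s\<in>{1..int q}. \<Sum>t\<in>{1..int q}. g (s - t)) = (\<Sum>n<q. \<Sum>h\<in>{- int n..int n}. g h)"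
proof (induction q)
  case (Suc q)
  let ?z = "int q + 1"
  have I: "{1..int (Suc q)} = insert ?z {1..int q}" by auto
  have a: "(\<Sum>t\<in>{1..int q}. g (?z - t)) = (\<Sum>h\<in>{1..int q}. g h)"
    by (rule sum.reindex_bij_witness[of _ "\<lambda>h. ?z - h" "\<lambda>h. ?z - h"]) auto
  have b: "(\<Sum>s\<in>{1..int q}. g (s - ?z)) = (\<Sum>h\<in>{- int q..-1}. g h)"
    by (rule sum.reindex_bij_witness[of _ "\<lambda>h. h + ?z" "\<lambda>s. s - ?z"]) auto
  have "(\<Sum>h\<in>{- int q..int q}. g h) = (\<Sum>h\<in>{- int q..-1} \<union> ({0} \<union> {1..int q}). g h)"
    by (rule arg_cong[where f="sum g"]) auto
  also have "\<dots> = (\<Sum>h\<in>{- int q..-1}. g h) + (g 0 + (\<Sum>h\<in>{1..int q}. g h))"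
    by (subst sum.union_disjoint, simp, simp, force, subst sum.union_disjoint) auto
  finally show ?case
    unfolding I using Suc.IH a b by (simp add: sum.distrib)
qed simp

context causal_process
begin

section \<open>Autocovariances and the variance of partial sums\<close>

definition autocov :: "int \<Rightarrow> real" where "autocov h = (\<integral>x. X h x * X 0 x \<partial>Om)"

lemma X_shift: "X (t + h) x = X t (shift_seq h x)"
  unfolding stationary[of "t + h"] stationary[of t "shift_seq h x"] shift_seq_shift_seq ..

lemma integral_X_X: "(\<integral>x. X s x * X t x \<partial>Om) = autocov (s - t)"
proof -
  have "(\<integral>x. X s x * X t x \<partial>Om) = (\<integral>x. X (s - t) (shift_seq t x) * X 0 (shift_seq t x) \<partial>Om)"
    using X_shift[of "s - t" t] X_shift[of 0 t] by simp
  also have "\<dots> = autocov (s - t)"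
    unfolding autocov_def by (rule integral_shift[of "\<lambda>x. X (s - t) x * X 0 x"]) measurable
  finally show ?thesis .
qed

lemma autocov_even: "autocov (- h) = autocov h"
  using integral_X_X[of 0 h] by (simp add: autocov_def mult.commute)

lemma X_sum_var: "(Lp_norm Om 2 (\<lambda>x. \<Sum>s\<in>{1..int q}. X s x))\<^sup>2 = (\<Sum>n<q. \<Sum>h\<in>{- int n..int n}. autocov h)"
proof -
  have i: "integrable Om (\<lambda>x. X s x * X t x)" for s t
    by (intro integrable_mult_of_squares Om.Lp_fun_mono[OF X_Lp]) auto
  have "(Lp_norm Om 2 (\<lambda>x. \<Sum>s\<in>{1..int q}. X s x))\<^sup>2 = (\<integral>x. (\<Sum>s\<in>{1..int q}. \<Sum>t\<in>{1..int q}. X s x * X t x) \<partial>Om)"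
    unfolding Lp_norm_2_square by (simp only: power2_eq_square sum_product)
  also have "\<dots> = (\<Sum>s\<in>{1..int q}. \<Sum>t\<in>{1..int q}. autocov (s - t))"
    by (subst Bochner_Integration.integral_sum, intro Bochner_Integration.integrable_sum i,
        subst Bochner_Integration.integral_sum, rule i, simp only: integral_X_X)
  also have "\<dots> = (\<Sum>n<q. \<Sum>h\<in>{- int n..int n}. autocov h)" using autocov_even by (rule sum_toeplitz)
  finally show ?thesis .
qed

text \<open>Without truncation the variance of a sum of q terms, divided by q, is a Cesaro mean of
  partial sums of the autocovariances. Truncation moves the normalized L2 norm by at most 3/2
  \<open>Theta_error l\<close> for every q, so q may tend to infinity with l at any speed.\<close>

lemma long_run_variance_tendsto:
  assumes lrv: "(autocov has_sum lrv) UNIV" and q: "filterlim q at_top sequentially"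
  shows "(\<lambda>l. partial_sum_var l (q l) / real (q l)) \<longlonglongrightarrow> lrv"
proof -
  let ?x = "\<lambda>q. Lp_norm Om 2 (\<lambda>x. \<Sum>s\<in>{1..int q}. X s x) / sqrt (real q)"
  let ?y = "\<lambda>l. Lp_norm Om 2 (\<lambda>x. \<Sum>s\<in>{1..int (q l)}. trunc l s x) / sqrt (real (q l))"
  have "(\<lambda>q. (\<Sum>n<q. \<Sum>h\<in>{- int n..int n}. autocov h) / real q) \<longlonglongrightarrow> lrv"
    by (rule cesaro_mean_tendsto[OF sum_symmetric_interval_tendsto[OF lrv]])
  then have "(\<lambda>q. (?x q)\<^sup>2) \<longlonglongrightarrow> lrv"
    by (simp add: power_divide X_sum_var)
  then have "(\<lambda>q. sqrt ((?x q)\<^sup>2)) \<longlonglongrightarrow> sqrt lrv" by (rule tendsto_real_sqrt)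
  then have "?x \<longlonglongrightarrow> sqrt lrv" by simp
  then have x: "(\<lambda>l. ?x (q l)) \<longlonglongrightarrow> sqrt lrv" using q by (rule filterlim_compose)
  have "\<bar>?y l - ?x (q l)\<bar> \<le> 3 / 2 * Theta_error l" for l
  proof (cases "q l = 0")
    case True
    then show ?thesis using Theta_error_nonneg[of l] by simp
  next
    case False
    let ?SX = "\<lambda>x. \<Sum>s\<in>{1..int (q l)}. X s x" and ?SY = "\<lambda>x. \<Sum>s\<in>{1..int (q l)}. trunc l s x"
    let ?SD = "\<lambda>x. \<Sum>s\<in>{1..int (q l)}. X s x - trunc l s x"
    have LX: "Lp_fun Om 2 ?SX" by (intro Lp_fun_sum Om.Lp_fun_mono[OF X_Lp]) auto
    have LY: "Lp_fun Om 2 ?SY" by (intro Lp_fun_sum Om.Lp_fun_mono[OF trunc_Lp]) auto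
    have LD: "Lp_fun Om 4 ?SD" by (intro Lp_fun_sum Lp_fun_diff X_Lp trunc_Lp) auto
    have LD2: "Lp_fun Om 2 ?SD" using LD by (rule Om.Lp_fun_mono) simp
    have d: "Lp_norm Om 2 ?SD \<le> 3 / 2 * Theta_error l * sqrt (real (q l))"
      using Om.Lp_norm_2_le_4[OF LD] linear_form_L4_bound[OF dependence_bound_diff_trunc, of "{1..int (q l)}" "\<lambda>_. 1" l] by simp
    have "Lp_norm Om 2 ?SX \<le> Lp_norm Om 2 ?SY + Lp_norm Om 2 ?SD"
      using Minkowski[OF _ LY LD2] by (simp add: sum_subtractf)
    moreover have "Lp_norm Om 2 ?SY \<le> Lp_norm Om 2 ?SX + Lp_norm Om 2 ?SD"
      using Minkowski_diff[OF _ LX LD2] by (simp add: sum_subtractf)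
    ultimately have "\<bar>Lp_norm Om 2 ?SY - Lp_norm Om 2 ?SX\<bar> \<le> 3 / 2 * Theta_error l * sqrt (real (q l))"
      using d by linarith
    moreover have r: "0 < sqrt (real (q l))" using False by simp
    ultimately have "\<bar>Lp_norm Om 2 ?SY - Lp_norm Om 2 ?SX\<bar> / sqrt (real (q l)) \<le> 3 / 2 * Theta_error l"
      by (simp only: pos_divide_le_eq)
    moreover have "?y l - ?x (q l) = (Lp_norm Om 2 ?SY - Lp_norm Om 2 ?SX) / sqrt (real (q l))"
      by (rule diff_divide_distrib[symmetric])
    ultimately show ?thesis using r by (simp only: abs_divide abs_of_pos)
  qed
  then have "\<forall>\<^sub>F l in sequentially. norm (?y l - ?x (q l)) \<le> 3 / 2 * Theta_error l"
    by (intro always_eventually allI) (simp only: real_norm_def)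
  then have "(\<lambda>l. ?y l - ?x (q l)) \<longlonglongrightarrow> 0"
    by (rule Lim_null_comparison[OF _ tendsto_mult_right_zero[OF Theta_error_tendsto]])
  from tendsto_add[OF this x] have "?y \<longlonglongrightarrow> sqrt lrv" by simp
  then have "(\<lambda>l. (?y l)\<^sup>2) \<longlonglongrightarrow> (sqrt lrv)\<^sup>2" by (rule tendsto_power)
  moreover have "(?y l)\<^sup>2 = partial_sum_var l (q l) / real (q l)" for l
    by (simp add: power_divide partial_sum_var_def Lp_norm_2_square)
  moreover have "lrv \<ge> 0"
    by (rule LIMSEQ_le_const[OF \<open>(\<lambda>q. (?x q)\<^sup>2) \<longlonglongrightarrow> lrv\<close>]) (auto simp: power_divide)
  ultimately show ?thesis by simp
qed

text \<open>For fixed l the bound of \<open>quad_form_char_bound\<close> tends to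
  \<open>R l 0 0\<close> as n grows, and this is small for large l. The normalization of p makes the
  squared Frobenius norm n^2 / 2 times 1 / (4 pi^2 n^2), which is the 1 / (8 pi^2) of the
  limit.\<close>

lemma quad_form_char_limit:
  fixes m :: "nat \<Rightarrow> nat" and p :: "nat \<Rightarrow> nat \<Rightarrow> real" and lrv v :: real
  defines "a \<equiv> \<lambda>n s t. trig_kernel n (m n) (p n) (s - t)"
  defines "T \<equiv> \<lambda>n x. quad_form n (a n) x - (\<integral>z. quad_form n (a n) z \<partial>Om)"
  assumes lrv: "(autocov has_sum lrv) UNIV"
    and m: "(\<lambda>n. real (m n) / real n) \<longlonglongrightarrow> 0"
    and p2: "\<forall>\<^sub>F n in sequentially. (\<Sum>j=1..m n. (p n j)\<^sup>2) = 1 / (4 * pi\<^sup>2 * (real n)\<^sup>2)"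
    and p4: "(\<lambda>n. (real n) ^ 4 * (\<Sum>j=1..m n. (p n j) ^ 4)) \<longlonglongrightarrow> 0"
  shows "(\<lambda>n. \<integral>x. iexp (v * T n x) \<partial>Om) \<longlonglongrightarrow> exp (- (lrv\<^sup>2 / (8 * pi\<^sup>2) * v\<^sup>2))"
proof -
  define s where "s = lrv\<^sup>2 / (8 * pi\<^sup>2)"
  define C where "C = 9 / 4 * Theta\<^sup>2"
  \<comment> \<open>A period quadratic in l makes the fraction l / L of gap times tend to 0. The
    next definition satisfies e^2 = (l + 1) / L, strictly above the limit of \<open>E l\<close> in
    n.\<close>
  define L where "L l = (l + 1)\<^sup>2" for l :: nat
  define e where "e l = 1 / sqrt (real (l + 1))" for l :: nat
  define vr where "vr l = partial_sum_var l (L l - l) / real (L l - l)" for l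
  define F2 where "F2 n = frobenius {1..int n} (mat_prod {1..int n} (a n) (a n))" for n
  \<comment> \<open>The common squared norm of the rows: n / 2 times 1 / (4 pi^2 n^2).\<close>
  define \<alpha> where "\<alpha> n = 1 / (8 * pi\<^sup>2 * real n)" for n :: nat
  \<comment> \<open>The bound of \<open>quad_form_char_bound\<close> with w = 1; f and \<tau> stand
    for the two quantities that still depend on n.\<close>
  define R where "R l f \<tau> = \<bar>v\<bar> * (6 * Theta * Theta_error l * 1 + 3 * Theta\<^sup>2 * e l) +
     \<bar>v\<bar> * (2 * \<bar>v\<bar> * (3 * Theta\<^sup>2 * C * (f + e l * (2 * 1 + e l))) + 6 * v\<^sup>2 * \<tau>) +
     v\<^sup>2 * (C\<^sup>2 * (e l * (2 * 1 + e l)) + \<bar>(vr l)\<^sup>2 * (1 / (8 * pi\<^sup>2)) - s\<bar>)" for l and f \<tau> :: real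
  define \<tau> where "\<tau> l n = real n * ((3 / 2 * Theta * sqrt (real (L l))) ^ 3 * (3 / 2 * Theta * sqrt (\<alpha> n)) ^ 3)" for l n
  \<comment> \<open>The left side of the condition on e^2 in
    \<open>quad_form_char_bound\<close>.\<close>
  define E where "E l n = 2 * (real n * real l / real (L l) + real (L l)) * \<alpha> n + real n * real (L l) * (real (m n) * (1 / (4 * pi\<^sup>2 * (real n)\<^sup>2)))
     + 4 * real n * (\<alpha> n * (2 * pi * real (m n) * real (L l) / real n)\<^sup>2)" for l n
  have lL: "l < L l" for l by (simp add: L_def power2_eq_square)
  have m_small: "\<forall>\<^sub>F n in sequentially. 2 * m n < n"
  proof -
    have "\<forall>\<^sub>F n in sequentially. real (m n) / real n < 1 / 2" using order_tendstoD(2)[OF m, of "1 / 2"] by simp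
    then show ?thesis using eventually_gt_at_top[of 0] by eventually_elim (simp add: field_simps)
  qed
  have inv_n: "(\<lambda>n. 1 / real n) \<longlonglongrightarrow> 0" by (rule lim_1_over_n)
  \<comment> \<open>By orthogonality the square of \<open>F2 n\<close> is n^4 / 8 times the sum of
    the fourth powers of the coefficients.\<close>
  have F2_lim: "F2 \<longlonglongrightarrow> 0"
  proof -
    have "\<forall>\<^sub>F n in sequentially. (F2 n)\<^sup>2 = (real n ^ 4 * (\<Sum>j=1..m n. (p n j) ^ 4)) / 8"
      using m_small
    proof eventually_elim
      case (elim n)
      have "(F2 n)\<^sup>2 = (real n)\<^sup>2 / 2 * (\<Sum>j=1..m n. (real n / 2 * (p n j)\<^sup>2)\<^sup>2)"
        unfolding F2_def a_def trig_kernel_mat_prod[OF elim] by (rule trig_kernel_frobenius[OF elim])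
      also have "(\<Sum>j=1..m n. (real n / 2 * (p n j)\<^sup>2)\<^sup>2) = (real n)\<^sup>2 / 4 * (\<Sum>j=1..m n. (p n j) ^ 4)"
        unfolding sum_distrib_left by (intro sum.cong refl) (simp add: power_mult_distrib power_divide flip: power_mult)
      finally show ?case by (simp add: power2_eq_square power4_eq_xxxx)
    qed
    moreover have "(\<lambda>n. (real n ^ 4 * (\<Sum>j=1..m n. (p n j) ^ 4)) / 8) \<longlonglongrightarrow> 0"
      using tendsto_divide_zero[OF p4] .
    ultimately have "(\<lambda>n. (F2 n)\<^sup>2) \<longlonglongrightarrow> 0" using tendsto_cong by fastforce
    then have "(\<lambda>n. sqrt ((F2 n)\<^sup>2)) \<longlonglongrightarrow> sqrt 0" by (rule tendsto_real_sqrt)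
    moreover have "sqrt ((F2 n)\<^sup>2) = F2 n" for n unfolding F2_def by simp
    ultimately show ?thesis by simp
  qed
  \<comment> \<open>For fixed l this is n times a constant multiple of n^(-3/2), hence of order
    n^(-1/2).\<close>
  have \<tau>_lim: "(\<lambda>n. \<tau> l n) \<longlonglongrightarrow> 0" for l
  proof -
    define c where "c = (3 / 2 * Theta * sqrt (real (L l))) ^ 3 * (3 / 2 * Theta / sqrt (8 * pi\<^sup>2)) ^ 3"
    have "\<tau> l n = c * sqrt (1 / real n)" if "n > 0" for n
    proof -
      define r where "r = sqrt (real n)"
      have r: "r > 0" "real n = r * r" using that by (auto simp: r_def)
      have "3 / 2 * Theta * sqrt (\<alpha> n) = (3 / 2 * Theta / sqrt (8 * pi\<^sup>2)) / r"
        unfolding \<alpha>_def r_def by (simp add: real_sqrt_divide real_sqrt_mult)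
      then have "\<tau> l n = real n * ((3 / 2 * Theta * sqrt (real (L l))) ^ 3 * ((3 / 2 * Theta / sqrt (8 * pi\<^sup>2)) / r) ^ 3)"
        unfolding \<tau>_def by (rule arg_cong[where f="\<lambda>z. real n * ((3 / 2 * Theta * sqrt (real (L l))) ^ 3 * z ^ 3)"])
      also have "\<dots> = c * (real n / r ^ 3)" unfolding c_def power_divide[of _ r] by simp
      also have "real n / r ^ 3 = sqrt (1 / real n)"
        using r by (simp add: real_sqrt_divide power3_eq_cube flip: r_def)
      finally show ?thesis .
    qed
    then have "\<forall>\<^sub>F n in sequentially. \<tau> l n = c * sqrt (1 / real n)"
      by (intro eventually_sequentiallyI[of 1]) auto
    moreover have "(\<lambda>n. c * sqrt (1 / real n)) \<longlonglongrightarrow> c * sqrt 0"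
      by (intro tendsto_mult tendsto_const tendsto_real_sqrt inv_n)
    ultimately show ?thesis using tendsto_cong by fastforce
  qed
  have E_small: "\<forall>\<^sub>F n in sequentially. E l n \<le> (e l)\<^sup>2" for l
  proof -
    \<comment> \<open>\<open>E l\<close> with the powers of n cancelled; only the gap fraction l / L
      survives in the limit.\<close>
    define G where "G n = 1 / (4 * pi\<^sup>2) * (real l / real (L l)) + real (L l) / (4 * pi\<^sup>2) * (1 / real n) + real (L l) / (4 * pi\<^sup>2) * (real (m n) / real n)
      + 2 * (real (L l))\<^sup>2 * (real (m n) / real n)\<^sup>2" for n
    have "E l n = G n" if "n > 0" for n
      using that lL[of l] unfolding E_def G_def \<alpha>_def by (simp add: field_simps power2_eq_square)
    then have "\<forall>\<^sub>F n in sequentially. E l n = G n" by (intro eventually_sequentiallyI[of 1]) auto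
    moreover have "G \<longlonglongrightarrow> 1 / (4 * pi\<^sup>2) * (real l / real (L l)) + real (L l) / (4 * pi\<^sup>2) * 0 + real (L l) / (4 * pi\<^sup>2) * 0 + 2 * (real (L l))\<^sup>2 * 0\<^sup>2"
      unfolding G_def[abs_def] by (intro tendsto_intros inv_n m)
    then have "G \<longlonglongrightarrow> 1 / (4 * pi\<^sup>2) * (real l / real (L l))" by simp
    moreover have "1 / (4 * pi\<^sup>2) * (real l / real (L l)) < (e l)\<^sup>2"
    proof -
      have "1 * 1 < pi * pi" using pi_gt3 by (intro mult_strict_mono) auto
      then have "1 / (4 * pi\<^sup>2) \<le> 1" by (simp add: power2_eq_square)
      then have "1 / (4 * pi\<^sup>2) * (real l / real (L l)) \<le> 1 * (real l / real (L l))"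
        by (intro mult_right_mono) auto
      also have "\<dots> < (real l + 1) / real (L l)" using lL[of l] by (simp add: divide_strict_right_mono)
      also have "\<dots> = (e l)\<^sup>2"
      proof -
        have "x / (x * x) = 1 / x" for x :: real by simp
        moreover have "real (L l) = real (l + 1) * real (l + 1)" by (simp only: L_def power2_eq_square of_nat_mult)
        moreover have "(e l)\<^sup>2 = 1 / real (l + 1)" unfolding e_def power_divide by simp
        moreover have "real l + 1 = real (l + 1)" by simp
        ultimately show ?thesis by (simp only:)
      qed
      finally show ?thesis .
    qed
    then have "\<forall>\<^sub>F n in sequentially. G n < (e l)\<^sup>2"
      using \<open>G \<longlonglongrightarrow> 1 / (4 * pi\<^sup>2) * (real l / real (L l))\<close> by (rule order_tendstoD(2)[rotated])
    ultimately show ?thesis by (auto elim: eventually_elim2)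
  qed
  have main: "\<forall>\<^sub>F n in sequentially. cmod ((\<integral>x. iexp (v * T n x) \<partial>Om) - exp (- (s * v\<^sup>2))) \<le> R l (F2 n) (\<tau> l n)" for l
    using m_small p2 E_small[of l] eventually_gt_at_top[of 0]
  proof eventually_elim
    case (elim n)
    let ?I = "{1..int n}"
    have row: "(\<Sum>t\<in>?I. (a n s t)\<^sup>2) \<le> \<alpha> n" for s
      unfolding a_def trig_kernel_row[OF elim(1)] elim(2) \<alpha>_def using elim(4) by (simp add: power2_eq_square)
    have fro: "(frobenius ?I (a n))\<^sup>2 = 1 / (8 * pi\<^sup>2)"
      unfolding a_def trig_kernel_frobenius[OF elim(1)] elim(2) using elim(4) by simp
    \<comment> \<open>The exact value 1 / (8 pi^2) of the square is below 1, so w = 1 serves for all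
      n.\<close>
    have fro1: "frobenius ?I (a n) \<le> 1"
    proof (rule power2_le_imp_le)
      have "1 * 1 < pi * pi" using pi_gt3 by (intro mult_strict_mono) auto
      then show "(frobenius ?I (a n))\<^sup>2 \<le> 1\<^sup>2" unfolding fro by (simp add: power2_eq_square)
    qed simp
    have smooth: "(\<Sum>t\<in>?I. (a n s t - a n s' t)\<^sup>2) \<le> \<alpha> n * (2 * pi * real (m n) * real (L l) / real n)\<^sup>2"
      if "\<bar>s - s'\<bar> \<le> int (L l)" for s s'
    proof -
      have "real n / 2 * (\<Sum>j=1..m n. (p n j)\<^sup>2) = \<alpha> n"
        unfolding elim(2) \<alpha>_def using elim(4) by (simp add: power2_eq_square)
      then show ?thesis using trig_kernel_smooth[OF elim(1) that, of "p n"] by (simp add: a_def)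
    qed
    have diag: "(a n s t)\<^sup>2 \<le> real (m n) * (1 / (4 * pi\<^sup>2 * (real n)\<^sup>2))" for s t
      unfolding a_def using trig_kernel_square_le[of n "m n" "p n" "s - t"] elim(2) by simp
    have sym: "a n s t = a n t s" for s t
      unfolding a_def using trig_kernel_minus[of n "m n" "p n" "s - t"] by simp
    have "cmod ((\<integral>x. iexp (v * (quad_form n (a n) x - (\<integral>z. quad_form n (a n) z \<partial>Om))) \<partial>Om) - exp (- (s * v\<^sup>2))) \<le>
     \<bar>v\<bar> * (6 * Theta * Theta_error l * 1 + 3 * Theta\<^sup>2 * e l) +
     \<bar>v\<bar> * (2 * \<bar>v\<bar> * (3 * Theta\<^sup>2 * (9 / 4 * Theta\<^sup>2) * (frobenius ?I (mat_prod ?I (a n) (a n)) + e l * (2 * 1 + e l))) +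
       6 * v\<^sup>2 * (real n * ((3 / 2 * Theta * sqrt (real (L l))) ^ 3 * (3 / 2 * Theta * sqrt (\<alpha> n)) ^ 3))) +
     v\<^sup>2 * ((9 / 4 * Theta\<^sup>2)\<^sup>2 * (e l * (2 * 1 + e l)) + \<bar>(partial_sum_var l (L l - l) / real (L l - l))\<^sup>2 * (frobenius ?I (a n))\<^sup>2 - s\<bar>)"
    proof (rule quad_form_char_bound[OF lL sym row smooth diag])
      show "2 * (real n * real l / real (L l) + real (L l)) * \<alpha> n + real n * real (L l) * (real (m n) * (1 / (4 * pi\<^sup>2 * (real n)\<^sup>2)))
         + 4 * real n * (\<alpha> n * (2 * pi * real (m n) * real (L l) / real n)\<^sup>2) \<le> (e l)\<^sup>2"
        using elim(3) by (simp only: E_def)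
    qed (use elim fro1 in \<open>auto simp: \<alpha>_def s_def e_def\<close>)
    then show ?case
      unfolding T_def R_def F2_def \<tau>_def C_def vr_def fro .
  qed
  have R_lim: "(\<lambda>l. R l 0 0) \<longlonglongrightarrow> 0"
  proof -
    have e: "e \<longlonglongrightarrow> 0"
    proof -
      have "(\<lambda>l. sqrt (1 / real (Suc l))) \<longlonglongrightarrow> sqrt 0"
        by (intro tendsto_real_sqrt LIMSEQ_Suc[OF inv_n])
      then show ?thesis by (simp add: e_def[abs_def] real_sqrt_divide)
    qed
    have "filterlim (\<lambda>l. L l - l) at_top sequentially"
      by (rule filterlim_at_top_mono[OF filterlim_ident]) (auto simp: L_def power2_eq_square)
    from long_run_variance_tendsto[OF lrv this]
    have vr: "vr \<longlonglongrightarrow> lrv" by (simp add: vr_def[abs_def])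
    have "(\<lambda>l. R l 0 0) \<longlonglongrightarrow> \<bar>v\<bar> * (6 * Theta * 0 * 1 + 3 * Theta\<^sup>2 * 0) +
     \<bar>v\<bar> * (2 * \<bar>v\<bar> * (3 * Theta\<^sup>2 * C * (0 + 0 * (2 * 1 + 0))) + 6 * v\<^sup>2 * 0) +
     v\<^sup>2 * (C\<^sup>2 * (0 * (2 * 1 + 0)) + \<bar>lrv\<^sup>2 * (1 / (8 * pi\<^sup>2)) - s\<bar>)"
      unfolding R_def by (intro tendsto_intros e vr Theta_error_tendsto)
    then show ?thesis by (simp add: s_def)
  qed
  show ?thesis
  proof (rule LIMSEQ_I)
    fix r :: real assume "r > 0"
    obtain l where l: "R l 0 0 < r"
      using order_tendstoD(2)[OF R_lim \<open>r > 0\<close>] by (auto simp: eventually_sequentially)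
    have "(\<lambda>n. R l (F2 n) (\<tau> l n)) \<longlonglongrightarrow> R l 0 0"
      unfolding R_def by (intro tendsto_intros F2_lim \<tau>_lim)
    from order_tendstoD(2)[OF this l] main[of l]
    have "\<forall>\<^sub>F n in sequentially. norm ((\<integral>x. iexp (v * T n x) \<partial>Om) - exp (- (s * v\<^sup>2))) < r"
      by eventually_elim simp
    then show "\<exists>no. \<forall>n\<ge>no. norm ((\<integral>x. iexp (v * T n x) \<partial>Om) - exp (- (lrv\<^sup>2 / (8 * pi\<^sup>2) * v\<^sup>2))) < r"
      by (auto simp: eventually_sequentially s_def)
  qed
qed

end

subsection \<open>Weighted periodograms as quadratic forms\<close>

lemma cmod_square_fourier_sum:
  fixes x :: "nat \<Rightarrow> real"
  shows "(cmod (\<Sum>t=1..n. of_real (x t) * exp (- (\<i> * of_nat t * of_real \<omega>))))\<^sup>2 =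
    (\<Sum>s=1..n. \<Sum>t=1..n. x s * x t * cos ((real s - real t) * \<omega>))"
proof -
  let ?S = "\<Sum>t=1..n. of_real (x t) * exp (- (\<i> * of_nat t * of_real \<omega>))"
  have e: "exp (- (\<i> * of_nat t * of_real \<omega>)) = cis (- (real t * \<omega>))" for t
    by (simp add: cis_conv_exp mult.assoc)
  have Re: "Re ?S = (\<Sum>t=1..n. x t * cos (real t * \<omega>))" and Im: "Im ?S = - (\<Sum>t=1..n. x t * sin (real t * \<omega>))"
    unfolding e by (simp_all add: sum_negf)
  have "(cmod ?S)\<^sup>2 = (\<Sum>t=1..n. x t * cos (real t * \<omega>))\<^sup>2 + (\<Sum>t=1..n. x t * sin (real t * \<omega>))\<^sup>2"
    unfolding cmod_power2 Re Im by simp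
  also have "\<dots> = (\<Sum>s=1..n. \<Sum>t=1..n. x s * x t * cos ((real s - real t) * \<omega>))"
    unfolding power2_eq_square sum_product sum.distrib[symmetric]
    by (intro sum.cong refl) (simp add: left_diff_distrib cos_diff algebra_simps)
  finally show ?thesis .
qed

text \<open>The squared modulus of the Fourier sum yields the cosines of time differences; the
  prefactor cancels one of the two powers of the norm in the definition of the statistic.\<close>

lemma weighted_periodogram_eq_quadratic_form:
  assumes n: "n > 0" and v: "vec_norm 2 m v > 0"
  shows "vec_norm 2 m v * weighted_periodogram X n m v w =
    (\<Sum>s\<in>{1..int n}. \<Sum>t\<in>{1..int n}. trig_kernel n m (\<lambda>j. v j / (2 * pi * real n * vec_norm 2 m v)) (s - t) * (X s w * X t w))"
proof -
  let ?k = "vec_norm 2 m v"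
  let ?c = "\<lambda>j s t. cos ((real s - real t) * fourier_freq n j)"
  have per: "periodogram X n (fourier_freq n j) w = 1 / (2 * pi * real n) * (\<Sum>s=1..n. \<Sum>t=1..n. X (int s) w * X (int t) w * ?c j s t)" for j
    unfolding periodogram_def norm_mult power_mult_distrib cmod_square_fourier_sum
    by (simp add: norm_divide power_divide)
  have nat_int: "(\<Sum>s\<in>{1..int n}. F s) = (\<Sum>s=1..n. F (int s))" for F :: "int \<Rightarrow> real"
    by (rule sum.reindex_bij_witness[of _ int nat]) auto
  have "?k * weighted_periodogram X n m v w = (\<Sum>j=1..m. v j / (2 * pi * real n * ?k) * (\<Sum>s=1..n. \<Sum>t=1..n. X (int s) w * X (int t) w * ?c j s t))"
    unfolding weighted_periodogram_def per sum_distrib_left[of _ _ "{1..m}"]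
    using v n by (intro sum.cong refl) (simp add: power2_eq_square)
  also have "\<dots> = (\<Sum>s=1..n. \<Sum>t=1..n. \<Sum>j=1..m. v j / (2 * pi * real n * ?k) * (X (int s) w * X (int t) w * ?c j s t))"
    unfolding sum_distrib_left by (subst sum.swap) (intro sum.cong refl sum.swap)
  also have "\<dots> = (\<Sum>s=1..n. \<Sum>t=1..n. trig_kernel n m (\<lambda>j. v j / (2 * pi * real n * ?k)) (int s - int t) * (X (int s) w * X (int t) w))"
    unfolding trig_kernel_def sum_distrib_right by (intro sum.cong refl) (simp add: mult_ac)
  finally show ?thesis unfolding nat_int .
qed

lemma vec_norm_2_square: "(vec_norm 2 m v)\<^sup>2 = (\<Sum>j=1..m. (v j)\<^sup>2)"
proof -
  have "vec_norm 2 m v = root 2 (\<Sum>j=1..m. (v j)\<^sup>2)"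
    unfolding vec_norm_def by (simp add: root_powr_inverse sum_nonneg)
  then show ?thesis by (simp add: sum_nonneg)
qed

lemma vec_norm_4_power4: "(vec_norm 4 m v) ^ 4 = (\<Sum>j=1..m. (v j) ^ 4)"
proof -
  have "vec_norm 4 m v = root 4 (\<Sum>j=1..m. (v j) ^ 4)"
    unfolding vec_norm_def by (simp add: root_powr_inverse sum_nonneg)
  then show ?thesis by (simp add: sum_nonneg)
qed

lemma rv_norm_eq_Lp_norm: "rv_norm M 4 f = Lp_norm M 4 f"
  unfolding rv_norm_def Lp_norm_def by (simp add: root_powr_inverse)

lemma distr_iid:
  fixes \<epsilon> :: "int \<Rightarrow> 'w \<Rightarrow> 's"
  assumes "prob_space M" "iid M S \<epsilon>"
  shows "distr M (\<Pi>\<^sub>M t\<in>UNIV. S) (\<lambda>w t. \<epsilon> t w) = (\<Pi>\<^sub>M t\<in>UNIV. distr M S (\<epsilon> 0))"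
    and "\<epsilon> t \<in> M \<rightarrow>\<^sub>M S"
proof -
  interpret prob_space M by fact
  have iv: "indep_vars (\<lambda>_. S) \<epsilon> UNIV" using assms(2) by (simp add: iid_def)
  have m: "\<epsilon> t \<in> M \<rightarrow>\<^sub>M S" for t using iv by (simp add: indep_vars_def)
  then show "\<epsilon> t \<in> M \<rightarrow>\<^sub>M S" .
  have law: "(\<lambda>t. distr M S (\<epsilon> t)) = (\<lambda>t. distr M S (\<epsilon> 0))" using assms(2) unfolding iid_def by blast
  show "distr M (\<Pi>\<^sub>M t\<in>UNIV. S) (\<lambda>w t. \<epsilon> t w) = (\<Pi>\<^sub>M t\<in>UNIV. distr M S (\<epsilon> 0))"
    using indep_vars_iff_distr_eq_PiM[where I=UNIV and M'="\<lambda>_. S" and X=\<epsilon>] iv m by (simp add: restrict_def law)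
qed

theorem theorem7:
  fixes M :: "'w measure" and S :: "'s measure"
    and \<epsilon> \<epsilon>' :: "int \<Rightarrow> 'w \<Rightarrow> 's"
    and g :: "(nat \<Rightarrow> 's) \<Rightarrow> real"
    and X :: "int \<Rightarrow> 'w \<Rightarrow> real"
    and m :: "nat \<Rightarrow> nat"
    and \<kappa> :: "nat \<Rightarrow> nat \<Rightarrow> real"
    and W :: "nat \<Rightarrow> 'w \<Rightarrow> real"
  defines "X \<equiv> bernoulli_shift g \<epsilon>"
    and "W \<equiv> \<lambda>n. weighted_periodogram X n (m n) (\<kappa> (m n))"
  assumes "prob_space M"
    and "iid M S \<epsilon>"
    and "independent_copy M S \<epsilon> \<epsilon>'"
    and "g \<in> borel_measurable (\<Pi>\<^sub>M k\<in>UNIV. S)"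
    and "(\<integral>w. X 0 w \<partial>M) = 0"
    and "integrable M (\<lambda>w. \<bar>X 0 w\<bar> ^ 4)"
    and "summable (\<lambda>t. rv_norm M 4 (\<lambda>w. X (int t) w - coupled_shift g \<epsilon> \<epsilon>' (int t) w))"
    and "spectral_density M X 0 > 0"
    and "\<forall>n\<ge>1. m n \<ge> 1"
    and "filterlim m at_top sequentially"
    and "(\<lambda>n. real (m n)) \<in> o(\<lambda>n. real n)"
    and "\<forall>k\<ge>1. \<exists>j\<in>{1..k}. \<kappa> k j \<noteq> 0"
    and "(\<lambda>n. vec_norm 4 (m n) (\<kappa> (m n)) / vec_norm 2 (m n) (\<kappa> (m n))) \<longlonglongrightarrow> 0"
    and "(\<lambda>n. (\<Sum>j=1..m n. (\<kappa> (m n) j)\<^sup>2 * (sin (fourier_freq n j / 2))\<^sup>2)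
              / (vec_norm 2 (m n) (\<kappa> (m n)))\<^sup>2) \<longlonglongrightarrow> 0"
  shows "weak_conv_m
           (\<lambda>n. distr M borel (\<lambda>w. vec_norm 2 (m n) (\<kappa> (m n)) / spectral_density M X 0
                                     * (W n w - (\<integral>u. W n u \<partial>M))))
           std_normal_distribution"
proof -
  interpret M: prob_space M by fact

  \<comment> \<open>Transfer to the canonical sequence space\<close>
  note iid = \<open>iid M S \<epsilon>\<close> and copy = \<open>independent_copy M S \<epsilon> \<epsilon>'\<close>
  define \<mu> where "\<mu> = distr M S (\<epsilon> 0)"
  have m\<epsilon> [measurable]: "\<epsilon> t \<in> M \<rightarrow>\<^sub>M S" for t by (rule distr_iid(2)[OF \<open>prob_space M\<close> iid])
  interpret iid_sequence \<mu>
    by (rule iid_sequence.intro) (simp add: \<mu>_def M.prob_space_distr[OF m\<epsilon>])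
  have sets_\<mu> [measurable_cong]: "sets \<mu> = sets S" by (simp add: \<mu>_def)
  have sets_P: "sets (\<Pi>\<^sub>M t\<in>UNIV. S) = sets (\<Pi>\<^sub>M t\<in>UNIV. \<mu>)"
    by (rule sets_PiM_cong) (simp_all add: sets_\<mu>)
  define e where "e = (\<lambda>w t. \<epsilon> t w)"
  define e' where "e' = (\<lambda>w t. \<epsilon>' t w)"
  have law_e: "distr M Om e = Om"
    using distr_iid(1)[OF \<open>prob_space M\<close> iid] distr_cong[OF refl sets_P, of M e e] by (simp add: e_def \<mu>_def)
  have copy': "M.indep_var (\<Pi>\<^sub>M t\<in>UNIV. S) e (\<Pi>\<^sub>M t\<in>UNIV. S) e'"
      "distr M (\<Pi>\<^sub>M t\<in>UNIV. S) e' = distr M (\<Pi>\<^sub>M t\<in>UNIV. S) e"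
    using copy unfolding independent_copy_def Let_def e_def e'_def by auto
  have joint: "distr M (\<Pi>\<^sub>M t\<in>UNIV. S) e \<Otimes>\<^sub>M distr M (\<Pi>\<^sub>M t\<in>UNIV. S) e' = distr M ((\<Pi>\<^sub>M t\<in>UNIV. S) \<Otimes>\<^sub>M (\<Pi>\<^sub>M t\<in>UNIV. S)) (\<lambda>w. (e w, e' w))"
    and me: "e \<in> M \<rightarrow>\<^sub>M (\<Pi>\<^sub>M t\<in>UNIV. S)" and me': "e' \<in> M \<rightarrow>\<^sub>M (\<Pi>\<^sub>M t\<in>UNIV. S)"
    using copy'(1) unfolding M.indep_var_distribution_eq by auto
  have me_Om [measurable]: "e \<in> M \<rightarrow>\<^sub>M Om" "e' \<in> M \<rightarrow>\<^sub>M Om"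
    using me me' by (simp_all cong: measurable_cong_sets add: measurable_cong_sets[OF refl sets_P])
  \<comment> \<open>The innovations together with their copy have the law of the canonical pair, so
    the coupling distances on M become influences.\<close>
  have law_ee: "distr M Om2 (\<lambda>w. (e w, e' w)) = Om2"
  proof -
    have "distr M ((\<Pi>\<^sub>M t\<in>UNIV. S) \<Otimes>\<^sub>M (\<Pi>\<^sub>M t\<in>UNIV. S)) (\<lambda>w. (e w, e' w)) = Om2"
      using joint copy'(2) distr_iid(1)[OF \<open>prob_space M\<close> iid] by (simp add: e_def \<mu>_def)
    moreover have "distr M ((\<Pi>\<^sub>M t\<in>UNIV. S) \<Otimes>\<^sub>M (\<Pi>\<^sub>M t\<in>UNIV. S)) (\<lambda>w. (e w, e' w)) = distr M Om2 (\<lambda>w. (e w, e' w))"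
      by (rule distr_cong) (auto intro!: sets_pair_measure_cong sets_P)
    ultimately show ?thesis by simp
  qed
  define Y where "Y t x = g (\<lambda>k. x (t - int k))" for t :: int and x :: "int \<Rightarrow> 's"
  have XY: "X t w = Y t (e w)" for t w by (simp add: X_def bernoulli_shift_def Y_def e_def)
  have coupled: "coupled_shift g \<epsilon> \<epsilon>' t w = Y t (mix {0} (e w) (e' w))" for t w
    unfolding coupled_shift_def bernoulli_shift_def Y_def e_def e'_def mix_def
    by (rule arg_cong[where f=g]) auto
  have g: "g \<in> borel_measurable (\<Pi>\<^sub>M k\<in>UNIV. \<mu>)"
    using \<open>g \<in> _\<close> by (simp add: measurable_cong_sets[OF sets_PiM_cong[OF refl sets_\<mu>] refl])
  have mY [measurable]: "Y t \<in> borel_measurable Om" for t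
  proof -
    have "(\<lambda>x k. x (t - int k)) \<in> Om \<rightarrow>\<^sub>M (\<Pi>\<^sub>M k\<in>UNIV. \<mu>)"
      by (rule measurable_abs_UNIV) (rule component_measurable)
    from measurable_compose[OF this g] show ?thesis by (simp add: Y_def[abs_def])
  qed
  have int_e: "(\<integral>w. f (e w) \<partial>M) = (\<integral>x. f x \<partial>Om)" if "f \<in> borel_measurable Om"
    for f :: "(int \<Rightarrow> 's) \<Rightarrow> 'b :: {banach, second_countable_topology}"
    using integral_distr[OF me_Om(1) that] by (simp add: law_e)
  have Y_stat: "Y t x = Y 0 (shift_seq t x)" for t x
    unfolding Y_def shift_seq_def by (simp add: algebra_simps)
  have Y0: "Lp_fun Om 4 (Y 0)"
    using Lp_fun_distr[OF me_Om(1) mY, of 4 0] \<open>integrable M (\<lambda>w. \<bar>X 0 w\<bar> ^ 4)\<close>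
    by (simp add: law_e XY Lp_fun_def)
  interpret causal_process \<mu> Y
  proof
    show "Lp_fun Om 4 (Y 0)" by fact
    show "(\<integral>x. Y 0 x \<partial>Om) = 0" using \<open>(\<integral>w. X 0 w \<partial>M) = 0\<close> int_e[OF mY, of 0] by (simp add: XY)
    show "Y t x = Y 0 (shift_seq t x)" for t x by (rule Y_stat)
    show "Y 0 (mix A x y) = Y 0 x" if "A \<subseteq> {0<..}" for A x y
    proof -
      have "- int k \<notin> A" for k using that by auto
      then show ?thesis by (simp add: Y_def mix_def)
    qed
    \<comment> \<open>Shifting time by j moves the replaced innovation from 0 to -j.\<close>
    have "rv_norm M 4 (\<lambda>w. X (int j) w - coupled_shift g \<epsilon> \<epsilon>' (int j) w) = influence 4 (Y 0) (- int j)" for j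
    proof -
      have "influence 4 (Y 0) (- int j) = influence 4 (Y (int j)) 0"
      proof -
        have Yj: "Y (int j) = (\<lambda>x. Y 0 (shift_seq (int j) x))" by (rule ext) (rule Y_stat)
        show ?thesis using influence_shift[OF mY, of 4 0 "int j" 0] by (simp only: Yj diff_0)
      qed
      also have "\<dots> = Lp_norm (distr M Om2 (\<lambda>w. (e w, e' w))) 4 (\<lambda>q. Y (int j) (fst q) - Y (int j) (resample {0} q))"
        unfolding influence_def law_ee ..
      also have "\<dots> = Lp_norm M 4 (\<lambda>w. Y (int j) (e w) - Y (int j) (mix {0} (e w) (e' w)))"
        by (subst Lp_norm_distr) auto
      finally show ?thesis by (simp add: rv_norm_eq_Lp_norm XY coupled)
    qed
    then show "summable (\<lambda>j. influence 4 (Y 0) (- int j))"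
      using \<open>summable (\<lambda>t. rv_norm M 4 _)\<close> by simp
  qed

  \<comment> \<open>Identification of the long-run variance with 2 pi f(0)\<close>
  define f0 where "f0 = spectral_density M X 0"
  have f0: "f0 > 0" using \<open>spectral_density M X 0 > 0\<close> by (simp add: f0_def)
  have cov: "covariance M (X h) (X 0) = autocov h" for h
  proof -
    have "(\<integral>w. X t w \<partial>M) = 0" for t using int_e[OF mY, of t] by (simp add: XY X_mean)
    then have "covariance M (X h) (X 0) = (\<integral>w. Y h (e w) * Y 0 (e w) \<partial>M)"
      by (simp add: covariance_def XY)
    also have "\<dots> = autocov h" unfolding autocov_def by (rule int_e[of "\<lambda>x. Y h x * Y 0 x"]) measurable
    finally show ?thesis .
  qed
  text \<open>A positive spectral density rules out the junk value 0 of a divergent sum.\<close>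
  have lrv: "(autocov has_sum (2 * pi * f0)) UNIV"
  proof -
    let ?c = "\<lambda>h. complex_of_real (autocov h)"
    have f0_eq: "f0 = Re (infsum ?c UNIV) / (2 * pi)"
    proof -
      have "1 / (2 * complex_of_real pi) = complex_of_real (1 / (2 * pi))" by simp
      then show ?thesis unfolding f0_def spectral_density_def cov by simp
    qed
    have "?c summable_on UNIV"
    proof (rule ccontr)
      assume "\<not> ?c summable_on UNIV"
      then have "infsum ?c UNIV = 0" by (rule infsum_not_exists)
      then show False using f0 f0_eq by simp
    qed
    then have "(?c has_sum infsum ?c UNIV) UNIV" by (rule has_sum_infsum)
    from has_sum_bounded_linear[OF bounded_linear_Re this]
    have "(autocov has_sum Re (infsum ?c UNIV)) UNIV" by (simp add: comp_def)
    then show ?thesis by (simp add: f0_eq)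
  qed

  \<comment> \<open>Normalization of the weights and limit of the characteristic functions\<close>
  define k2 where "k2 n = vec_norm 2 (m n) (\<kappa> (m n))" for n
  define p where "p n j = \<kappa> (m n) j / (2 * pi * real n * k2 n)" for n j
  define T where "T n x = quad_form n (\<lambda>s t. trig_kernel n (m n) (p n) (s - t)) x
      - (\<integral>z. quad_form n (\<lambda>s t. trig_kernel n (m n) (p n) (s - t)) z \<partial>Om)" for n x
  \<comment> \<open>The dimension m n is known to be positive only for n \<ge> 1, whence this
    restriction here and below.\<close>
  have k2_pos: "k2 n > 0" if "n \<ge> 1" for n
  proof -
    obtain j where j: "j \<in> {1..m n}" "\<kappa> (m n) j \<noteq> 0"
      using \<open>\<forall>n\<ge>1. m n \<ge> 1\<close> \<open>\<forall>k\<ge>1. \<exists>j\<in>{1..k}. \<kappa> k j \<noteq> 0\<close> \<open>n \<ge> 1\<close> by blast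
    have "0 < (\<Sum>j=1..m n. (\<kappa> (m n) j)\<^sup>2)"
      by (rule sum_pos2[OF _ j(1)]) (use j(2) in auto)
    then have "(k2 n)\<^sup>2 > 0" by (simp only: k2_def vec_norm_2_square)
    then have "k2 n \<noteq> 0" by auto
    moreover have "k2 n \<ge> 0" by (simp add: k2_def vec_norm_def)
    ultimately show ?thesis by simp
  qed
  have stat: "k2 n / f0 * (W n w - (\<integral>u. W n u \<partial>M)) = 1 / f0 * T n (e w)" if "n \<ge> 1" for n w
  proof -
    let ?q = "quad_form n (\<lambda>s t. trig_kernel n (m n) (p n) (s - t))"
    have q: "k2 n * W n w = ?q (e w)" for w
      using weighted_periodogram_eq_quadratic_form[of n "m n" "\<kappa> (m n)" X w] k2_pos[OF that] that
      by (simp add: W_def quad_form_def p_def[abs_def] k2_def XY)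
    have "k2 n * (\<integral>u. W n u \<partial>M) = (\<integral>u. ?q (e u) \<partial>M)" using q by (simp flip: integral_mult_right_zero)
    also have "\<dots> = (\<integral>z. ?q z \<partial>Om)" by (rule int_e[OF Lp_fun_measurable[OF quad_form_Lp]])
    finally show ?thesis using q[of w] unfolding T_def by (simp add: right_diff_distrib)
  qed
  have char_lim: "(\<lambda>n. \<integral>x. iexp (v * T n x) \<partial>Om) \<longlonglongrightarrow> exp (- ((2 * pi * f0)\<^sup>2 / (8 * pi\<^sup>2) * v\<^sup>2))" for v
    unfolding T_def
  proof (rule quad_form_char_limit[OF lrv])
    show "(\<lambda>n. real (m n) / real n) \<longlonglongrightarrow> 0"
      using smalloD_tendsto[OF \<open>(\<lambda>n. real (m n)) \<in> o(\<lambda>n. real n)\<close>] .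
    have p2: "(\<Sum>j=1..m n. (p n j)\<^sup>2) = 1 / (4 * pi\<^sup>2 * (real n)\<^sup>2)" if "n \<ge> 1" for n
    proof -
      have "(\<Sum>j=1..m n. (p n j)\<^sup>2) = (\<Sum>j=1..m n. (\<kappa> (m n) j)\<^sup>2) / (4 * pi\<^sup>2 * (real n)\<^sup>2 * (k2 n)\<^sup>2)"
        unfolding sum_divide_distrib p_def by (intro sum.cong refl) (simp add: power_divide power_mult_distrib)
      also have "(\<Sum>j=1..m n. (\<kappa> (m n) j)\<^sup>2) = (k2 n)\<^sup>2" unfolding k2_def by (rule vec_norm_2_square[symmetric])
      finally show ?thesis using k2_pos[OF that] by simp
    qed
    then show "\<forall>\<^sub>F n in sequentially. (\<Sum>j=1..m n. (p n j)\<^sup>2) = 1 / (4 * pi\<^sup>2 * (real n)\<^sup>2)"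
      by (rule eventually_sequentiallyI)
    let ?r = "\<lambda>n. vec_norm 4 (m n) (\<kappa> (m n)) / vec_norm 2 (m n) (\<kappa> (m n))"
    have "(real n) ^ 4 * (\<Sum>j=1..m n. (p n j) ^ 4) = (?r n) ^ 4 / (2 * pi) ^ 4" if "n \<ge> 1" for n
    proof -
      have "(\<Sum>j=1..m n. (p n j) ^ 4) = (\<Sum>j=1..m n. (\<kappa> (m n) j) ^ 4) / ((2 * pi) ^ 4 * (real n) ^ 4 * (k2 n) ^ 4)"
        unfolding sum_divide_distrib p_def by (intro sum.cong refl) (simp only: power_divide power_mult_distrib)
      then show ?thesis
        unfolding vec_norm_4_power4[symmetric] k2_def[symmetric] using that by (simp add: power_divide)
    qed
    then have ev: "\<forall>\<^sub>F n in sequentially. (real n) ^ 4 * (\<Sum>j=1..m n. (p n j) ^ 4) = (?r n) ^ 4 / (2 * pi) ^ 4"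
      by (rule eventually_sequentiallyI)
    have "(\<lambda>n. (?r n) ^ 4 / (2 * pi) ^ 4) \<longlonglongrightarrow> 0 ^ 4 / (2 * pi) ^ 4"
      using \<open>?r \<longlonglongrightarrow> 0\<close> by (intro tendsto_divide tendsto_power tendsto_const) auto
    then have "(\<lambda>n. (?r n) ^ 4 / (2 * pi) ^ 4) \<longlonglongrightarrow> 0" by simp
    with ev show "(\<lambda>n. (real n) ^ 4 * (\<Sum>j=1..m n. (p n j) ^ 4)) \<longlonglongrightarrow> 0"
      by (rule tendsto_cong[THEN iffD2])
  qed

  \<comment> \<open>Conclusion by Levy's continuity theorem\<close>
  define F where "F n w = vec_norm 2 (m n) (\<kappa> (m n)) / spectral_density M X 0 * (W n w - (\<integral>u. W n u \<partial>M))" for n w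
  have F_eq: "F n w = 1 / f0 * T n (e w)" if "n \<ge> 1" for n w
    using stat[OF that] by (simp add: F_def k2_def f0_def)
  \<comment> \<open>Derived from the definition of W rather than from \<open>F_eq\<close>, because
    the continuity theorem asks for a distribution at every n, including n = 0.\<close>
  have mF [measurable]: "F n \<in> borel_measurable M" for n
  proof -
    have [measurable]: "X t \<in> borel_measurable M" for t
      unfolding XY[abs_def] by measurable
    show ?thesis
      unfolding F_def[abs_def] W_def weighted_periodogram_def[abs_def] periodogram_def[abs_def] by measurable
  qed
  have "weak_conv_m (\<lambda>n. distr M borel (F n)) std_normal_distribution"
  proof (rule levy_continuity)
    show "real_distribution (distr M borel (F n))" for n by (rule M.real_distribution_distr) (rule mF)
    show "real_distribution std_normal_distribution" by (rule real_dist_normal_dist)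
    fix u :: real
    have mT [measurable]: "T n \<in> borel_measurable Om" for n
      unfolding T_def[abs_def] using Lp_fun_measurable[OF quad_form_Lp] by measurable
    have "char (distr M borel (F n)) u = (\<integral>x. iexp ((u / f0) * T n x) \<partial>Om)" if "n \<ge> 1" for n
    proof -
      have "char (distr M borel (F n)) u = (\<integral>w. iexp (u * F n w) \<partial>M)"
        unfolding char_def by (rule integral_distr) auto
      also have "\<dots> = (\<integral>w. iexp ((u / f0) * T n (e w)) \<partial>M)" by (simp add: F_eq[OF that])
      also have "\<dots> = (\<integral>x. iexp ((u / f0) * T n x) \<partial>Om)"
        by (rule int_e[of "\<lambda>x. iexp ((u / f0) * T n x)"]) measurable
      finally show ?thesis .
    qed
    then have ev: "\<forall>\<^sub>F n in sequentially. char (distr M borel (F n)) u = (\<integral>x. iexp ((u / f0) * T n x) \<partial>Om)"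
      by (rule eventually_sequentiallyI)
    \<comment> \<open>The exponent (2 pi f(0))^2 / (8 pi^2) = f(0)^2 / 2 meets the argument u /
      f(0), which leaves the standard normal exponent.\<close>
    have var_eq: "(2 * pi * f0)\<^sup>2 / (8 * pi\<^sup>2) * (u / f0)\<^sup>2 = u\<^sup>2 / 2"
      using f0 by (simp add: power_divide power_mult_distrib)
    have char_eq: "char std_normal_distribution u = exp (- (u\<^sup>2 / 2))"
      by (simp add: char_std_normal_distribution)
    have "(\<lambda>n. \<integral>x. iexp ((u / f0) * T n x) \<partial>Om) \<longlonglongrightarrow> char std_normal_distribution u"
      using char_lim[of "u / f0"] unfolding var_eq char_eq .
    then show "(\<lambda>n. char (distr M borel (F n)) u) \<longlonglongrightarrow> char std_normal_distribution u"
      by (rule tendsto_cong[THEN iffD2, OF ev])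
  qed
  then show ?thesis by (simp add: F_def[abs_def])
qed

end
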